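(* Let $a>0$, $m\in\mathbb R$, $3M=m^2-2a^{-2}-a^4$, $k=\sqrt{3M}$, and let $f$ be the hyperbolic affine sphere obtained from the Delaunay-type potential at $\lambda=-i$ (see context), with $t=x+iy$, $x\in\mathbb R\setminus\tilde\Lambda$, $y\in\mathbb R$. (i) If $3M=m^2-2a^{-2}-a^4<0$, then $$\gamma_1:=\frac ik\begin{pmatrix} a^{-1} & 0 & 0 \\ 0 & m-a^2 & 0 \\ 0 & 0 & a^{-1} \end{pmatrix}K_1T^{-1}\in\mathrm{SL}_3\mathbb R,$$ and $\gamma_1f=(X_1,X_2,X_3)^t$ satisfies $$X_1X_3=-\frac1{a^2k^2}\left(\frac{\sigma(\beta)\sigma(x+\beta-\alpha)}{\sigma(x+\beta)\sigma(\beta-\alpha)}e^{\zeta(\alpha)x}\right)^2,\qquad X_2=\frac{i(m-a^2)\sigma(\beta)\sigma(x+\beta+2\alpha)}{k\,\sigma(x+\beta)\sigma(\beta+2\alpha)}e^{-2\zeta(\alpha)x}.$$ (ii) If $3M=m^2-2a^{-2}-a^4>0$, then $$\gamma_2:=\frac1{2k}\begin{pmatrix} 2a^{-1} & 0 & 2a^{-1} \\ 0 & m-a^2 & 0 \\ 2ia^{-1} & 0 & -2ia^{-1} \end{pmatrix}K_1T^{-1}\in\mathrm{SL}_3\mathbb R,$$ and $\gamma_2f=(X_1,X_2,X_3)^t$ satisfies $$X_1^2+X_3^2=\frac4{a^2k^2}\left(\frac{\sigma(\beta)\sigma(x+\beta-\alpha)}{\sigma(x+\beta)\sigma(\beta-\alpha)}e^{\zeta(\alpha)x}\right)^2,\qquad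 X_2=\frac{(m-a^2)\sigma(\beta)\sigma(x+\beta+2\alpha)}{2k\,\sigma(x+\beta)\sigma(\beta+2\alpha)}e^{-2\zeta(\alpha)x}.$$ (iii) If $3M=m^2-2a^{-2}-a^4=0$, then $$\gamma_3:=-\frac{\sigma(\beta)}{\sigma(\beta-\alpha)}\begin{pmatrix} 0 & 1 & 0 \\ 2a^{-2} & 0 & 0 \\ 0 & 0 & 1 \end{pmatrix}PK_2T^{-1}\in\mathrm{SL}_3\mathbb R,$$ and $\gamma_3f=(X_1,X_2,X_3)^t$ satisfies $$X_3=Q(x)X_1^2+R(x),\qquad X_2=-2a^{-2}\frac{\sigma(\beta)\sigma(x+\beta-\alpha)}{\sigma(x+\beta)\sigma(\beta-\alpha)}e^{\zeta(\alpha)x},$$ where $$Q(x)=\frac{(m-a^2)\sigma(x+\beta)\sigma(\beta-\alpha)}{2\sigma(\beta)\sigma(x+\beta-\alpha)}e^{-\zeta(\alpha)x},$$ $$R(x)=\frac{\sigma(\beta)\sigma(x+\beta-\alpha)}{\sigma(x+\beta)\sigma(\beta-\alpha)}e^{\zeta(\alpha)x}\left\{\frac{m-a^2}{2}x^2-x+4a^2q(x)\left(\frac{\sigma(\beta-\alpha)}{\sigma(\beta)}\right)^3\right\}.$$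
   Context: $\wp$ is the Weierstrass elliptic function with $(\wp_t)^2=4\wp^3-12M^2\wp+8(M^3+2)$, with fundamental periods $\omega_1,\omega_2$; $\zeta,\sigma$ are the corresponding Weierstrass functions ($\zeta'=-\wp$, $\sigma'/\sigma=\zeta$). $\alpha,\beta$ satisfy $\wp(\beta)=2a^{-2}+M$, $\wp_t(\beta)=4a^{-2}m$, $\wp(\alpha)=M$, $\wp_t(\alpha)=4$. $\tilde\Lambda=\{x\in\mathbb C\mid x+\beta\in\omega_1\mathbb Z+\omega_2\mathbb Z\text{ or }\wp(x+\beta)=M\}$. The surface at $\lambda=-i$: let $X=\begin{pmatrix} m & -a^{-1} & a^2 \\ a^{-1} & 0 & -a^{-1} \\ -a^2 & a^{-1} & -m \end{pmatrix}$ (the Delaunay-type potential matrix $\begin{pmatrix} m & \lambda^{-1}ia^{-1} & \lambda ia^2 \\ \lambda ia^{-1} & 0 & \lambda^{-1}ia^{-1} \\ \lambda^{-1}ia^2 & \lambda ia^{-1} & -m \end{pmatrix}$ at $\lambda=-i$), and let $\tilde\Phi_+^{-1}(t)$ be the solution on $\mathbb C\setminus\tilde\Lambda$ of $$(\tilde\Phi_+^{-1})_t=\tilde\Phi_+^{-1}\begin{pmatrix} -\frac{\wp_t(t+\beta)}{\wp(t+\beta)-M} & 0 & -2a^2 \\ -2a^{-1} & 0 & 0 \\ 0 & -2a^{-1} & \frac{\wp_t(t+\beta)}{\wp(t+\beta)-M} \end{pmatrix},\quad\tilde\Phi_+^{-1}(0)=I_3.$$ With $\omega=e^{2\pi i/3}$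 and $T=\frac1{\sqrt3}\begin{pmatrix} 1 & 1 & 1 \\ \omega & 1 & \omega^2 \\ \omega^2 & 1 & \omega \end{pmatrix}$, the surface is $f(x+iy)=T\exp((x+iy)X)\,\tilde\Phi_+^{-1}(x)\,(0,1,0)^t$. Matrices, for $M\neq0$: $$K_1=\begin{pmatrix} \frac{a(k-m-a^2)}2 & 1 & -\frac{a(k+m+a^2)}2 \\ -\frac1{a(m-a^2)} & 1 & -\frac1{a(m-a^2)} \\ -\frac{a(k+m+a^2)}2 & 1 & \frac{a(k-m-a^2)}2 \end{pmatrix},$$ and, for $M=0$, $$K_2=\frac{\sigma(\beta-\alpha)}{\sigma(\beta)}\begin{pmatrix} -\frac a2(m+a^2) & 1 & -\frac a2(m+a^2) \\ \frac a2 & 0 & -\frac a2 \\ \frac1{4a}\left(\frac{\sigma(\beta)}{\sigma(\beta-\alpha)}\right)^3 & 0 & 0 \end{pmatrix},\quad P=\begin{pmatrix} 1 & 0 & 0 \\ 0 & i & 0 \\ 0 & 1 & -4a^2\left(\frac{\sigma(\beta-\alpha)}{\sigma(\beta)}\right)^3 \end{pmatrix},$$ $$q(t)=\int_0^t(t-s)\left(\frac{\sigma(s+\beta)}{\sigma(s+\beta-\alpha)}\right)^3e^{-3\zeta(\alpha)s}\,ds.$$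
   Formalization: In (i) the case m = a² is excluded, since K₁ contains 1/(m−a²) and σ(β+2α) = 0 there; in (iii) q(x) is the integral along any path from 0 to x avoiding the poles of the integrand, which is the real segment whenever that is pole-free. *)

theory Defs
  imports "HOL-Complex_Analysis.Complex_Analysis"
begin

definition period_lattice :: "complex \<Rightarrow> complex \<Rightarrow> complex set" where
  "period_lattice \<omega>1 \<omega>2 = {of_int p * \<omega>1 + of_int q * \<omega>2 | p q. True}"

definition wp :: "complex \<Rightarrow> complex \<Rightarrow> complex \<Rightarrow> complex" where
  "wp \<omega>1 \<omega>2 z = 1 / z^2 +
     (\<Sum>\<^sub>\<infinity>\<omega>\<in>period_lattice \<omega>1 \<omega>2 - {0}. 1 / (z - \<omega>)^2 - 1 / \<omega>^2)"

definition wzeta :: "complex \<Rightarrow> complex \<Rightarrow> complex \<Rightarrow> complex" where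
  "wzeta \<omega>1 \<omega>2 z = 1 / z +
     (\<Sum>\<^sub>\<infinity>\<omega>\<in>period_lattice \<omega>1 \<omega>2 - {0}. 1 / (z - \<omega>) + 1 / \<omega> + z / \<omega>^2)"

text \<open>The Weierstrass product over the nonzero periods. It converges unconditionally, so it is
  the limit of the finite partial products along the net of finite sets of nonzero periods.\<close>
definition wsigma :: "complex \<Rightarrow> complex \<Rightarrow> complex \<Rightarrow> complex" where
  "wsigma \<omega>1 \<omega>2 z = z *
     Lim (finite_subsets_at_top (period_lattice \<omega>1 \<omega>2 - {0}))
       (\<lambda>F. \<Prod>\<omega>\<in>F. (1 - z / \<omega>) * exp (z / \<omega> + z^2 / (2 * \<omega>^2)))"

text \<open>The standing conditions on the elliptic data: \<open>\<omega>1, \<omega>2\<close> are fundamental periods of the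
  \<open>\<wp>\<close>-function with the given differential equation, and \<open>\<alpha>, \<beta>\<close> are the prescribed points.
  Poles of \<open>\<wp>\<close> are excluded explicitly because \<open>wp\<close> is total.\<close>
definition elliptic_data ::
  "real \<Rightarrow> real \<Rightarrow> real \<Rightarrow> complex \<Rightarrow> complex \<Rightarrow> complex \<Rightarrow> complex \<Rightarrow> bool" where
  "elliptic_data a m M \<omega>1 \<omega>2 \<alpha> \<beta> \<longleftrightarrow>
     \<omega>1 \<noteq> 0 \<and> \<omega>2 / \<omega>1 \<notin> \<real> \<and>
     (\<forall>t. t \<notin> period_lattice \<omega>1 \<omega>2 \<longrightarrow>
        (deriv (wp \<omega>1 \<omega>2) t)^2 =
          4 * (wp \<omega>1 \<omega>2 t)^3 - 12 * (of_real M)^2 * wp \<omega>1 \<omega>2 t + 8 * ((of_real M)^3 + 2)) \<and>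
     \<alpha> \<notin> period_lattice \<omega>1 \<omega>2 \<and>
     wp \<omega>1 \<omega>2 \<alpha> = of_real M \<and> deriv (wp \<omega>1 \<omega>2) \<alpha> = 4 \<and>
     \<beta> \<notin> period_lattice \<omega>1 \<omega>2 \<and>
     wp \<omega>1 \<omega>2 \<beta> = of_real (2 / a^2 + M) \<and> deriv (wp \<omega>1 \<omega>2) \<beta> = of_real (4 * m / a^2)"

definition Lambda_tilde :: "complex \<Rightarrow> complex \<Rightarrow> complex \<Rightarrow> complex \<Rightarrow> complex set" where
  "Lambda_tilde \<omega>1 \<omega>2 M \<beta> =
     {x. x + \<beta> \<in> period_lattice \<omega>1 \<omega>2 \<or> wp \<omega>1 \<omega>2 (x + \<beta>) = M}"

definition cscale :: "complex \<Rightarrow> complex^3^3 \<Rightarrow> complex^3^3" (infixr \<open>*\<^sub>M\<close> 71) where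
  "c *\<^sub>M A = (\<chi> i j. c * A $ i $ j)"

definition mat_exp :: "complex^3^3 \<Rightarrow> complex^3^3" where
  "mat_exp A = (\<Sum>n. (1 / fact n) *\<^sub>R (((**) A ^^ n) (mat 1)))"

definition SL3R :: "(complex^3^3) set" where
  "SL3R = {A. (\<forall>i j. A $ i $ j \<in> \<real>) \<and> det A = 1}"

text \<open>The Delaunay-type potential matrix at \<open>\<lambda> = -\<i>\<close>.\<close>
definition potential_X :: "complex \<Rightarrow> complex \<Rightarrow> complex^3^3" where
  "potential_X a m = vector
     [vector [m, - (1 / a), a^2],
      vector [1 / a, 0, - (1 / a)],
      vector [- (a^2), 1 / a, - m]]"

definition ode_matrix ::
  "complex \<Rightarrow> complex \<Rightarrow> complex \<Rightarrow> complex \<Rightarrow> complex \<Rightarrow> complex \<Rightarrow> complex^3^3" where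
  "ode_matrix \<omega>1 \<omega>2 a M \<beta> t =
     (let h = deriv (wp \<omega>1 \<omega>2) (t + \<beta>) / (wp \<omega>1 \<omega>2 (t + \<beta>) - M)
      in vector
        [vector [- h, 0, - 2 * a^2],
         vector [- 2 / a, 0, 0],
         vector [0, - 2 / a, h]])"

text \<open>\<open>\<Psi>\<close> plays the role of \<open>\<Phi>\<^sub>+\<^sup>-\<^sup>1\<close>; the derivatives are complex, entry by entry.\<close>
definition Phi_inv_solution ::
  "complex \<Rightarrow> complex \<Rightarrow> complex \<Rightarrow> complex \<Rightarrow> complex \<Rightarrow> (complex \<Rightarrow> complex^3^3) \<Rightarrow> bool" where
  "Phi_inv_solution \<omega>1 \<omega>2 a M \<beta> \<Psi> \<longleftrightarrow>
     (\<forall>t. t \<notin> Lambda_tilde \<omega>1 \<omega>2 M \<beta> \<longrightarrow>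
        (\<forall>i j. ((\<lambda>s. \<Psi> s $ i $ j) has_field_derivative
                  (\<Psi> t ** ode_matrix \<omega>1 \<omega>2 a M \<beta> t) $ i $ j) (at t))) \<and>
     \<Psi> 0 = mat 1"

definition T_mat :: "complex^3^3" where
  "T_mat = (let \<omega> = exp (2 * of_real pi * \<i> / 3) in
     of_real (1 / sqrt 3) *\<^sub>M vector
       [vector [1, 1, 1],
        vector [\<omega>, 1, \<omega>^2],
        vector [\<omega>^2, 1, \<omega>]])"

definition surface ::
  "complex \<Rightarrow> complex \<Rightarrow> (complex \<Rightarrow> complex^3^3) \<Rightarrow> real \<Rightarrow> real \<Rightarrow> complex^3" where
  "surface a m \<Psi> x y =
     (T_mat ** mat_exp (Complex x y *\<^sub>M potential_X a m) ** \<Psi> (of_real x)) *v vector [0, 1, 0]"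

definition K1 :: "complex \<Rightarrow> complex \<Rightarrow> complex \<Rightarrow> complex^3^3" where
  "K1 a m k = vector
     [vector [a * (k - m - a^2) / 2, 1, - (a * (k + m + a^2) / 2)],
      vector [- (1 / (a * (m - a^2))), 1, - (1 / (a * (m - a^2)))],
      vector [- (a * (k + m + a^2) / 2), 1, a * (k - m - a^2) / 2]]"

definition K2 ::
  "complex \<Rightarrow> complex \<Rightarrow> complex \<Rightarrow> complex \<Rightarrow> complex \<Rightarrow> complex \<Rightarrow> complex^3^3" where
  "K2 \<omega>1 \<omega>2 \<alpha> \<beta> a m = (wsigma \<omega>1 \<omega>2 (\<beta> - \<alpha>) / wsigma \<omega>1 \<omega>2 \<beta>) *\<^sub>M vector
     [vector [- (a / 2 * (m + a^2)), 1, - (a / 2 * (m + a^2))],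
      vector [a / 2, 0, - (a / 2)],
      vector [1 / (4 * a) * (wsigma \<omega>1 \<omega>2 \<beta> / wsigma \<omega>1 \<omega>2 (\<beta> - \<alpha>))^3, 0, 0]]"

definition P_mat :: "complex \<Rightarrow> complex \<Rightarrow> complex \<Rightarrow> complex \<Rightarrow> complex \<Rightarrow> complex^3^3" where
  "P_mat \<omega>1 \<omega>2 \<alpha> \<beta> a = vector
     [vector [1, 0, 0],
      vector [0, \<i>, 0],
      vector [0, 1, - (4 * a^2 * (wsigma \<omega>1 \<omega>2 (\<beta> - \<alpha>) / wsigma \<omega>1 \<omega>2 \<beta>)^3)]]"

definition gamma1 :: "complex \<Rightarrow> complex \<Rightarrow> complex \<Rightarrow> complex^3^3" where
  "gamma1 a m k = (\<i> / k) *\<^sub>M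
     (vector [vector [1 / a, 0, 0], vector [0, m - a^2, 0], vector [0, 0, 1 / a]]
      ** K1 a m k ** matrix_inv T_mat)"

definition gamma2 :: "complex \<Rightarrow> complex \<Rightarrow> complex \<Rightarrow> complex^3^3" where
  "gamma2 a m k = (1 / (2 * k)) *\<^sub>M
     (vector [vector [2 / a, 0, 2 / a], vector [0, m - a^2, 0], vector [2 * \<i> / a, 0, - (2 * \<i> / a)]]
      ** K1 a m k ** matrix_inv T_mat)"

definition gamma3 ::
  "complex \<Rightarrow> complex \<Rightarrow> complex \<Rightarrow> complex \<Rightarrow> complex \<Rightarrow> complex \<Rightarrow> complex^3^3" where
  "gamma3 \<omega>1 \<omega>2 \<alpha> \<beta> a m = (- (wsigma \<omega>1 \<omega>2 \<beta> / wsigma \<omega>1 \<omega>2 (\<beta> - \<alpha>))) *\<^sub>M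
     (vector [vector [0, 1, 0], vector [2 / a^2, 0, 0], vector [0, 0, 1]]
      ** P_mat \<omega>1 \<omega>2 \<alpha> \<beta> a ** K2 \<omega>1 \<omega>2 \<alpha> \<beta> a m ** matrix_inv T_mat)"

text \<open>\<open>e_minus\<close> and \<open>e_plus\<close> are the two normalised exponential sigma quotients.\<close>
definition e_minus :: "complex \<Rightarrow> complex \<Rightarrow> complex \<Rightarrow> complex \<Rightarrow> complex \<Rightarrow> complex" where
  "e_minus \<omega>1 \<omega>2 \<alpha> \<beta> x =
     wsigma \<omega>1 \<omega>2 \<beta> * wsigma \<omega>1 \<omega>2 (x + \<beta> - \<alpha>) /
     (wsigma \<omega>1 \<omega>2 (x + \<beta>) * wsigma \<omega>1 \<omega>2 (\<beta> - \<alpha>)) * exp (wzeta \<omega>1 \<omega>2 \<alpha> * x)"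

definition e_plus :: "complex \<Rightarrow> complex \<Rightarrow> complex \<Rightarrow> complex \<Rightarrow> complex \<Rightarrow> complex" where
  "e_plus \<omega>1 \<omega>2 \<alpha> \<beta> x =
     wsigma \<omega>1 \<omega>2 \<beta> * wsigma \<omega>1 \<omega>2 (x + \<beta> + 2 * \<alpha>) /
     (wsigma \<omega>1 \<omega>2 (x + \<beta>) * wsigma \<omega>1 \<omega>2 (\<beta> + 2 * \<alpha>)) * exp (- 2 * wzeta \<omega>1 \<omega>2 \<alpha> * x)"

text \<open>The integral from \<open>0\<close> to \<open>t\<close> in \<open>q(t)\<close>, along a path avoiding the poles of the integrand.
  The real segment from \<open>0\<close> to \<open>t\<close> is such a path unless a pole lies on it.\<close>
definition q_path :: "complex \<Rightarrow> complex \<Rightarrow> complex \<Rightarrow> complex \<Rightarrow> complex \<Rightarrow> (real \<Rightarrow> complex) \<Rightarrow> bool"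
  where
  "q_path \<omega>1 \<omega>2 \<alpha> \<beta> t g \<longleftrightarrow> valid_path g \<and> pathstart g = 0 \<and> pathfinish g = t \<and>
     (\<forall>s\<in>path_image g. s + \<beta> - \<alpha> \<notin> period_lattice \<omega>1 \<omega>2)"

definition q_int :: "complex \<Rightarrow> complex \<Rightarrow> complex \<Rightarrow> complex \<Rightarrow> (real \<Rightarrow> complex) \<Rightarrow> complex \<Rightarrow> complex"
  where
  "q_int \<omega>1 \<omega>2 \<alpha> \<beta> g t = contour_integral g (\<lambda>s. (t - s) *
     (wsigma \<omega>1 \<omega>2 (s + \<beta>) / wsigma \<omega>1 \<omega>2 (s + \<beta> - \<alpha>))^3 * exp (- 3 * wzeta \<omega>1 \<omega>2 \<alpha> * s))"

definition Q_coeff :: "complex \<Rightarrow> complex \<Rightarrow> complex \<Rightarrow> complex \<Rightarrow> complex \<Rightarrow> complex \<Rightarrow> complex \<Rightarrow> complex"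
  where
  "Q_coeff \<omega>1 \<omega>2 \<alpha> \<beta> a m x =
     (m - a^2) * wsigma \<omega>1 \<omega>2 (x + \<beta>) * wsigma \<omega>1 \<omega>2 (\<beta> - \<alpha>) /
     (2 * wsigma \<omega>1 \<omega>2 \<beta> * wsigma \<omega>1 \<omega>2 (x + \<beta> - \<alpha>)) * exp (- wzeta \<omega>1 \<omega>2 \<alpha> * x)"

definition R_coeff ::
  "complex \<Rightarrow> complex \<Rightarrow> complex \<Rightarrow> complex \<Rightarrow> complex \<Rightarrow> complex \<Rightarrow> (real \<Rightarrow> complex) \<Rightarrow> complex \<Rightarrow> complex"
  where
  "R_coeff \<omega>1 \<omega>2 \<alpha> \<beta> a m g x = e_minus \<omega>1 \<omega>2 \<alpha> \<beta> x *
     ((m - a^2) / 2 * x^2 - x +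
      4 * a^2 * q_int \<omega>1 \<omega>2 \<alpha> \<beta> g x * (wsigma \<omega>1 \<omega>2 (\<beta> - \<alpha>) / wsigma \<omega>1 \<omega>2 \<beta>)^3)"

end

theory Submission
  imports Defs
begin

text \<open>
  Let \<open>v\<close> be a constant row vector. Because \<open>\<Psi>\<close> satisfies a linear system, the second entry \<open>u\<close> of
  \<open>v \<Psi>\<close> satisfies the scalar equation \<open>u''' = 6 (\<wp> + M) u' - 8 u\<close>, with \<open>\<wp>\<close> taken at \<open>x + \<beta>\<close>, and \<open>v\<close>
  prescribes its three initial values (\<open>row_third_order\<close>, \<open>row_solution\<close>). The matrices in
  \<open>\<gamma>\<^sub>1\<close>, \<open>\<gamma>\<^sub>2\<close>, \<open>\<gamma>\<^sub>3\<close> are built from rows adapted to the potential \<open>X\<close>: the rows of \<open>K\<^sub>1\<close> are left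
  eigenvectors for \<open>-k\<close>, \<open>0\<close>, \<open>k\<close>, and for \<open>M = 0\<close>, where \<open>X\<close> is nilpotent, one has a Jordan chain
  instead. After \<open>T\<close> has cancelled, every coordinate of the transformed surface is therefore a
  combination of entries \<open>u\<close> whose coefficients are exponentials or polynomials in \<open>x + i y\<close>.

  It remains to solve the scalar equation with the prescribed initial values. For the eigenvalues
  \<open>\<mp>k\<close> the solutions are \<open>e_minus(x) exp(\<plusminus>k x)\<close>, for the eigenvalue \<open>0\<close> the solution is \<open>e_plus\<close>.
  The exponentials cancel in \<open>X\<^sub>1 X\<^sub>3\<close> and in \<open>X\<^sub>1\<^sup>2 + X\<^sub>3\<^sup>2\<close>. For \<open>M = 0\<close> the solutions are \<open>e_minus\<close>,
  \<open>x e_minus(x)\<close> and, by reduction of order, \<open>e_minus r\<close> with \<open>r'' = 4 a\<^sup>2 / e_minus\<^sup>3\<close>; integrating twice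
  produces the integral \<open>q\<close>.

  That these functions are solutions rests on two properties of the Baker--Akhiezer function
  \<open>y(x) = \<sigma>(x + \<beta> - v) / \<sigma>(x + \<beta>) exp(\<zeta>(v) x)\<close>: the Lame equation \<open>y'' = (2 \<wp> + \<wp>(v)) y\<close>
  (\<open>baker_lame\<close>) and the first-order relation \<open>2 (\<wp> - \<wp>(v)) y' = (\<wp>' + \<wp>'(v)) y\<close> (\<open>baker_mult\<close>).
  The function \<open>e_minus\<close> belongs to \<open>v = \<alpha>\<close>. The function \<open>e_plus\<close> belongs to \<open>v = -2 \<alpha>\<close>: since
  \<open>\<wp>''(\<alpha>) = 0\<close>, one has \<open>\<zeta>(2 \<alpha>) = 2 \<zeta>(\<alpha>)\<close>, \<open>\<wp>(2 \<alpha>) = -2 M\<close> and \<open>\<wp>'(2 \<alpha>) = -4\<close>. All the relations between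
  \<open>\<zeta>\<close> and \<open>\<wp>\<close> come from one identity, \<open>(\<zeta>(a) + \<zeta>(b) + \<zeta>(c))\<^sup>2 = \<wp>(a) + \<wp>(b) + \<wp>(c)\<close> for
  \<open>a + b + c = 0\<close> (\<open>Frobenius_Stickelberger\<close>), which follows from Liouville's theorem.
\<close>

section \<open>Period lattices\<close>

text \<open>One of the two factors into which the lattice sum of inverse cubes is split.\<close>
lemma summable_on_int_powr:
  "(\<lambda>p::int. (1 + real_of_int \<bar>p\<bar>) powr (-3/2)) summable_on UNIV"
proof -
  let ?f = "\<lambda>p::int. (1 + real_of_int \<bar>p\<bar>) powr (-3/2)"
  have "summable (\<lambda>n. of_nat n powr (-3/2) :: real)"
    by (subst summable_real_powr_iff) simp
  then have "summable (\<lambda>n. of_nat (Suc n) powr (-3/2) :: real)"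
    by (subst summable_Suc_iff)
  then have *: "(\<lambda>n. of_nat (Suc n) powr (-3/2) :: real) summable_on UNIV"
    by (intro norm_summable_imp_summable_on) simp
  have "?f summable_on range int"
    using * by (subst summable_on_reindex) (auto simp: o_def add.commute)
  moreover have "?f summable_on range (\<lambda>n. - int n)"
    using * by (subst summable_on_reindex) (auto simp: o_def add.commute inj_on_def)
  moreover have "(UNIV :: int set) = range int \<union> range (\<lambda>n. - int n)"
  proof -
    have "p \<in> range int \<union> range (\<lambda>n. - int n)" for p
      by (cases p rule: int_cases2) auto
    then show ?thesis by blast
  qed
  ultimately show ?thesis
    by (metis (no_types, lifting) summable_on_union)
qed

locale period_pair =
  fixes \<omega>1 \<omega>2 :: complex
  assumes nonzero: "\<omega>1 \<noteq> 0" and not_collinear: "\<omega>2 / \<omega>1 \<notin> \<real>"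
begin

abbreviation L :: "complex set" where "L \<equiv> period_lattice \<omega>1 \<omega>2"

lemma zero_mem [simp]: "0 \<in> L"
  unfolding period_lattice_def by (auto intro!: exI[of _ "0::int"])

lemma add_mem: "u \<in> L \<Longrightarrow> v \<in> L \<Longrightarrow> u + v \<in> L"
  unfolding period_lattice_def
proof safe
  fix p q p' q' :: int
  show "\<exists>r s. of_int p * \<omega>1 + of_int q * \<omega>2 + (of_int p' * \<omega>1 + of_int q' * \<omega>2) =
              of_int r * \<omega>1 + of_int s * \<omega>2 \<and> True"
    by (rule exI[of _ "p + p'"], rule exI[of _ "q + q'"]) (simp add: algebra_simps)
qed

lemma minus_mem_iff [simp]: "- u \<in> L \<longleftrightarrow> u \<in> L"
proof -
  have "- v \<in> L" if "v \<in> L" for v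
  proof -
    from that obtain p q where "v = of_int p * \<omega>1 + of_int q * \<omega>2"
      unfolding period_lattice_def by blast
    then have "- v = of_int (-p) * \<omega>1 + of_int (-q) * \<omega>2"
      by (simp add: algebra_simps)
    then show ?thesis unfolding period_lattice_def by blast
  qed
  from this[of u] this[of "- u"] show ?thesis by auto
qed

lemma diff_mem: "u \<in> L \<Longrightarrow> v \<in> L \<Longrightarrow> u - v \<in> L"
  using add_mem[of u "-v"] by simp

lemma add_mem_iff [simp]: "u \<in> L \<Longrightarrow> v + u \<in> L \<longleftrightarrow> v \<in> L"
  using add_mem[of v u] diff_mem[of "v + u" u] by auto

lemma diff_mem_iff [simp]: "u \<in> L \<Longrightarrow> v - u \<in> L \<longleftrightarrow> v \<in> L"
  using add_mem[of "v - u" u] diff_mem[of v u] by auto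

lemma minus_diff_mem_iff: "u - v \<in> L \<longleftrightarrow> v - u \<in> L"
  using minus_mem_iff[of "u - v"] by simp

text \<open>The quotient \<open>\<tau> = \<omega>2 / \<omega>1\<close> is not real, so the imaginary part of \<open>p + q \<tau>\<close> controls \<open>q\<close>, and
  then the triangle inequality controls \<open>p\<close>. Injectivity of the coordinates, discreteness of the lattice and
  convergence of the lattice sums all follow.\<close>
lemma norm_lower_bound:
  obtains c where "c > 0"
    "\<And>p q. c * (\<bar>of_int p\<bar> + \<bar>of_int q\<bar>) \<le> norm (of_int p * \<omega>1 + of_int q * \<omega>2)"
proof -
  define \<tau> where "\<tau> = \<omega>2 / \<omega>1"
  have im: "Im \<tau> \<noteq> 0"
    using not_collinear by (auto simp: \<tau>_def complex_is_Real_iff)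
  (* The bounds |q| <= |z| / |Im tau| and |p| <= |z| + |q| |tau| add up to |p| + |q| <= k |z|. *)
  define k where "k = 1 + (1 + norm \<tau>) / \<bar>Im \<tau>\<bar>"
  have k: "k > 0" using im by (simp add: k_def add_pos_nonneg)
  show thesis
  proof (rule that[of "norm \<omega>1 / k"])
    show "norm \<omega>1 / k > 0" using nonzero k by simp
    fix p q :: int
    define z where "z = of_int p + of_int q * \<tau>"
    have "Im z = of_int q * Im \<tau>" by (simp add: z_def)
    then have "\<bar>of_int q\<bar> * \<bar>Im \<tau>\<bar> \<le> norm z"
      by (metis abs_Im_le_cmod abs_mult)
    then have q: "\<bar>of_int q\<bar> \<le> norm z / \<bar>Im \<tau>\<bar>"
      using im by (simp add: field_simps)
    have "\<bar>of_int p\<bar> = norm (z - of_int q * \<tau>)" by (simp add: z_def)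
    also have "\<dots> \<le> norm z + \<bar>of_int q\<bar> * norm \<tau>"
      by (metis norm_mult norm_of_int norm_triangle_ineq4)
    also have "\<dots> \<le> norm z + norm z / \<bar>Im \<tau>\<bar> * norm \<tau>"
      using q by (intro add_left_mono mult_right_mono) auto
    finally have "\<bar>of_int p\<bar> \<le> norm z + norm z / \<bar>Im \<tau>\<bar> * norm \<tau>" .
    with q have "\<bar>of_int p\<bar> + \<bar>of_int q\<bar> \<le> norm z + norm z / \<bar>Im \<tau>\<bar> * norm \<tau> + norm z / \<bar>Im \<tau>\<bar>"
      by linarith
    also have "\<dots> = norm z * k"
      by (simp add: k_def distrib_left add_divide_distrib)
    finally have "\<bar>of_int p\<bar> + \<bar>of_int q\<bar> \<le> norm z * k" .
    moreover have "of_int p * \<omega>1 + of_int q * \<omega>2 = \<omega>1 * z"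
      using nonzero by (simp add: z_def \<tau>_def field_simps)
    ultimately show "norm \<omega>1 / k * (\<bar>of_int p\<bar> + \<bar>of_int q\<bar>) \<le> norm (of_int p * \<omega>1 + of_int q * \<omega>2)"
      using k mult_left_mono[of "\<bar>of_int p\<bar> + \<bar>of_int q\<bar>" "norm z * k" "norm \<omega>1"]
      by (simp add: norm_mult field_simps)
  qed
qed

lemma lattice_coords_inj: "inj (\<lambda>(p, q). of_int p * \<omega>1 + of_int q * \<omega>2)"
proof (rule injI, clarify)
  fix p q p' q' :: int
  assume eq: "of_int p * \<omega>1 + of_int q * \<omega>2 = of_int p' * \<omega>1 + of_int q' * \<omega>2"
  obtain c where c: "c > 0"
    "\<And>p q. c * (\<bar>of_int p\<bar> + \<bar>of_int q\<bar>) \<le> norm (of_int p * \<omega>1 + of_int q * \<omega>2)"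
    using norm_lower_bound by blast
  have "of_int (p - p') * \<omega>1 + of_int (q - q') * \<omega>2 = 0"
    using eq by (simp add: algebra_simps)
  with c(2)[of "p - p'" "q - q'"] have "c * (\<bar>of_int (p - p')\<bar> + \<bar>of_int (q - q')\<bar>) \<le> 0"
    by simp
  with c(1) have "\<bar>of_int (p - p')\<bar> + \<bar>of_int (q - q')\<bar> \<le> (0::real)"
    by (simp add: mult_le_0_iff)
  then show "p = p' \<and> q = q'" by linarith
qed

lemma finite_in_ball: "finite {\<omega>\<in>L. norm \<omega> \<le> R}"
proof -
  obtain c where c: "c > 0"
    "\<And>p q. c * (\<bar>of_int p\<bar> + \<bar>of_int q\<bar>) \<le> norm (of_int p * \<omega>1 + of_int q * \<omega>2)"
    using norm_lower_bound by blast
  define N where "N = \<lceil>R / c\<rceil>"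
  have "{\<omega>\<in>L. norm \<omega> \<le> R} \<subseteq>
        (\<lambda>(p, q). of_int p * \<omega>1 + of_int q * \<omega>2) ` ({-N..N} \<times> {-N..N})"
  proof
    fix \<omega> assume "\<omega> \<in> {\<omega>\<in>L. norm \<omega> \<le> R}"
    then obtain p q where pq: "\<omega> = of_int p * \<omega>1 + of_int q * \<omega>2" "norm \<omega> \<le> R"
      unfolding period_lattice_def by blast
    with order_trans[OF c(2)[of p q]] have "c * (\<bar>of_int p\<bar> + \<bar>of_int q\<bar>) \<le> R" by simp
    then have "\<bar>of_int p\<bar> + \<bar>of_int q\<bar> \<le> R / c"
      using c(1) by (simp add: field_simps)
    then have "p \<in> {-N..N}" "q \<in> {-N..N}"
      unfolding N_def by (simp_all, linarith+)
    then show "\<omega> \<in> (\<lambda>(p, q). of_int p * \<omega>1 + of_int q * \<omega>2) ` ({-N..N} \<times> {-N..N})"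
      using pq by force
  qed
  then show ?thesis by (rule finite_subset) auto
qed

text \<open>Every bounded set contains finitely many periods. Sparse sets are closed, have connected
  complement and are stable under finite unions, which is what the pole sets below need.\<close>
lemma lattice_sparse: "L sparse_in UNIV"
proof (subst sparse_in_eventually_iff)
  show "\<forall>y\<in>UNIV. \<forall>\<^sub>F z in at y. z \<notin> L"
  proof
    fix y :: complex
    have "finite (L \<inter> cball y 1)"
    proof (rule finite_subset[OF _ finite_in_ball])
      show "L \<inter> cball y 1 \<subseteq> {\<omega>\<in>L. norm \<omega> \<le> norm y + 1}"
      proof
        fix w assume w: "w \<in> L \<inter> cball y 1"
        have "norm w \<le> norm y + norm (w - y)"
          by (metis add.commute norm_triangle_sub)
        with w show "w \<in> {\<omega>\<in>L. norm \<omega> \<le> norm y + 1}"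
          by (auto simp: dist_norm norm_minus_commute)
      qed
    qed
    then have "\<not> y islimpt (L \<inter> cball y 1)" by (rule islimpt_finite)
    then have "\<forall>\<^sub>F z in at y. z \<notin> L \<inter> cball y 1"
      by (simp add: islimpt_iff_eventually)
    moreover have "\<forall>\<^sub>F z in at y. z \<in> ball y 1"
      by (rule eventually_at_in_open') auto
    ultimately show "\<forall>\<^sub>F z in at y. z \<notin> L"
      by eventually_elim auto
  qed
qed auto

lemma lattice_translate_sparse: "{z. z + d \<in> L} sparse_in UNIV"
proof -
  have "{z. z + d \<in> L} = (+) (- d) ` L"
    by (force simp: image_iff algebra_simps)
  then show ?thesis using sparse_in_translate_UNIV[OF lattice_sparse, of "- d"] by (simp only:)
qed

lemma open_compl_lattice: "open (- L)"
  using sparse_in_UNIV_imp_closed[OF lattice_sparse] by (simp add: open_Compl)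

lemma connected_compl_lattice: "connected (- L)"
  using sparse_imp_connected[of "UNIV :: complex set" L] lattice_sparse connected_UNIV
  by (simp add: Compl_eq_Diff_UNIV)

lemma half_generator_not_mem: "\<omega>1 / 2 \<notin> L" "\<omega>2 / 2 \<notin> L"
proof -
  have inj: "p = p' \<and> q = q'"
    if "of_int p * \<omega>1 + of_int q * \<omega>2 = of_int p' * \<omega>1 + of_int q' * \<omega>2" for p q p' q' :: int
    using lattice_coords_inj that unfolding inj_def by auto
  show "\<omega>1 / 2 \<notin> L"
  proof
    assume "\<omega>1 / 2 \<in> L"
    then obtain p q where "\<omega>1 / 2 = of_int p * \<omega>1 + of_int q * \<omega>2"
      unfolding period_lattice_def by blast
    then have "of_int (2 * p) * \<omega>1 + of_int (2 * q) * \<omega>2 = of_int 1 * \<omega>1 + of_int 0 * \<omega>2"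
      by (simp add: field_simps)
    from inj[OF this] have "2 * p = 1" by blast
    then show False by presburger
  qed
  show "\<omega>2 / 2 \<notin> L"
  proof
    assume "\<omega>2 / 2 \<in> L"
    then obtain p q where "\<omega>2 / 2 = of_int p * \<omega>1 + of_int q * \<omega>2"
      unfolding period_lattice_def by blast
    then have "of_int (2 * p) * \<omega>1 + of_int (2 * q) * \<omega>2 = of_int 0 * \<omega>1 + of_int 1 * \<omega>2"
      by (simp add: field_simps)
    from inj[OF this] have "2 * q = 1" by blast
    then show False by presburger
  qed
qed

lemma generators_mem: "\<omega>1 \<in> L" "\<omega>2 \<in> L"
proof -
  have "\<omega>1 = of_int 1 * \<omega>1 + of_int 0 * \<omega>2" "\<omega>2 = of_int 0 * \<omega>1 + of_int 1 * \<omega>2" by simp_all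
  then show "\<omega>1 \<in> L" "\<omega>2 \<in> L" unfolding period_lattice_def by blast+
qed

text \<open>The coordinates satisfy \<open>norm \<omega> \<ge> c (1 + \<bar>p\<bar> + \<bar>q\<bar>) / 2\<close>, and the inverse cube of \<open>1 + \<bar>p\<bar> + \<bar>q\<bar>\<close> is at
  most \<open>(1 + \<bar>p\<bar>)\<close> to the power \<open>-3/2\<close> times \<open>(1 + \<bar>q\<bar>)\<close> to the power \<open>-3/2\<close>.\<close>
lemma inverse_cube_summable: "(\<lambda>\<omega>. 1 / norm \<omega> ^ 3) summable_on (L - {0})"
proof -
  obtain c where c: "c > 0"
    "\<And>p q. c * (\<bar>of_int p\<bar> + \<bar>of_int q\<bar>) \<le> norm (of_int p * \<omega>1 + of_int q * \<omega>2)"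
    using norm_lower_bound by blast
  let ?g = "\<lambda>(p, q). of_int p * \<omega>1 + of_int q * \<omega>2"
  define b where "b = (\<lambda>p::int. (1 + real_of_int \<bar>p\<bar>) powr (-3/2))"
  have b: "b summable_on UNIV" unfolding b_def by (rule summable_on_int_powr)
  have "(\<lambda>(p, q). b p * b q) summable_on (UNIV \<times> UNIV)"
  proof (rule summable_on_SigmaI)
    show "((\<lambda>q. case (p, q) of (p, q) \<Rightarrow> b p * b q) has_sum (b p * infsum b UNIV)) UNIV" for p
      using b by (auto intro!: has_sum_cmult_right)
    show "(\<lambda>p. b p * infsum b UNIV) summable_on UNIV"
      using b by (rule summable_on_cmult_left)
  qed (auto simp: b_def)
  then have "(\<lambda>(p, q). b p * b q) summable_on (UNIV - {(0, 0)})"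
    by (rule summable_on_subset_banach) auto
  then have sum: "(\<lambda>x. (8 / c ^ 3) * (case x of (p, q) \<Rightarrow> b p * b q)) summable_on (UNIV - {(0, 0)})"
    by (rule summable_on_cmult_right)
  have "(\<lambda>x. 1 / norm (?g x) ^ 3) summable_on (UNIV - {(0, 0)})"
  proof (rule summable_on_comparison_test[OF sum])
    fix x :: "int \<times> int" assume "x \<in> UNIV - {(0, 0)}"
    then obtain p q where x: "x = (p, q)" "p \<noteq> 0 \<or> q \<noteq> 0" by (cases x) auto
    define s where "s = 1 + real_of_int (\<bar>p\<bar> + \<bar>q\<bar>)"
    have s: "s > 0" by (simp add: s_def)
    have "\<bar>p\<bar> + \<bar>q\<bar> \<ge> 1" using x(2) by linarith
    then have "1 \<le> real_of_int (\<bar>p\<bar> + \<bar>q\<bar>)" by (simp only: of_int_1_le_iff)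
    then have "s \<le> 2 * (\<bar>of_int p\<bar> + \<bar>of_int q\<bar>)" by (simp add: s_def)
    with c(1) have "c * s \<le> 2 * (c * (\<bar>of_int p\<bar> + \<bar>of_int q\<bar>))" by simp
    with c(2)[of p q] have *: "c / 2 * s \<le> norm (?g x)" by (simp add: x(1))
    have "1 / norm (?g x) ^ 3 \<le> 1 / (c / 2 * s) ^ 3"
      using * c(1) s by (intro divide_left_mono power_mono mult_pos_pos zero_less_power
        less_le_trans[OF _ *]) auto
    also have "\<dots> = (8 / c ^ 3) * (1 / s ^ 3)" using c(1) by (simp add: field_simps power3_eq_cube)
    also have "1 / s ^ 3 = s powr (-3/2) * s powr (-3/2)"
      using s by (simp add: powr_add[symmetric] powr_minus_divide flip: powr_numeral)
    also have "\<dots> \<le> b p * b q"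
      unfolding b_def s_def by (intro mult_mono powr_mono2') auto
    finally have "1 / norm (?g x) ^ 3 \<le> (8 / c ^ 3) * (b p * b q)"
      using c(1) by (simp add: divide_right_mono)
    then show "1 / norm (?g x) ^ 3 \<le> (8 / c ^ 3) * (case x of (p, q) \<Rightarrow> b p * b q)"
      by (simp add: x(1))
  qed auto
  then have "(\<lambda>\<omega>. 1 / norm \<omega> ^ 3) summable_on (?g ` (UNIV - {(0, 0)}))"
    by (subst summable_on_reindex) (auto simp: o_def intro: inj_on_subset[OF lattice_coords_inj])
  moreover have "?g ` (UNIV - {(0, 0)}) = L - {0}"
  proof -
    have "?g ` (UNIV - {(0, 0)}) = range ?g - ?g ` {(0, 0)}"
      by (rule image_set_diff[OF lattice_coords_inj])
    also have "range ?g = L" unfolding period_lattice_def by auto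
    finally show ?thesis by simp
  qed
  ultimately show ?thesis by simp
qed

end

section \<open>The Weierstrass functions\<close>

text \<open>By the Weierstrass test the finite partial sums converge uniformly on discs, and the derivatives of a locally
  uniform limit of holomorphic functions are the limits of the derivatives. In particular the
  derivatives are summable as well.\<close>
lemma infsum_has_field_derivative:
  fixes f f' :: "'i \<Rightarrow> complex \<Rightarrow> complex"
  assumes M: "M summable_on A"
    and bound: "\<And>i z. i \<in> A \<Longrightarrow> z \<in> ball 0 R \<Longrightarrow> norm (f i z) \<le> M i"
    and deriv: "\<And>i z. i \<in> A \<Longrightarrow> z \<in> ball 0 R \<Longrightarrow> (f i has_field_derivative f' i z) (at z)"
    and z: "z \<in> ball 0 R"
  shows "(\<lambda>i. f' i z) summable_on A"
    and "((\<lambda>z. infsum (\<lambda>i. f i z) A) has_field_derivative infsum (\<lambda>i. f' i z) A) (at z)"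
proof -
  obtain r where r: "r > 0" "cball z r \<subseteq> ball 0 R"
    using z open_ball open_contains_cball by blast
  have ul: "uniform_limit (cball z r) (\<lambda>X z. \<Sum>i\<in>X. f i z) (\<lambda>z. infsum (\<lambda>i. f i z) A)
              (finite_subsets_at_top A)"
    by (rule Weierstrass_m_test_general[OF _ M]) (use bound r in auto)
  have ev: "\<forall>\<^sub>F X in finite_subsets_at_top A. continuous_on (cball z r) (\<lambda>z. \<Sum>i\<in>X. f i z) \<and>
         (\<forall>w\<in>ball z r. ((\<lambda>z. \<Sum>i\<in>X. f i z) has_field_derivative (\<Sum>i\<in>X. f' i w)) (at w))"
  proof (rule eventually_finite_subsets_at_top_weakI, intro conjI ballI)
    fix X assume X: "finite X" "X \<subseteq> A"
    have d: "((\<lambda>z. \<Sum>i\<in>X. f i z) has_field_derivative (\<Sum>i\<in>X. f' i w)) (at w)"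
      if "w \<in> cball z r" for w
      using X r(2) that by (intro DERIV_sum deriv) blast+
    show "continuous_on (cball z r) (\<lambda>z. \<Sum>i\<in>X. f i z)"
      using d by (meson DERIV_isCont continuous_at_imp_continuous_on)
    show "((\<lambda>z. \<Sum>i\<in>X. f i z) has_field_derivative (\<Sum>i\<in>X. f' i w)) (at w)" if "w \<in> ball z r" for w
      using d that by simp
  qed
  obtain g' where g': "\<And>w. w \<in> ball z r \<Longrightarrow>
      ((\<lambda>z. infsum (\<lambda>i. f i z) A) has_field_derivative g' w) (at w) \<and>
      ((\<lambda>X. \<Sum>i\<in>X. f' i w) \<longlongrightarrow> g' w) (finite_subsets_at_top A)"
    by (rule has_complex_derivative_uniform_limit[OF ev ul]) (use r in auto)
  have zz: "z \<in> ball z r" using r by simp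
  have hs: "((\<lambda>i. f' i z) has_sum g' z) A"
    using g'[OF zz] by (simp add: has_sum_def)
  then show "(\<lambda>i. f' i z) summable_on A" by (rule has_sum_imp_summable)
  show "((\<lambda>z. infsum (\<lambda>i. f i z) A) has_field_derivative infsum (\<lambda>i. f' i z) A) (at z)"
    using g'[OF zz] infsumI[OF hs] by simp
qed

context period_pair
begin

text \<open>On the disc of radius \<open>R\<close> all but finitely many periods have norm at least \<open>2 R\<close>. Those
  contribute a series dominated by inverse cubes, the others a finite sum.\<close>
lemma lattice_series:
  fixes t t' :: "complex \<Rightarrow> complex \<Rightarrow> complex"
  assumes bound: "\<And>R. R > 0 \<Longrightarrow> \<exists>C. \<forall>\<omega>\<in>L. norm \<omega> \<ge> 2 * R \<longrightarrow>
                    (\<forall>z\<in>ball 0 R. norm (t \<omega> z) \<le> C / norm \<omega> ^ 3)"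
    and deriv: "\<And>\<omega> z. \<omega> \<in> L - {0} \<Longrightarrow> z \<noteq> \<omega> \<Longrightarrow> (t \<omega> has_field_derivative t' \<omega> z) (at z)"
    and z: "z \<notin> L - {0}"
  shows "(\<lambda>\<omega>. t \<omega> z) summable_on (L - {0})" (is ?A)
    and "(\<lambda>\<omega>. t' \<omega> z) summable_on (L - {0})" (is ?B)
    and "((\<lambda>z. infsum (\<lambda>\<omega>. t \<omega> z) (L - {0})) has_field_derivative
            infsum (\<lambda>\<omega>. t' \<omega> z) (L - {0})) (at z)" (is ?C)
proof -
  define R where "R = norm z + 1"
  have R: "R > 0" by (simp add: R_def add_nonneg_pos)
  have zR: "z \<in> ball 0 R" by (simp add: R_def)
  define F where "F = {\<omega>\<in>L - {0}. norm \<omega> < 2 * R}"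
  define A where "A = {\<omega>\<in>L - {0}. norm \<omega> \<ge> 2 * R}"
  have FA: "L - {0} = F \<union> A" "F \<inter> A = {}" by (auto simp: F_def A_def)
  have F: "finite F" by (rule finite_subset[OF _ finite_in_ball[of "2 * R"]]) (auto simp: F_def)
  obtain C where "\<forall>\<omega>\<in>L. norm \<omega> \<ge> 2 * R \<longrightarrow> (\<forall>z\<in>ball 0 R. norm (t \<omega> z) \<le> C / norm \<omega> ^ 3)"
    using bound[OF R] by blast
  then have C: "norm (t \<omega> z) \<le> C / norm \<omega> ^ 3" if "\<omega> \<in> A" "z \<in> ball 0 R" for \<omega> z
    using that unfolding A_def by blast
  have M: "(\<lambda>\<omega>. C * (1 / norm \<omega> ^ 3)) summable_on A"
    by (rule summable_on_cmult_right, rule summable_on_subset_banach[OF inverse_cube_summable])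
       (auto simp: A_def)
  have d: "(t \<omega> has_field_derivative t' \<omega> w) (at w)" if "\<omega> \<in> A" "w \<in> ball 0 R" for \<omega> w
    using that R by (intro deriv) (auto simp: A_def)
  have S: "(\<lambda>\<omega>. t \<omega> w) summable_on A" if "w \<in> ball 0 R" for w
    by (rule abs_summable_summable, rule summable_on_comparison_test[OF M]) (use C that in auto)
  show ?A unfolding FA(1) using S[OF zR] F FA(2) by (intro summable_on_Un_disjoint) auto
  have B: "(\<lambda>\<omega>. t' \<omega> z) summable_on A"
    by (rule infsum_has_field_derivative(1)[OF M _ d zR]) (use C in auto)
  show ?B unfolding FA(1) using B F FA(2) by (intro summable_on_Un_disjoint) auto
  have split: "infsum (\<lambda>\<omega>. t \<omega> w) (L - {0}) = (\<Sum>\<omega>\<in>F. t \<omega> w) + infsum (\<lambda>\<omega>. t \<omega> w) A"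
    if "w \<in> ball 0 R" for w
    unfolding FA(1) using S[OF that] F FA(2) by (subst infsum_Un_disjoint) auto
  have "((\<lambda>w. (\<Sum>\<omega>\<in>F. t \<omega> w) + infsum (\<lambda>\<omega>. t \<omega> w) A) has_field_derivative
          (\<Sum>\<omega>\<in>F. t' \<omega> z) + infsum (\<lambda>\<omega>. t' \<omega> z) A) (at z)"
  proof (rule DERIV_add)
    show "((\<lambda>w. \<Sum>\<omega>\<in>F. t \<omega> w) has_field_derivative (\<Sum>\<omega>\<in>F. t' \<omega> z)) (at z)"
    proof (rule DERIV_sum)
      fix \<omega> assume "\<omega> \<in> F"
      then have "\<omega> \<in> L - {0}" by (simp add: F_def)
      moreover from this have "z \<noteq> \<omega>" using z by blast
      ultimately show "(t \<omega> has_field_derivative t' \<omega> z) (at z)" by (rule deriv)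
    qed
    show "((\<lambda>w. infsum (\<lambda>\<omega>. t \<omega> w) A) has_field_derivative infsum (\<lambda>\<omega>. t' \<omega> z) A) (at z)"
      by (rule infsum_has_field_derivative(2)[OF M _ d zR]) (use C in auto)
  qed
  also have "(\<Sum>\<omega>\<in>F. t' \<omega> z) + infsum (\<lambda>\<omega>. t' \<omega> z) A = infsum (\<lambda>\<omega>. t' \<omega> z) (L - {0})"
    unfolding FA(1) using B F FA(2) by (subst infsum_Un_disjoint) auto
  finally show ?C
    by (rule has_field_derivative_transform_within_open[OF _ open_ball zR]) (simp add: split)
qed

definition zeta_term :: "complex \<Rightarrow> complex \<Rightarrow> complex" where
  "zeta_term \<omega> z = 1 / (z - \<omega>) + 1 / \<omega> + z / \<omega>^2"

definition wp_term :: "complex \<Rightarrow> complex \<Rightarrow> complex" where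
  "wp_term \<omega> z = 1 / (z - \<omega>)^2 - 1 / \<omega>^2"

text \<open>\<open>zeta_reg\<close> and \<open>wp_reg\<close> are what remains of the two functions after removing their
  principal parts at the origin.\<close>

definition zeta_reg :: "complex \<Rightarrow> complex" where
  "zeta_reg z = infsum (\<lambda>\<omega>. zeta_term \<omega> z) (L - {0})"

definition wp_reg :: "complex \<Rightarrow> complex" where
  "wp_reg z = infsum (\<lambda>\<omega>. wp_term \<omega> z) (L - {0})"

definition wp'_reg :: "complex \<Rightarrow> complex" where
  "wp'_reg z = infsum (\<lambda>\<omega>. - 2 / (z - \<omega>)^3) (L - {0})"

abbreviation \<zeta> where "\<zeta> \<equiv> wzeta \<omega>1 \<omega>2"
abbreviation wpf (\<open>\<wp>\<close>) where "\<wp> \<equiv> wp \<omega>1 \<omega>2"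
abbreviation \<sigma> where "\<sigma> \<equiv> wsigma \<omega>1 \<omega>2"

lemma zeta_conv_reg: "\<zeta> z = 1 / z + zeta_reg z"
  by (simp add: wzeta_def zeta_reg_def zeta_term_def)

lemma wp_conv_reg: "\<wp> z = 1 / z^2 + wp_reg z"
  by (simp add: wp_def wp_reg_def wp_term_def)

lemma norm_diff_lower:
  assumes "z \<in> ball 0 R" "norm \<omega> \<ge> 2 * R"
  shows "norm (z - \<omega>) \<ge> norm \<omega> / 2" "z \<noteq> \<omega>" "\<omega> \<noteq> 0"
proof -
  have "norm \<omega> - norm z \<le> norm (z - \<omega>)" by (metis norm_minus_commute norm_triangle_ineq2)
  with assms show 1: "norm (z - \<omega>) \<ge> norm \<omega> / 2" by simp
  have "R > 0" using assms(1) norm_ge_zero[of z] by (simp, linarith)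
  then show "\<omega> \<noteq> 0" using assms(2) by auto
  then show "z \<noteq> \<omega>" using 1 by auto
qed

text \<open>The subtracted terms are the Taylor polynomial of \<open>1 / (z - \<omega>)\<close>, which leaves
  \<open>z\<^sup>2 / (\<omega>\<^sup>2 (z - \<omega>))\<close>.\<close>
lemma zeta_term_bound:
  assumes "z \<in> ball 0 R" "norm \<omega> \<ge> 2 * R"
  shows "norm (zeta_term \<omega> z) \<le> 2 * R^2 / norm \<omega> ^ 3"
proof -
  note * = norm_diff_lower[OF assms]
  have "zeta_term \<omega> z = z^2 / (\<omega>^2 * (z - \<omega>))"
    using * by (simp add: zeta_term_def field_simps power2_eq_square)
  then have "norm (zeta_term \<omega> z) = norm z ^ 2 / (norm \<omega> ^ 2 * norm (z - \<omega>))"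
    by (simp add: norm_divide norm_mult norm_power)
  also have "\<dots> \<le> R ^ 2 / (norm \<omega> ^ 2 * (norm \<omega> / 2))"
    using assms * by (intro frac_le mult_left_mono power_mono) auto
  also have "\<dots> = 2 * R^2 / norm \<omega> ^ 3" by (simp add: power2_eq_square power3_eq_cube)
  finally show ?thesis .
qed

lemma wp_term_bound:
  assumes "z \<in> ball 0 R" "norm \<omega> \<ge> 2 * R"
  shows "norm (wp_term \<omega> z) \<le> 10 * R / norm \<omega> ^ 3"
proof -
  note * = norm_diff_lower[OF assms]
  have R: "norm z \<le> R" "R \<ge> 0" using assms(1) norm_ge_zero[of z] by (auto simp del: norm_ge_zero)
  have "wp_term \<omega> z = z * (2 * \<omega> - z) / (\<omega>^2 * (z - \<omega>)^2)"
    using * by (simp add: wp_term_def divide_simps) (simp add: algebra_simps power2_eq_square)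
  then have "norm (wp_term \<omega> z) = norm z * norm (2 * \<omega> - z) / (norm \<omega> ^ 2 * norm (z - \<omega>) ^ 2)"
    by (simp add: norm_divide norm_mult norm_power)
  also have "\<dots> \<le> R * (5 / 2 * norm \<omega>) / (norm \<omega> ^ 2 * (norm \<omega> / 2) ^ 2)"
  proof (intro frac_le mult_mono power_mono)
    have "norm (2 * \<omega> - z) \<le> 2 * norm \<omega> + norm z"
      by (rule order_trans[OF norm_triangle_ineq4]) (simp add: norm_mult)
    with assms R show "norm (2 * \<omega> - z) \<le> 5 / 2 * norm \<omega>" by simp
  qed (use assms * R in auto)
  also have "\<dots> = 10 * R / norm \<omega> ^ 3" using * by (simp add: power2_eq_square power3_eq_cube)
  finally show ?thesis .
qed

lemma zeta_term_deriv: "\<omega> \<in> L - {0} \<Longrightarrow> z \<noteq> \<omega> \<Longrightarrow> (zeta_term \<omega> has_field_derivative - wp_term \<omega> z) (at z)"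
  unfolding zeta_term_def[abs_def] wp_term_def
  by (rule derivative_eq_intros refl | simp; fail)+ (simp add: power2_eq_square divide_simps)

lemma wp_term_deriv: "\<omega> \<in> L - {0} \<Longrightarrow> z \<noteq> \<omega> \<Longrightarrow> (wp_term \<omega> has_field_derivative - 2 / (z - \<omega>)^3) (at z)"
  unfolding wp_term_def[abs_def]
  by (rule derivative_eq_intros refl | simp; fail)+
     (simp add: power2_eq_square power3_eq_cube divide_simps)

lemma
  assumes "z \<notin> L - {0}"
  shows zeta_term_summable: "(\<lambda>\<omega>. zeta_term \<omega> z) summable_on (L - {0})"
    and zeta_reg_deriv: "(zeta_reg has_field_derivative - wp_reg z) (at z)"
proof -
  have bd: "\<exists>C. \<forall>\<omega>\<in>L. norm \<omega> \<ge> 2 * R \<longrightarrow> (\<forall>z\<in>ball 0 R. norm (zeta_term \<omega> z) \<le> C / norm \<omega> ^ 3)" for R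
    using zeta_term_bound by blast
  note * = lattice_series[OF bd _ assms, of "\<lambda>\<omega> z. - wp_term \<omega> z", OF zeta_term_deriv]
  show "(\<lambda>\<omega>. zeta_term \<omega> z) summable_on (L - {0})" using *(1) by blast
  show "(zeta_reg has_field_derivative - wp_reg z) (at z)"
    using *(3) unfolding zeta_reg_def[abs_def] wp_reg_def by (simp add: infsum_uminus)
qed

lemma
  assumes "z \<notin> L - {0}"
  shows wp'_term_summable: "(\<lambda>\<omega>. - 2 / (z - \<omega>)^3) summable_on (L - {0})"
    and wp_reg_deriv: "(wp_reg has_field_derivative wp'_reg z) (at z)"
proof -
  have bd: "\<exists>C. \<forall>\<omega>\<in>L. norm \<omega> \<ge> 2 * R \<longrightarrow> (\<forall>z\<in>ball 0 R. norm (wp_term \<omega> z) \<le> C / norm \<omega> ^ 3)" for R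
    using wp_term_bound by blast
  note * = lattice_series[OF bd _ assms, of "\<lambda>\<omega> z. - 2 / (z - \<omega>)^3", OF wp_term_deriv]
  show "(\<lambda>\<omega>. - 2 / (z - \<omega>)^3) summable_on (L - {0})" using *(2) by blast
  show "(wp_reg has_field_derivative wp'_reg z) (at z)"
    using *(3) unfolding wp_reg_def[abs_def] wp'_reg_def by simp
qed

lemma zeta_deriv: "z \<notin> L \<Longrightarrow> (\<zeta> has_field_derivative - \<wp> z) (at z)"
proof -
  assume z: "z \<notin> L"
  then have "z \<noteq> 0" by auto
  have "((\<lambda>z. 1 / z + zeta_reg z) has_field_derivative - \<wp> z) (at z)"
    by (rule derivative_eq_intros zeta_reg_deriv refl | use z \<open>z \<noteq> 0\<close> in \<open>simp; fail\<close>)+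
       (use \<open>z \<noteq> 0\<close> in \<open>simp add: wp_conv_reg power2_eq_square field_simps\<close>)
  then show ?thesis by (simp add: zeta_conv_reg[abs_def])
qed

lemma wp_deriv: "z \<notin> L \<Longrightarrow> (\<wp> has_field_derivative (\<Sum>\<^sub>\<infinity>\<omega>\<in>L. - 2 / (z - \<omega>)^3)) (at z)"
proof -
  assume z: "z \<notin> L"
  then have "z \<noteq> 0" by auto
  have "((\<lambda>z. 1 / z^2 + wp_reg z) has_field_derivative - 2 / z^3 + wp'_reg z) (at z)"
    by (rule derivative_eq_intros wp_reg_deriv refl | use z \<open>z \<noteq> 0\<close> in \<open>simp; fail\<close>)+
       (use \<open>z \<noteq> 0\<close> in \<open>simp add: power2_eq_square power3_eq_cube field_simps\<close>)
  moreover have "(\<Sum>\<^sub>\<infinity>\<omega>\<in>L. - 2 / (z - \<omega>)^3) = - 2 / z^3 + wp'_reg z"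
  proof -
    have "(\<Sum>\<^sub>\<infinity>\<omega>\<in>L. - 2 / (z - \<omega>)^3) = (\<Sum>\<^sub>\<infinity>\<omega>\<in>{0} \<union> (L - {0}). - 2 / (z - \<omega>)^3)"
      by (rule infsum_cong_neutral) auto
    also have "\<dots> = - 2 / z^3 + wp'_reg z"
      using wp'_term_summable[of z] z by (subst infsum_Un_disjoint) (auto simp: wp'_reg_def)
    finally show ?thesis .
  qed
  ultimately show ?thesis by (simp add: wp_conv_reg[abs_def])
qed

end

text \<open>Each point has a disc in which it is the only possible exception, so Riemann's theorem on
  removable singularities applies there.\<close>
lemma continuous_off_sparse_holomorphic:
  fixes G :: "complex \<Rightarrow> complex"
  assumes P: "P sparse_in UNIV" and hol: "G holomorphic_on - P" and cont: "\<And>z. isCont G z"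
  shows "G holomorphic_on UNIV"
proof -
  have "\<exists>e>0. G holomorphic_on ball z e" for z
  proof -
    obtain B where B: "open B" "z \<in> B" "\<forall>y\<in>B. y \<noteq> z \<longrightarrow> y \<notin> P"
      using sparse_in_not_in[OF P, of z] by auto
    then obtain e where e: "e > 0" "ball z e \<subseteq> B" using open_contains_ball by blast
    have "G holomorphic_on ball z e"
    proof (rule no_isolated_singularity)
      show "continuous_on (ball z e) G" using cont by (simp add: continuous_at_imp_continuous_on)
      show "G holomorphic_on ball z e - {z}"
        using hol by (rule holomorphic_on_subset) (use B e in blast)
    qed auto
    with e show ?thesis by blast
  qed
  then have "G field_differentiable at z" for z
    by (meson centre_in_ball holomorphic_on_imp_differentiable_at open_ball)
  then show ?thesis by (simp add: holomorphic_on_def)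
qed

context period_pair
begin

lemma infsum_lattice_uminus: "infsum f (L - {0}) = infsum (\<lambda>\<omega>. f (- \<omega>)) (L - {0})"
  by (rule infsum_reindex_bij_witness[of _ uminus uminus]) auto

lemma zeta_odd: "\<zeta> (- z) = - \<zeta> z"
proof -
  have "zeta_reg (- z) = infsum (\<lambda>\<omega>. zeta_term (- \<omega>) (- z)) (L - {0})"
    unfolding zeta_reg_def by (rule infsum_lattice_uminus)
  also have "(\<lambda>\<omega>. zeta_term (- \<omega>) (- z)) = (\<lambda>\<omega>. - zeta_term \<omega> z)"
  proof
    fix \<omega>
    have "- z - - \<omega> = - (z - \<omega>)" by simp
    then show "zeta_term (- \<omega>) (- z) = - zeta_term \<omega> z"
      unfolding zeta_term_def by (simp only: divide_minus_right divide_minus_left power2_minus) simp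
  qed
  finally show ?thesis by (simp add: zeta_conv_reg infsum_uminus zeta_reg_def)
qed

lemma wp_even: "\<wp> (- z) = \<wp> z"
proof -
  have "wp_reg (- z) = infsum (\<lambda>\<omega>. wp_term (- \<omega>) (- z)) (L - {0})"
    unfolding wp_reg_def by (rule infsum_lattice_uminus)
  also have "(\<lambda>\<omega>. wp_term (- \<omega>) (- z)) = wp_term_swap" if "wp_term_swap = (\<lambda>\<omega>. wp_term \<omega> z)" for wp_term_swap
    unfolding that wp_term_def by (auto simp: power2_commute fun_eq_iff)
  finally show ?thesis by (simp add: wp_conv_reg wp_reg_def)
qed

lemma deriv_wp: "z \<notin> L \<Longrightarrow> deriv \<wp> z = (\<Sum>\<^sub>\<infinity>\<omega>\<in>L. - 2 / (z - \<omega>)^3)"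
  by (rule DERIV_imp_deriv, rule wp_deriv)

lemma wp_has_deriv: "z \<notin> L \<Longrightarrow> (\<wp> has_field_derivative deriv \<wp> z) (at z)"
  using wp_deriv[of z] DERIV_imp_deriv by metis

lemma deriv_wp_periodic: "z \<notin> L \<Longrightarrow> \<omega> \<in> L \<Longrightarrow> deriv \<wp> (z + \<omega>) = deriv \<wp> z"
  by (simp add: deriv_wp)
     (rule infsum_reindex_bij_witness[of _ "\<lambda>x. x + \<omega>" "\<lambda>x. x - \<omega>"], auto simp: algebra_simps)

lemma deriv_wp_odd: "z \<notin> L \<Longrightarrow> deriv \<wp> (- z) = - deriv \<wp> z"
proof -
  assume z: "z \<notin> L"
  have "(\<Sum>\<^sub>\<infinity>\<omega>\<in>L. - 2 / (- z - \<omega>)^3) = (\<Sum>\<^sub>\<infinity>\<omega>\<in>L. - (- 2 / (z - \<omega>)^3))"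
  proof (rule infsum_reindex_bij_witness[of _ uminus uminus])
    fix \<omega> :: complex
    have "(- z - \<omega>)^3 = - ((z - - \<omega>)^3)" by (simp add: power3_eq_cube algebra_simps)
    then show "- (- 2 / (z - - \<omega>) ^ 3) = - 2 / (- z - \<omega>) ^ 3" by (simp only:) simp
  qed auto
  then show ?thesis using z by (simp only: deriv_wp minus_mem_iff infsum_uminus not_False_eq_True)
qed

text \<open>The series for \<open>\<wp>'\<close> converges absolutely and is summed over the whole lattice, so it is periodic by
  reindexing. The compensating terms in the series for \<open>\<wp>\<close> break this symmetry, which leaves an additive constant.\<close>
lemma wp_shift_const:
  assumes \<omega>: "\<omega> \<in> L"
  obtains c where "\<And>z. z \<notin> L \<Longrightarrow> \<wp> (z + \<omega>) = \<wp> z + c"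
proof -
  have "(\<lambda>z. \<wp> (z + \<omega>) - \<wp> z) constant_on (- L)"
  proof (rule has_field_derivative_0_imp_constant_on)
    fix z assume "z \<in> - L"
    then have z: "z \<notin> L" by simp
    have 1: "((\<lambda>z. \<wp> (z + \<omega>)) has_field_derivative deriv \<wp> z) (at z)"
      using wp_has_deriv[of "z + \<omega>"] z \<omega> deriv_wp_periodic[of z \<omega>] DERIV_shift[of \<wp>] by auto
    show "((\<lambda>z. \<wp> (z + \<omega>) - \<wp> z) has_field_derivative 0) (at z)"
      using DERIV_diff[OF 1 wp_has_deriv[OF z]] by simp
  qed (auto simp: connected_compl_lattice open_compl_lattice)
  then obtain c where "\<And>z. z \<notin> L \<Longrightarrow> \<wp> (z + \<omega>) - \<wp> z = c"
    unfolding constant_on_def by auto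
  then show thesis by (intro that[of c]) (simp add: algebra_simps)
qed

text \<open>The shift constant is determined at the half period, which is not a pole for either
  generator, and there it vanishes because \<open>\<wp>\<close> is even.\<close>
lemma wp_periodic_half:
  assumes \<omega>: "\<omega> \<in> L" and half: "\<omega> / 2 \<notin> L" and z: "z \<notin> L"
  shows "\<wp> (z + \<omega>) = \<wp> z"
proof -
  obtain c where c: "\<And>z. z \<notin> L \<Longrightarrow> \<wp> (z + \<omega>) = \<wp> z + c"
    using wp_shift_const[OF \<omega>] by blast
  have "\<wp> (- (\<omega> / 2) + \<omega>) = \<wp> (- (\<omega> / 2)) + c" using half by (intro c) simp
  moreover have "- (\<omega> / 2) + \<omega> = \<omega> / 2" by (simp add: field_simps)
  ultimately have "c = 0" by (simp add: wp_even)
  with c[OF z] show ?thesis by simp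
qed

lemma generator_multiples:
  assumes "\<omega> \<in> L" and per: "\<And>z. z \<notin> L \<Longrightarrow> f (z + \<omega>) = (f z :: complex)" and "z \<notin> L"
  shows "of_int p * \<omega> \<in> L \<and> f (z + of_int p * \<omega>) = f z"
proof (induction p rule: int_induct[of _ 0])
  case base
  then show ?case by simp
next
  case (step1 i)
  have eq: "z + of_int (i + 1) * \<omega> = (z + of_int i * \<omega>) + \<omega>" by (simp add: algebra_simps)
  have m: "of_int (i + 1) * \<omega> \<in> L"
    using step1 assms(1) add_mem[of "of_int i * \<omega>" \<omega>] by (simp add: algebra_simps)
  have "f ((z + of_int i * \<omega>) + \<omega>) = f (z + of_int i * \<omega>)"
    using step1 assms by (intro per) simp
  then show ?case using step1 m by (simp only: eq)
next
  case (step2 i)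
  have eq: "z + of_int (i - 1) * \<omega> + \<omega> = z + of_int i * \<omega>" by (simp add: algebra_simps)
  have m: "of_int (i - 1) * \<omega> \<in> L"
    using step2 assms(1) diff_mem[of "of_int i * \<omega>" \<omega>] by (simp add: algebra_simps)
  have "f (z + of_int (i - 1) * \<omega> + \<omega>) = f (z + of_int (i - 1) * \<omega>)"
    using m assms by (intro per) simp
  then show ?case using step2 m by (simp only: eq)
qed

lemma wp_periodic:
  assumes "\<omega> \<in> L" "z \<notin> L"
  shows "\<wp> (z + \<omega>) = \<wp> z"
proof -
  obtain p q where pq: "\<omega> = of_int p * \<omega>1 + of_int q * \<omega>2"
    using assms unfolding period_lattice_def by blast
  note per = wp_periodic_half[OF generators_mem(1) half_generator_not_mem(1)]
    wp_periodic_half[OF generators_mem(2) half_generator_not_mem(2)]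
  have 1: "of_int p * \<omega>1 \<in> L" "\<wp> (z + of_int p * \<omega>1) = \<wp> z"
    using generator_multiples[where f = \<wp>, OF generators_mem(1) per(1) assms(2)] by auto
  then have "z + of_int p * \<omega>1 \<notin> L" using assms by simp
  then have "\<wp> (z + of_int p * \<omega>1 + of_int q * \<omega>2) = \<wp> (z + of_int p * \<omega>1)"
    using generator_multiples[where f = \<wp>, OF generators_mem(2) per(2)] by blast
  with 1 show ?thesis by (simp add: pq algebra_simps)
qed

text \<open>The constant is a quasi-period; it cancels in differences of two values of \<open>\<zeta>\<close>.\<close>
lemma zeta_shift_const:
  assumes \<omega>: "\<omega> \<in> L"
  obtains \<eta> where "\<And>z. z \<notin> L \<Longrightarrow> \<zeta> (z + \<omega>) = \<zeta> z + \<eta>"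
proof -
  have "(\<lambda>z. \<zeta> (z + \<omega>) - \<zeta> z) constant_on (- L)"
  proof (rule has_field_derivative_0_imp_constant_on)
    fix z assume "z \<in> - L"
    then have z: "z \<notin> L" by simp
    have 1: "((\<lambda>z. \<zeta> (z + \<omega>)) has_field_derivative - \<wp> z) (at z)"
      using zeta_deriv[of "z + \<omega>"] z \<omega> wp_periodic[of \<omega> z] DERIV_shift[of \<zeta>] by auto
    show "((\<lambda>z. \<zeta> (z + \<omega>) - \<zeta> z) has_field_derivative 0) (at z)"
      using DERIV_diff[OF 1 zeta_deriv[OF z]] by simp
  qed (auto simp: connected_compl_lattice open_compl_lattice)
  then obtain c where "\<And>z. z \<notin> L \<Longrightarrow> \<zeta> (z + \<omega>) - \<zeta> z = c"
    unfolding constant_on_def by auto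
  then show thesis by (intro that[of c]) (simp add: algebra_simps)
qed

section \<open>The addition theorem\<close>

text \<open>The sum of \<open>\<zeta>\<close> over the three points \<open>u - v\<close>, \<open>-u\<close>, \<open>v\<close>, whose sum is \<open>0\<close>; \<open>\<zeta>\<close> is odd. The asymmetric
  form shows the logarithmic derivative in \<open>u\<close> of \<open>\<sigma>(u - v) / \<sigma>(u) exp(\<zeta>(v) u)\<close>.\<close>
definition zsum :: "complex \<Rightarrow> complex \<Rightarrow> complex" where
  "zsum u v = \<zeta> (u - v) - \<zeta> u + \<zeta> v"

lemma zsum_swap: "zsum u (u - v) = zsum u v"
  by (simp add: zsum_def)

lemma zsum_reflect: "zsum (v - u) v = zsum u v"
  using zeta_odd[of u] zeta_odd[of "u - v"] by (simp add: zsum_def)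

lemma zsum_periodic:
  assumes "\<omega> \<in> L" "u \<notin> L" "u - v \<notin> L"
  shows "zsum (u + \<omega>) v = zsum u v"
proof -
  obtain \<eta> where "\<And>z. z \<notin> L \<Longrightarrow> \<zeta> (z + \<omega>) = \<zeta> z + \<eta>"
    using zeta_shift_const[OF assms(1)] by blast
  from this[OF assms(2)] this[OF assms(3)] show ?thesis
    by (simp add: zsum_def algebra_simps)
qed

lemma zsum_deriv:
  assumes "u \<notin> L" "u - v \<notin> L"
  shows "((\<lambda>u. zsum u v) has_field_derivative \<wp> u - \<wp> (u - v)) (at u)"
proof -
  have "((\<lambda>u. \<zeta> (u - v)) has_field_derivative - \<wp> (u - v)) (at u)"
    using DERIV_shift[of \<zeta> "- \<wp> (u - v)" u "- v"] zeta_deriv[OF assms(2)] by simp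
  from DERIV_add[OF DERIV_diff[OF this zeta_deriv[OF assms(1)]] DERIV_const[of "\<zeta> v"]]
  show ?thesis unfolding zsum_def by simp
qed

lemma parallelogram_translate:
  obtains \<omega> s t where "\<omega> \<in> L" "s \<in> {0..1}" "t \<in> {0..1}"
    "z = of_real s * \<omega>1 + of_real t * \<omega>2 + \<omega>"
proof -
  define \<tau> where "\<tau> = \<omega>2 / \<omega>1"
  have im: "Im \<tau> \<noteq> 0"
    using not_collinear by (auto simp: \<tau>_def complex_is_Real_iff)
  define y where "y = Im (z / \<omega>1) / Im \<tau>"
  define x where "x = Re (z / \<omega>1) - y * Re \<tau>"
  have "z / \<omega>1 = of_real x + of_real y * \<tau>"
    using im by (intro complex_eqI) (simp_all add: x_def y_def)
  then have z: "z = of_real x * \<omega>1 + of_real y * \<omega>2"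
    using nonzero by (simp add: \<tau>_def field_simps)
  show thesis
  proof (rule that[of "of_int \<lfloor>x\<rfloor> * \<omega>1 + of_int \<lfloor>y\<rfloor> * \<omega>2" "frac x" "frac y"])
    show "of_int \<lfloor>x\<rfloor> * \<omega>1 + of_int \<lfloor>y\<rfloor> * \<omega>2 \<in> L" unfolding period_lattice_def by blast
    show "z = of_real (frac x) * \<omega>1 + of_real (frac y) * \<omega>2 +
            (of_int \<lfloor>x\<rfloor> * \<omega>1 + of_int \<lfloor>y\<rfloor> * \<omega>2)"
      unfolding z frac_def by (simp add: algebra_simps)
  qed (auto simp: less_imp_le frac_lt_1)
qed

text \<open>All values are taken on the compact period parallelogram, so Liouville's theorem applies.\<close>
lemma elliptic_entire_constant:
  assumes hol: "G holomorphic_on UNIV" and per: "\<And>z \<omega>. \<omega> \<in> L \<Longrightarrow> G (z + \<omega>) = G z"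
  shows "G z = G w"
proof -
  define K where "K = (\<lambda>(s::real, t::real). of_real s * \<omega>1 + of_real t * \<omega>2) ` ({0..1} \<times> {0..1})"
  have "compact K" unfolding K_def
    by (intro compact_continuous_image compact_Times)
       (auto simp: case_prod_unfold intro!: continuous_intros)
  then have "compact (G ` K)"
    by (rule compact_continuous_image[rotated])
       (meson hol holomorphic_on_imp_continuous_on continuous_on_subset top_greatest)
  moreover have "range G \<subseteq> G ` K"
  proof (rule image_subsetI)
    fix z
    obtain \<omega> s t where "\<omega> \<in> L" "s \<in> {0..1}" "t \<in> {0..1}"
      "z = of_real s * \<omega>1 + of_real t * \<omega>2 + \<omega>"
      using parallelogram_translate by blast
    then have "G z = G (of_real s * \<omega>1 + of_real t * \<omega>2)"
      "of_real s * \<omega>1 + of_real t * \<omega>2 \<in> K"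
      using per by (auto simp: K_def)
    then show "G z \<in> G ` K" by simp
  qed
  ultimately have "bounded (range G)"
    using compact_imp_bounded bounded_subset by blast
  then show ?thesis
    using Liouville_theorem[OF hol] by (auto simp: constant_on_def)
qed

text \<open>As a function of \<open>u\<close>, the difference \<open>F\<close> of the two sides is elliptic with poles at most on \<open>L\<close> and
  \<open>v + L\<close>. Near \<open>0\<close> the double and simple poles cancel and \<open>F\<close> tends to \<open>0\<close>. Since \<open>F\<close> is invariant
  under periods and under \<open>u \<mapsto> v - u\<close>, it tends to \<open>0\<close> at all exceptional points, so its extension by
  \<open>0\<close> is entire and elliptic, hence constant and equal to its value \<open>0\<close> at the origin.\<close>
theorem Frobenius_Stickelberger:
  assumes u: "u \<notin> L" and v: "v \<notin> L" and uv: "u - v \<notin> L"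
  shows "(zsum u v)^2 = \<wp> (u - v) + \<wp> u + \<wp> v"
proof -
  define F where "F = (\<lambda>u. (zsum u v)^2 - \<wp> (u - v) - \<wp> u - \<wp> v)"
  define P where "P = L \<union> {u. u - v \<in> L}"
  define G where "G = (\<lambda>u. if u \<in> P then 0 else F u)"
  have P_sparse: "P sparse_in UNIV"
    unfolding P_def using lattice_sparse lattice_translate_sparse[of "- v"]
    by (intro sparse_in_union') auto
  have G_per: "G (z + \<omega>) = G z" if \<omega>: "\<omega> \<in> L" for z \<omega>
  proof -
    have "z + \<omega> - v = (z - v) + \<omega>" by simp
    then have mem: "z + \<omega> \<in> P \<longleftrightarrow> z \<in> P" using \<omega> by (simp only: P_def Un_iff mem_Collect_eq add_mem_iff)
    show ?thesis
    proof (cases "z \<in> P")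
      case False
      then have "z \<notin> L" "z - v \<notin> L" by (auto simp: P_def)
      with \<omega> have "zsum (z + \<omega>) v = zsum z v" "\<wp> (z + \<omega>) = \<wp> z" "\<wp> (z - v + \<omega>) = \<wp> (z - v)"
        by (simp_all add: zsum_periodic wp_periodic)
      then show ?thesis using False mem by (simp add: G_def F_def algebra_simps)
    qed (simp add: G_def mem)
  qed
  have G_refl: "G (v - z) = G z" for z
  proof -
    have mem: "v - z \<in> P \<longleftrightarrow> z \<in> P"
      using minus_diff_mem_iff[of v z] minus_mem_iff[of z] by (auto simp: P_def)
    have "F (v - z) = F z"
      using zsum_reflect[of v z] wp_even[of z] wp_even[of "z - v"] by (simp add: F_def)
    then show ?thesis by (simp add: G_def mem)
  qed
  have F_lim: "(F \<longlongrightarrow> 0) (at 0)"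
  proof -
    (* zsum u v = D u - 1 / u with D holomorphic at 0, D 0 = 0 and D' 0 = - wp v, so that
       squaring leaves 1 / u^2 + 2 wp v + o(1). *)
    define D where "D = (\<lambda>u. \<zeta> (u - v) + \<zeta> v - zeta_reg u)"
    have D0: "D 0 = 0"
      by (simp add: D_def zeta_odd zeta_reg_def zeta_term_def)
    have reg0: "wp_reg 0 = 0" by (simp add: wp_reg_def wp_term_def)
    have mv: "0 - v \<notin> L" using v by simp
    have dz: "((\<lambda>u. \<zeta> (u - v)) has_field_derivative - \<wp> v) (at 0)"
      using DERIV_shift[of \<zeta> "- \<wp> (0 - v)" 0 "- v"] zeta_deriv[OF mv] by (simp add: wp_even)
    have dD: "(D has_field_derivative - \<wp> v) (at 0)"
      unfolding D_def using reg0
      by (auto intro!: derivative_eq_intros dz zeta_reg_deriv)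
    then have q: "((\<lambda>u. D u / u) \<longlongrightarrow> - \<wp> v) (at 0)"
      by (simp add: has_field_derivative_iff D0)
    have D: "(D \<longlongrightarrow> 0) (at 0)"
      using DERIV_isCont[OF dD] by (simp add: isCont_def D0)
    have w: "(wp_reg \<longlongrightarrow> 0) (at 0)"
      using DERIV_isCont[OF wp_reg_deriv[of 0]] by (simp add: isCont_def reg0)
    have s: "((\<lambda>u. \<wp> (u - v)) \<longlongrightarrow> \<wp> v) (at 0)"
    proof -
      have "isCont (\<lambda>u. \<wp> (u - v)) 0"
        using DERIV_shift[of \<wp> "deriv \<wp> (0 - v)" 0 "- v"] wp_has_deriv[OF mv] DERIV_isCont by auto
      then show ?thesis by (simp add: isCont_def wp_even)
    qed
    have "((\<lambda>u. (D u)^2 - 2 * (D u / u) - wp_reg u - \<wp> (u - v) - \<wp> v) \<longlongrightarrow>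
            0^2 - 2 * (- \<wp> v) - 0 - \<wp> v - \<wp> v) (at 0)"
      by (intro tendsto_intros q D w s)
    then have "((\<lambda>u. (D u)^2 - 2 * (D u / u) - wp_reg u - \<wp> (u - v) - \<wp> v) \<longlongrightarrow> 0) (at 0)"
      by simp
    moreover have "\<forall>\<^sub>F u in at 0. (D u)^2 - 2 * (D u / u) - wp_reg u - \<wp> (u - v) - \<wp> v = F u"
    proof -
      have "(D u)^2 - 2 * (D u / u) - wp_reg u - \<wp> (u - v) - \<wp> v = F u" if "u \<noteq> 0" for u
      proof -
        have eq: "zsum u v = D u - 1 / u" by (simp add: zsum_def D_def zeta_conv_reg[of u])
        have "(zsum u v)^2 = (D u)^2 - 2 * (D u / u) + 1 / u^2"
          unfolding eq by (simp add: power2_eq_square algebra_simps)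
        then show ?thesis by (simp add: F_def wp_conv_reg[of u])
      qed
      then show ?thesis by (simp add: eventually_at_filter)
    qed
    ultimately show ?thesis by (rule Lim_transform_eventually)
  qed
  have G_lim0: "(G \<longlongrightarrow> 0) (at 0)"
  proof (rule Lim_transform_eventually[OF F_lim])
    have "\<forall>\<^sub>F u in at 0. u \<notin> P" using P_sparse by (simp add: sparse_in_eventually_iff)
    then show "\<forall>\<^sub>F u in at 0. F u = G u" by eventually_elim (simp add: G_def)
  qed
  have G_limL: "(G \<longlongrightarrow> 0) (at \<omega>)" if "\<omega> \<in> L" for \<omega>
    using LIM_offset_zero_cancel[of G \<omega> 0] G_lim0 G_per[OF that] by (simp add: add.commute)
  have G_cont: "isCont G z" for z
  proof (cases "z \<in> P")
    case False
    then have z: "z \<notin> L" "z - v \<notin> L" by (auto simp: P_def)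
    have "isCont (\<lambda>u. zsum u v) z" "isCont \<wp> z"
      using zsum_deriv[OF z] wp_has_deriv[OF z(1)] DERIV_isCont by blast+
    moreover have "isCont (\<lambda>u. \<wp> (u - v)) z"
      using DERIV_shift[of \<wp> "deriv \<wp> (z - v)" z "- v"] wp_has_deriv[OF z(2)] DERIV_isCont by auto
    ultimately have "isCont F z" unfolding F_def by (intro continuous_intros)
    moreover have "\<forall>\<^sub>F u in nhds z. F u = G u"
    proof -
      have "\<forall>\<^sub>F u in nhds z. u \<in> - P"
        using sparse_in_UNIV_imp_closed[OF P_sparse] False by (intro eventually_nhds_in_open) auto
      then show ?thesis by eventually_elim (simp add: G_def)
    qed
    ultimately show ?thesis using isCont_cong by blast
  next
    case True
    have "(G \<longlongrightarrow> 0) (at z)"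
    proof (cases "z \<in> L")
      case False
      with True have "v - z \<in> L" by (auto simp: P_def minus_diff_mem_iff)
      from G_limL[OF this] have "((\<lambda>u. G (v - u)) \<longlongrightarrow> 0) (at z)"
        by (rule filterlim_compose) (auto intro!: filterlim_atI tendsto_eq_intros simp: eventually_at_filter)
      then show ?thesis by (simp add: G_refl)
    qed (rule G_limL)
    with True show ?thesis by (simp add: isCont_def G_def)
  qed
  have "G holomorphic_on - P"
  proof -
    have "F field_differentiable at z" if "z \<notin> P" for z
    proof -
      have z: "z \<notin> L" "z - v \<notin> L" using that by (auto simp: P_def)
      have "((\<lambda>u. \<wp> (u - v)) has_field_derivative deriv \<wp> (z - v)) (at z)"
        using DERIV_shift[of \<wp> "deriv \<wp> (z - v)" z "- v"] wp_has_deriv[OF z(2)] by simp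
      then show ?thesis unfolding F_def
        using zsum_deriv[OF z] wp_has_deriv[OF z(1)]
        by (intro derivative_intros) (auto simp: field_differentiable_def)
    qed
    then have "F holomorphic_on - P" by (simp add: holomorphic_on_def field_differentiable_at_within)
    then show ?thesis by (rule holomorphic_transform) (simp add: G_def)
  qed
  then have "G holomorphic_on UNIV"
    by (rule continuous_off_sparse_holomorphic[OF P_sparse]) (rule G_cont)
  then have "G u = G 0" by (rule elliptic_entire_constant) (rule G_per)
  then have "F u = 0" using u uv by (simp add: G_def P_def)
  then show ?thesis by (simp add: F_def algebra_simps)
qed

lemma zsum_riccati:
  assumes "u \<notin> L" "v \<notin> L" "u - v \<notin> L"
  shows "((\<lambda>u. zsum u v) has_field_derivative 2 * \<wp> u + \<wp> v - (zsum u v)^2) (at u)"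
  using zsum_deriv[of u v] Frobenius_Stickelberger[OF assms] assms by simp

text \<open>Differentiating the addition theorem in \<open>u\<close> gives the relation for the points \<open>u\<close> and \<open>u - w\<close>.
  Taking \<open>w = u - v\<close>, which leaves \<open>zsum\<close> unchanged, turns them into \<open>u\<close> and \<open>v\<close>. The relation is a product, so
  that it carries information at the zeros of \<open>\<wp> u - \<wp> v\<close>.\<close>
lemma zsum_mult_wp_diff:
  assumes u: "u \<notin> L" and v: "v \<notin> L" and uv: "u - v \<notin> L"
  shows "2 * zsum u v * (\<wp> u - \<wp> v) = deriv \<wp> u + deriv \<wp> v"
proof -
  have *: "2 * zsum u w * (\<wp> u - \<wp> (u - w)) = deriv \<wp> u + deriv \<wp> (u - w)"
    if w: "w \<notin> L" "u - w \<notin> L" for w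
  proof -
    have 1: "((\<lambda>u. \<wp> (u - w)) has_field_derivative deriv \<wp> (u - w)) (at u)"
      using DERIV_shift[of \<wp> "deriv \<wp> (u - w)" u "- w"] wp_has_deriv[OF w(2)] by simp
    have 2: "((\<lambda>u. \<wp> (u - w) + \<wp> u + \<wp> w) has_field_derivative deriv \<wp> (u - w) + deriv \<wp> u) (at u)"
      using DERIV_add[OF DERIV_add[OF 1 wp_has_deriv[OF u]] DERIV_const] by simp
    have 3: "((\<lambda>u. (zsum u w)^2) has_field_derivative 2 * zsum u w * (\<wp> u - \<wp> (u - w))) (at u)"
      using DERIV_power[OF zsum_deriv[OF u w(2)], of 2] by (simp add: mult_ac)
    have "open (- (L \<union> {u. u + - w \<in> L}))"
      using sparse_in_union'[OF lattice_sparse lattice_translate_sparse, THEN sparse_in_UNIV_imp_closed]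
      by blast
    moreover have "u \<in> - (L \<union> {u. u + - w \<in> L})" using u w by simp
    ultimately have "((\<lambda>u. (zsum u w)^2) has_field_derivative deriv \<wp> (u - w) + deriv \<wp> u) (at u)"
      by (rule has_field_derivative_transform_within_open[OF 2])
         (use Frobenius_Stickelberger[OF _ w(1)] in auto)
    from DERIV_unique[OF this 3] show ?thesis by (simp add: add.commute)
  qed
  from *[of "u - v"] u v uv show ?thesis by (simp add: zsum_swap)
qed

end

section \<open>The sigma function\<close>

text \<open>The derivatives of the factors are given in logarithmic form, as for the factors of \<open>\<sigma>\<close> below.\<close>
lemma has_field_derivative_prod_log:
  fixes f :: "'i \<Rightarrow> complex \<Rightarrow> complex"
  assumes "finite F" "\<And>i. i \<in> F \<Longrightarrow> (f i has_field_derivative f i z * d i) (at z)"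
  shows "((\<lambda>z. \<Prod>i\<in>F. f i z) has_field_derivative (\<Prod>i\<in>F. f i z) * (\<Sum>i\<in>F. d i)) (at z)"
  using assms
proof (induction F rule: finite_induct)
  case (insert j F)
  have "((\<lambda>z. f j z * (\<Prod>i\<in>F. f i z)) has_field_derivative
          f j z * d j * (\<Prod>i\<in>F. f i z) + (\<Prod>i\<in>F. f i z) * (\<Sum>i\<in>F. d i) * f j z) (at z)"
    by (rule DERIV_mult) (use insert in auto)
  then show ?case using insert.hyps by (simp add: algebra_simps)
qed simp

context period_pair
begin

definition sigma_factor :: "complex \<Rightarrow> complex \<Rightarrow> complex" where
  "sigma_factor \<omega> z = (1 - z / \<omega>) * exp (z / \<omega> + z^2 / (2 * \<omega>^2))"

text \<open>A logarithm of \<open>sigma_factor\<close> where \<open>z\<close> is small compared with \<open>\<omega>\<close>; there its derivative is the term of \<open>\<zeta>\<close>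
  belonging to \<open>\<omega>\<close>.\<close>
definition sigma_log :: "complex \<Rightarrow> complex \<Rightarrow> complex" where
  "sigma_log \<omega> z = Ln (1 - z / \<omega>) + z / \<omega> + z^2 / (2 * \<omega>^2)"

lemma sigma_log_facts:
  assumes "z \<in> ball 0 R" "norm \<omega> \<ge> 2 * R"
  shows "exp (sigma_log \<omega> z) = sigma_factor \<omega> z"
    and "(sigma_log \<omega> has_field_derivative zeta_term \<omega> z) (at z)"
proof -
  note * = norm_diff_lower[OF assms]
  have R: "norm z < R" using assms(1) by simp
  then have "norm (z / \<omega>) < 1"
    using assms(2) * norm_ge_zero[of z] by (simp add: norm_divide del: norm_ge_zero)
  then have "\<bar>Re (z / \<omega>)\<bar> < 1" using abs_Re_le_cmod[of "z / \<omega>"] by linarith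
  then have pos: "1 - z / \<omega> \<notin> \<real>\<^sub>\<le>\<^sub>0"
    by (auto simp: complex_nonpos_Reals_iff)
  then have nz: "1 - z / \<omega> \<noteq> 0" by auto
  then show "exp (sigma_log \<omega> z) = sigma_factor \<omega> z"
    by (simp add: sigma_log_def sigma_factor_def exp_add)
  have "(sigma_log \<omega> has_field_derivative (- (1 / \<omega>)) * inverse (1 - z / \<omega>) + 1 / \<omega> + 2 * z / (2 * \<omega>^2)) (at z)"
    unfolding sigma_log_def[abs_def] using pos
    by (auto intro!: derivative_eq_intros simp: * field_simps)
  moreover have "1 / (z - \<omega>) = (- (1 / \<omega>)) * inverse (1 - z / \<omega>)"
    using * by (simp add: field_simps)
  then have "zeta_term \<omega> z = (- (1 / \<omega>)) * inverse (1 - z / \<omega>) + 1 / \<omega> + 2 * z / (2 * \<omega>^2)"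
    unfolding zeta_term_def by simp
  ultimately show "(sigma_log \<omega> has_field_derivative zeta_term \<omega> z) (at z)"
    by (simp only:)
qed

text \<open>The logarithm vanishes at \<open>0\<close>, so the bound on its derivative \<open>zeta_term\<close> suffices.\<close>
lemma sigma_log_bound:
  assumes z: "z \<in> ball 0 R" and \<omega>: "norm \<omega> \<ge> 2 * R"
  shows "norm (sigma_log \<omega> z) \<le> 2 * R^3 / norm \<omega> ^ 3"
proof -
  have R: "norm z < R" using z by simp
  then have "R > 0" using norm_ge_zero[of z] by linarith
  have "norm (sigma_log \<omega> z - sigma_log \<omega> 0) \<le> 2 * R^2 / norm \<omega> ^ 3 * norm (z - 0)"
    by (rule field_differentiable_bound[of "ball 0 R" _ "zeta_term \<omega>"])
       (use sigma_log_facts(2)[OF _ \<omega>] zeta_term_bound[OF _ \<omega>] z \<open>R > 0\<close>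
        in \<open>auto intro: has_field_derivative_at_within\<close>)
  also have "\<dots> \<le> 2 * R^2 / norm \<omega> ^ 3 * R"
    using R by (intro mult_left_mono) auto
  finally show ?thesis by (simp add: sigma_log_def power2_eq_square power3_eq_cube)
qed

lemma sigma_factor_deriv:
  assumes "\<omega> \<noteq> 0" "z \<noteq> \<omega>"
  shows "(sigma_factor \<omega> has_field_derivative sigma_factor \<omega> z * zeta_term \<omega> z) (at z)"
proof -
  let ?e = "exp (z / \<omega> + z^2 / (2 * \<omega>^2))"
  have "(sigma_factor \<omega> has_field_derivative
          (- (1 / \<omega>)) * ?e + (1 - z / \<omega>) * (?e * (1 / \<omega> + 2 * z / (2 * \<omega>^2)))) (at z)"
  proof -
    have 1: "((\<lambda>z. z / \<omega> + z^2 / (2 * \<omega>^2)) has_field_derivative 1 / \<omega> + 2 * z / (2 * \<omega>^2)) (at z)"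
      using assms
      by (auto intro!: derivative_eq_intros simp: power2_eq_square power4_eq_xxxx divide_simps)
    have 2: "((\<lambda>z. 1 - z / \<omega>) has_field_derivative - (1 / \<omega>)) (at z)"
      using assms by (auto intro!: derivative_eq_intros)
    show ?thesis
      unfolding sigma_factor_def[abs_def]
      by (rule DERIV_cong[OF DERIV_mult[OF 2 DERIV_fun_exp[OF 1]]]) (simp only: ac_simps)
  qed
  moreover have "(- (1 / \<omega>)) * ?e + (1 - z / \<omega>) * (?e * (1 / \<omega> + 2 * z / (2 * \<omega>^2))) =
      sigma_factor \<omega> z * zeta_term \<omega> z"
  proof -
    have *: "- (1 / \<omega>) = (1 - z / \<omega>) * (1 / (z - \<omega>))"
      using assms by (simp add: field_simps)
    show ?thesis
      unfolding * sigma_factor_def zeta_term_def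
      by (simp add: algebra_simps add_divide_distrib diff_divide_distrib)
  qed
  ultimately show ?thesis by (simp only:)
qed

text \<open>On a disc the factors of the finitely many short periods are kept as a product and all others are
  replaced by the exponential of the sum of their logarithms. That sum converges absolutely, hence the product
  converges along the net of finite sets, and it may be differentiated termwise.\<close>
lemma sigma_local:
  assumes R: "R > 0"
  defines "F \<equiv> {\<omega>\<in>L - {0}. norm \<omega> < 2 * R}" and "A \<equiv> {\<omega>\<in>L - {0}. norm \<omega> \<ge> 2 * R}"
  obtains T where "\<And>z. z \<in> ball 0 R \<Longrightarrow> \<sigma> z = z * (\<Prod>\<omega>\<in>F. sigma_factor \<omega> z) * exp (T z)"
    "\<And>z. z \<in> ball 0 R \<Longrightarrow> (T has_field_derivative infsum (\<lambda>\<omega>. zeta_term \<omega> z) A) (at z)"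
    "finite F"
proof -
  have F: "finite F" by (rule finite_subset[OF _ finite_in_ball[of "2 * R"]]) (auto simp: F_def)
  have M: "(\<lambda>\<omega>. 2 * R^3 * (1 / norm \<omega> ^ 3)) summable_on A"
    by (rule summable_on_cmult_right, rule summable_on_subset_banach[OF inverse_cube_summable])
       (auto simp: A_def)
  have bd: "norm (sigma_log \<omega> z) \<le> 2 * R^3 * (1 / norm \<omega> ^ 3)" if "\<omega> \<in> A" "z \<in> ball 0 R" for \<omega> z
    using sigma_log_bound[OF that(2), of \<omega>] that(1) by (simp add: A_def)
  define T where "T = (\<lambda>z. infsum (\<lambda>\<omega>. sigma_log \<omega> z) A)"
  have T: "(T has_field_derivative infsum (\<lambda>\<omega>. zeta_term \<omega> z) A) (at z)" if "z \<in> ball 0 R" for z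
    unfolding T_def
    by (rule infsum_has_field_derivative(2)[OF M bd _ that])
       (use sigma_log_facts(2) in \<open>auto simp: A_def\<close>)
  have prod: "\<sigma> z = z * (\<Prod>\<omega>\<in>F. sigma_factor \<omega> z) * exp (T z)" if z: "z \<in> ball 0 R" for z
  proof -
    have "(\<lambda>\<omega>. sigma_log \<omega> z) summable_on A"
      by (rule abs_summable_summable, rule summable_on_comparison_test[OF M]) (use bd z in auto)
    then have "((\<lambda>\<omega>. sigma_log \<omega> z) has_sum T z) A" by (simp add: T_def)
    then have "((\<lambda>\<omega>. if \<omega> \<in> F then 0 else sigma_log \<omega> z) has_sum T z) (L - {0})"
      by (rule has_sum_cong_neutral[THEN iffD1, rotated 3]) (auto simp: A_def F_def)
    then have "((\<lambda>X. exp (\<Sum>\<omega>\<in>X. if \<omega> \<in> F then 0 else sigma_log \<omega> z)) \<longlongrightarrow> exp (T z))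
        (finite_subsets_at_top (L - {0}))"
      unfolding has_sum_def by (rule tendsto_exp)
    then have "((\<lambda>X. (\<Prod>\<omega>\<in>F. sigma_factor \<omega> z) * exp (\<Sum>\<omega>\<in>X. if \<omega> \<in> F then 0 else sigma_log \<omega> z))
        \<longlongrightarrow> (\<Prod>\<omega>\<in>F. sigma_factor \<omega> z) * exp (T z)) (finite_subsets_at_top (L - {0}))"
      by (rule tendsto_mult_left)
    moreover have "\<forall>\<^sub>F X in finite_subsets_at_top (L - {0}).
        (\<Prod>\<omega>\<in>F. sigma_factor \<omega> z) * exp (\<Sum>\<omega>\<in>X. if \<omega> \<in> F then 0 else sigma_log \<omega> z) =
        (\<Prod>\<omega>\<in>X. sigma_factor \<omega> z)"
    proof -
      have "(\<Prod>\<omega>\<in>F. sigma_factor \<omega> z) * exp (\<Sum>\<omega>\<in>X. if \<omega> \<in> F then 0 else sigma_log \<omega> z) =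
            (\<Prod>\<omega>\<in>X. sigma_factor \<omega> z)" if X: "finite X" "F \<subseteq> X" "X \<subseteq> L - {0}" for X
      proof -
        have "exp (\<Sum>\<omega>\<in>X. if \<omega> \<in> F then 0 else sigma_log \<omega> z) =
              (\<Prod>\<omega>\<in>X. exp (if \<omega> \<in> F then 0 else sigma_log \<omega> z))"
          using X(1) by (rule exp_sum)
        also have "\<dots> = (\<Prod>\<omega>\<in>X - F. exp (if \<omega> \<in> F then 0 else sigma_log \<omega> z))"
          by (rule prod.mono_neutral_right) (use X in auto)
        also have "\<dots> = (\<Prod>\<omega>\<in>X - F. sigma_factor \<omega> z)"
        proof (rule prod.cong[OF refl])
          fix \<omega> assume "\<omega> \<in> X - F"
          then have "norm \<omega> \<ge> 2 * R" "\<omega> \<notin> F" using X by (auto simp: F_def)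
          then show "exp (if \<omega> \<in> F then 0 else sigma_log \<omega> z) = sigma_factor \<omega> z"
            using sigma_log_facts(1)[OF z] by simp
        qed
        finally show ?thesis
          using prod.subset_diff[OF X(2,1), of "\<lambda>\<omega>. sigma_factor \<omega> z"] by (simp add: mult.commute)
      qed
      moreover have "F \<subseteq> L - {0}" by (auto simp: F_def)
      ultimately show ?thesis
        using F unfolding eventually_finite_subsets_at_top by blast
    qed
    ultimately have "((\<lambda>X. \<Prod>\<omega>\<in>X. sigma_factor \<omega> z) \<longlongrightarrow> (\<Prod>\<omega>\<in>F. sigma_factor \<omega> z) * exp (T z))
        (finite_subsets_at_top (L - {0}))"
      by (rule Lim_transform_eventually)
    then have "Lim (finite_subsets_at_top (L - {0})) (\<lambda>X. \<Prod>\<omega>\<in>X. sigma_factor \<omega> z) =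
        (\<Prod>\<omega>\<in>F. sigma_factor \<omega> z) * exp (T z)"
      by (rule tendsto_Lim[rotated]) simp
    then show ?thesis by (simp add: wsigma_def sigma_factor_def)
  qed
  show thesis by (rule that[OF prod T F])
qed

lemma sigma_nonzero: "z \<notin> L \<Longrightarrow> \<sigma> z \<noteq> 0"
proof -
  assume z: "z \<notin> L"
  define R where "R = norm z + 1"
  have R: "R > 0" "z \<in> ball 0 R" by (auto simp: R_def add_nonneg_pos)
  define F where "F = {\<omega>\<in>L - {0}. norm \<omega> < 2 * R}"
  define A where "A = {\<omega>\<in>L - {0}. norm \<omega> \<ge> 2 * R}"
  obtain T where T: "\<And>z. z \<in> ball 0 R \<Longrightarrow> \<sigma> z = z * (\<Prod>\<omega>\<in>F. sigma_factor \<omega> z) * exp (T z)"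
    "\<And>z. z \<in> ball 0 R \<Longrightarrow> (T has_field_derivative infsum (\<lambda>\<omega>. zeta_term \<omega> z) A) (at z)" "finite F"
    using sigma_local[OF R(1)] unfolding F_def A_def by blast
  show ?thesis using T(1)[OF R(2)] T(3) z by (auto simp: F_def sigma_factor_def)
qed

lemma sigma_deriv: "z \<notin> L \<Longrightarrow> (\<sigma> has_field_derivative \<zeta> z * \<sigma> z) (at z)"
proof -
  assume z: "z \<notin> L"
  then have "z \<noteq> 0" by auto
  define R where "R = norm z + 1"
  have R: "R > 0" "z \<in> ball 0 R" by (auto simp: R_def add_nonneg_pos)
  define F where "F = {\<omega>\<in>L - {0}. norm \<omega> < 2 * R}"
  define A where "A = {\<omega>\<in>L - {0}. norm \<omega> \<ge> 2 * R}"
  obtain T where T: "\<And>z. z \<in> ball 0 R \<Longrightarrow> \<sigma> z = z * (\<Prod>\<omega>\<in>F. sigma_factor \<omega> z) * exp (T z)"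
    "\<And>z. z \<in> ball 0 R \<Longrightarrow> (T has_field_derivative infsum (\<lambda>\<omega>. zeta_term \<omega> z) A) (at z)" "finite F"
    using sigma_local[OF R(1)] unfolding F_def A_def by blast
  have fd: "((\<lambda>z. \<Prod>\<omega>\<in>F. sigma_factor \<omega> z) has_field_derivative
      (\<Prod>\<omega>\<in>F. sigma_factor \<omega> z) * (\<Sum>\<omega>\<in>F. zeta_term \<omega> z)) (at z)"
    using T(3) z by (intro has_field_derivative_prod_log sigma_factor_deriv) (auto simp: F_def)
  have sum: "zeta_reg z = (\<Sum>\<omega>\<in>F. zeta_term \<omega> z) + infsum (\<lambda>\<omega>. zeta_term \<omega> z) A"
  proof -
    have S: "(\<lambda>\<omega>. zeta_term \<omega> z) summable_on (L - {0})" using z by (intro zeta_term_summable) auto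
    have "(\<lambda>\<omega>. zeta_term \<omega> z) summable_on A"
      by (rule summable_on_subset_banach[OF S]) (auto simp: A_def)
    moreover have "L - {0} = F \<union> A" "F \<inter> A = {}" by (auto simp: F_def A_def)
    ultimately show ?thesis using T(3) by (simp add: zeta_reg_def infsum_Un_disjoint)
  qed
  have "((\<lambda>z. z * (\<Prod>\<omega>\<in>F. sigma_factor \<omega> z) * exp (T z)) has_field_derivative
      \<zeta> z * (z * (\<Prod>\<omega>\<in>F. sigma_factor \<omega> z) * exp (T z))) (at z)"
    by (rule derivative_eq_intros fd T(2)[OF R(2)] refl)+
       (use \<open>z \<noteq> 0\<close> in \<open>simp add: zeta_conv_reg sum field_simps\<close>)
  then have "(\<sigma> has_field_derivative \<zeta> z * (z * (\<Prod>\<omega>\<in>F. sigma_factor \<omega> z) * exp (T z))) (at z)"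
    by (rule has_field_derivative_transform_within_open[OF _ open_ball R(2)]) (simp add: T(1))
  then show ?thesis by (simp only: T(1)[OF R(2)])
qed

lemma sigma_holomorphic: "\<sigma> holomorphic_on S"
proof -
  have "\<sigma> field_differentiable at z" for z
  proof -
    define R where "R = norm z + 1"
    have R: "R > 0" "z \<in> ball 0 R" by (auto simp: R_def add_nonneg_pos)
    define F where "F = {\<omega>\<in>L - {0}. norm \<omega> < 2 * R}"
    define A where "A = {\<omega>\<in>L - {0}. norm \<omega> \<ge> 2 * R}"
    obtain T where T: "\<And>z. z \<in> ball 0 R \<Longrightarrow> \<sigma> z = z * (\<Prod>\<omega>\<in>F. sigma_factor \<omega> z) * exp (T z)"
      "\<And>z. z \<in> ball 0 R \<Longrightarrow> (T has_field_derivative infsum (\<lambda>\<omega>. zeta_term \<omega> z) A) (at z)" "finite F"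
      using sigma_local[OF R(1)] unfolding F_def A_def by blast
    have "T holomorphic_on ball 0 R"
      using T(2) by (simp only: holomorphic_on_open[OF open_ball]) blast
    moreover have "sigma_factor \<omega> holomorphic_on ball 0 R" if "\<omega> \<in> F" for \<omega>
      using that unfolding sigma_factor_def[abs_def] F_def by (auto intro!: holomorphic_intros)
    ultimately have "(\<lambda>z. z * (\<Prod>\<omega>\<in>F. sigma_factor \<omega> z) * exp (T z)) holomorphic_on ball 0 R"
      by (intro holomorphic_intros) auto
    then have "\<sigma> holomorphic_on ball 0 R"
      by (rule holomorphic_transform) (simp add: T(1))
    then show ?thesis using R(2) holomorphic_on_imp_differentiable_at by blast
  qed
  then show ?thesis by (simp add: holomorphic_on_def field_differentiable_at_within)
qed

end

section \<open>The elliptic data and the two Baker--Akhiezer functions\<close>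

text \<open>Identities obtained from logarithmic derivatives are extended in this way to the zeros of the function.\<close>
lemma isCont_eq_of_eventually_eq:
  fixes f g :: "complex \<Rightarrow> complex"
  assumes "isCont f x" "isCont g x" "\<forall>\<^sub>F y in at x. f y = g y"
  shows "f x = g x"
proof -
  have "(g \<longlongrightarrow> f x) (at x)"
    using assms(1,3) unfolding isCont_def by (rule Lim_transform_eventually)
  then show ?thesis
    using assms(2) tendsto_unique[of "at x" g] unfolding isCont_def by auto
qed

lemma has_field_derivative_shift:
  "(f has_field_derivative D) (at (x + c)) \<Longrightarrow> ((\<lambda>x. f (x + c)) has_field_derivative D) (at x)"
  by (simp add: DERIV_shift)

lemma quotient_log_deriv:
  fixes g h :: "complex \<Rightarrow> complex"
  assumes "(g has_field_derivative r * g x) (at x)" "(h has_field_derivative s * h x) (at x)" "h x \<noteq> 0"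
  shows "((\<lambda>x. c * g x / (h x * d) * exp (l * x)) has_field_derivative
          (r - s + l) * (c * g x / (h x * d) * exp (l * x))) (at x)"
proof -
  have "((\<lambda>x. (c / d) * (g x / h x) * exp (l * x)) has_field_derivative
      (c / d) * ((r * g x * h x - g x * (s * h x)) / (h x * h x)) * exp (l * x) +
      exp (l * x) * l * ((c / d) * (g x / h x))) (at x)"
    by (rule DERIV_mult[OF DERIV_cmult[OF DERIV_divide[OF assms]]] derivative_eq_intros refl)+ simp
  moreover have "(r * g x * h x - g x * (s * h x)) / (h x * h x) = (r - s) * (g x / h x)"
    using assms(3) by (simp add: field_simps)
  then have "(c / d) * ((r * g x * h x - g x * (s * h x)) / (h x * h x)) * exp (l * x) +
      exp (l * x) * l * ((c / d) * (g x / h x)) = (r - s + l) * ((c / d) * (g x / h x) * exp (l * x))"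
    by (simp only:) (simp only: ring_distribs mult_ac)
  moreover have "c * g y / (h y * d) = (c / d) * (g y / h y)" for y by simp
  ultimately show ?thesis by (simp only:)
qed

locale delaunay_data =
  fixes a m M :: real and \<omega>1 \<omega>2 \<alpha> \<beta> :: complex
  assumes a_pos: "a > 0" and M_eq: "3 * M = m^2 - 2 / a^2 - a^4"
    and data: "elliptic_data a m M \<omega>1 \<omega>2 \<alpha> \<beta>"
begin

sublocale period_pair \<omega>1 \<omega>2
  using data by unfold_locales (auto simp: elliptic_data_def)

abbreviation A where "A \<equiv> complex_of_real a"
abbreviation \<mu> where "\<mu> \<equiv> complex_of_real m"
abbreviation N where "N \<equiv> complex_of_real M"

lemma a_nonzero [simp]: "a \<noteq> 0" using a_pos by simp

lemma N_eq: "3 * N = \<mu>^2 - 2 / A^2 - A^4"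
  using arg_cong[OF M_eq, of complex_of_real] by simp

lemma wp_ode: "t \<notin> L \<Longrightarrow> (deriv \<wp> t)^2 = 4 * (\<wp> t)^3 - 12 * N^2 * \<wp> t + 8 * (N^3 + 2)"
  using data by (auto simp: elliptic_data_def)

lemma alpha: "\<alpha> \<notin> L" "\<wp> \<alpha> = N" "deriv \<wp> \<alpha> = 4"
  using data by (auto simp: elliptic_data_def)

lemma beta: "\<beta> \<notin> L" "\<wp> \<beta> = 2 / A^2 + N" "deriv \<wp> \<beta> = 4 * \<mu> / A^2"
  using data by (auto simp: elliptic_data_def)

lemma wp_holomorphic: "\<wp> holomorphic_on - L"
  using wp_has_deriv by (simp only: holomorphic_on_open[OF open_compl_lattice]) blast

text \<open>Differentiating the differential equation gives \<open>\<wp>' (\<wp>'' - 6 \<wp>\<^sup>2 + 6 M\<^sup>2) = 0\<close>. The first factor does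
  not vanish near \<open>\<alpha>\<close>, so the second one vanishes there, and everywhere by the identity theorem.\<close>
lemma wp_second_deriv: 
  assumes t: "t \<notin> L"
  shows "(deriv \<wp> has_field_derivative 6 * (\<wp> t)^2 - 6 * N^2) (at t)"
proof -
  define d where "d = deriv (deriv \<wp>)"
  have hol: "deriv \<wp> holomorphic_on - L" "d holomorphic_on - L"
    unfolding d_def by (intro holomorphic_deriv wp_holomorphic open_compl_lattice)+
  have d: "(deriv \<wp> has_field_derivative d z) (at z)" if "z \<notin> L" for z
    using holomorphic_derivI[OF hol(1) open_compl_lattice] that by (simp add: d_def)
  have prod: "deriv \<wp> z * (d z - (6 * (\<wp> z)^2 - 6 * N^2)) = 0" if z: "z \<notin> L" for z
  proof -
    have 1: "((\<lambda>z. (deriv \<wp> z)^2) has_field_derivative 2 * (deriv \<wp> z * d z)) (at z)"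
      using DERIV_power[OF d[OF z], of 2] by (simp add: mult_ac)
    have "((\<lambda>z. 4 * (\<wp> z)^3 - 12 * N^2 * \<wp> z + 8 * (N^3 + 2)) has_field_derivative
            (12 * (\<wp> z)^2 - 12 * N^2) * deriv \<wp> z) (at z)"
      using wp_has_deriv[OF z] by (auto intro!: derivative_eq_intros simp: algebra_simps)
    then have 2: "((\<lambda>z. (deriv \<wp> z)^2) has_field_derivative
            (12 * (\<wp> z)^2 - 12 * N^2) * deriv \<wp> z) (at z)"
      by (rule has_field_derivative_transform_within_open[OF _ open_compl_lattice])
         (use z wp_ode in auto)
    have "2 * (deriv \<wp> z * (d z - (6 * (\<wp> z)^2 - 6 * N^2))) = 0"
      using DERIV_unique[OF 1 2] by (simp add: algebra_simps)
    then show ?thesis by simp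
  qed
  define U where "U = - L \<inter> {z. deriv \<wp> z \<noteq> 0}"
  have "U = - L \<inter> deriv \<wp> -` (- {0})" by (auto simp: U_def)
  then have "open U"
    using continuous_on_open_vimage[OF open_compl_lattice] holomorphic_on_imp_continuous_on[OF hol(1)]
    by (metis Int_commute closed_singleton open_Compl)
  have "d t = 6 * (\<wp> t)^2 - 6 * N^2"
  proof (rule analytic_continuation_open[of U "- L" d])
    show "open U" by fact
    show "U \<noteq> {}" using alpha by (auto simp: U_def)
    show "(\<lambda>z. 6 * (\<wp> z)^2 - 6 * N^2) holomorphic_on - L"
      by (intro holomorphic_intros wp_holomorphic)
    show "d z = 6 * (\<wp> z)^2 - 6 * N^2" if "z \<in> U" for z
      using prod[of z] that by (auto simp: U_def)
  qed (use hol t open_compl_lattice connected_compl_lattice in \<open>auto simp: U_def\<close>)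
  with d[OF t] show ?thesis by simp
qed

text \<open>Otherwise the odd periodic function \<open>\<wp>'\<close> would vanish at \<open>\<alpha>\<close>.\<close>
lemma two_alpha: "2 * \<alpha> \<notin> L"
proof
  assume *: "2 * \<alpha> \<in> L"
  have "deriv \<wp> (- \<alpha> + 2 * \<alpha>) = deriv \<wp> (- \<alpha>)"
    using * alpha(1) by (intro deriv_wp_periodic) auto
  then show False using alpha deriv_wp_odd[of \<alpha>] by simp
qed

text \<open>The relation between \<open>zsum\<close> and \<open>\<wp>'\<close> for \<open>\<alpha>\<close> and for \<open>-\<alpha>\<close> would force \<open>\<wp>' = -4\<close> and
  \<open>\<wp>' = 4\<close> at any further zero of \<open>\<wp> - M\<close>.\<close>
lemma wp_eq_N_cases:
  assumes u: "u \<notin> L" and eq: "\<wp> u = N"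
  shows "u - \<alpha> \<in> L \<or> u + \<alpha> \<in> L"
proof (rule ccontr)
  assume *: "\<not> (u - \<alpha> \<in> L \<or> u + \<alpha> \<in> L)"
  have "deriv \<wp> u + deriv \<wp> \<alpha> = 0"
    using zsum_mult_wp_diff[OF u alpha(1)] * alpha eq by simp
  moreover have "deriv \<wp> u + deriv \<wp> (- \<alpha>) = 0"
    using zsum_mult_wp_diff[OF u, of "- \<alpha>"] * alpha eq by (simp add: wp_even)
  ultimately show False using alpha deriv_wp_odd[of \<alpha>] by simp
qed

lemma wp_eq_N_of_shift:
  assumes "u - \<alpha> \<in> L \<or> u + \<alpha> \<in> L"
  shows "u \<notin> L" "\<wp> u = N"
proof -
  have "u \<notin> L \<and> \<wp> u = N"
    using assms
  proof
    assume *: "u - \<alpha> \<in> L"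
    have "u = \<alpha> + (u - \<alpha>)" by simp
    then show ?thesis using add_mem_iff[OF *, of \<alpha>] wp_periodic[OF * alpha(1)] alpha by simp
  next
    assume *: "u + \<alpha> \<in> L"
    have "u = - \<alpha> + (u + \<alpha>)" by simp
    then show ?thesis
      using add_mem_iff[OF *, of "- \<alpha>"] wp_periodic[OF *, of "- \<alpha>"] alpha by (simp add: wp_even)
  qed
  then show "u \<notin> L" "\<wp> u = N" by auto
qed

lemma beta_shift: "\<beta> - \<alpha> \<notin> L" "\<beta> + \<alpha> \<notin> L"
  using wp_eq_N_of_shift[of \<beta>] beta by auto

text \<open>With \<open>v = -\<alpha>\<close>, differentiating \<open>2 zsum u v (\<wp> u - M) = \<wp>' u - 4\<close> at \<open>u = \<alpha>\<close> gives
  \<open>8 zsum \<alpha> v = \<wp>''(\<alpha>) = 0\<close>. Geometrically the tangent to the elliptic curve at \<open>\<alpha>\<close> is horizontal, of height \<open>4\<close>, and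
  meets the curve again at \<open>-2 \<alpha>\<close>.\<close>
lemma zeta_two_alpha: "\<zeta> (2 * \<alpha>) = 2 * \<zeta> \<alpha>"
proof -
  have sum: "\<alpha> - - \<alpha> \<notin> L" using two_alpha by simp
  let ?E = "\<lambda>u. zsum u (- \<alpha>)"
  have 1: "((\<lambda>u. 2 * ?E u * (\<wp> u - N)) has_field_derivative
      2 * (\<wp> \<alpha> - \<wp> (\<alpha> - - \<alpha>)) * (\<wp> \<alpha> - N) + 4 * (2 * ?E \<alpha>)) (at \<alpha>)"
    using DERIV_mult[OF DERIV_cmult[OF zsum_deriv[OF alpha(1) sum], of 2]
        DERIV_diff[OF wp_has_deriv[OF alpha(1)] DERIV_const[of N]]]
    by (simp add: alpha)
  have 2: "((\<lambda>u. deriv \<wp> u + deriv \<wp> (- \<alpha>)) has_field_derivative 6 * (\<wp> \<alpha>)^2 - 6 * N^2) (at \<alpha>)"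
    using DERIV_add[OF wp_second_deriv[OF alpha(1)] DERIV_const] by simp
  have "open (- (L \<union> {u. u + \<alpha> \<in> L}))"
    using sparse_in_union'[OF lattice_sparse lattice_translate_sparse, THEN sparse_in_UNIV_imp_closed]
    by blast
  moreover have "\<alpha> \<in> - (L \<union> {u. u + \<alpha> \<in> L})" using two_alpha alpha by simp
  ultimately have "((\<lambda>u. 2 * ?E u * (\<wp> u - N)) has_field_derivative 6 * (\<wp> \<alpha>)^2 - 6 * N^2) (at \<alpha>)"
    by (rule has_field_derivative_transform_within_open[OF 2])
       (use zsum_mult_wp_diff[of _ "- \<alpha>"] alpha in \<open>auto simp: wp_even\<close>)
  from DERIV_unique[OF this 1] have "?E \<alpha> = 0" by (simp add: alpha)
  then show ?thesis by (simp add: zsum_def zeta_odd)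
qed

lemma wp_two_alpha: "\<wp> (2 * \<alpha>) = - 2 * N" "deriv \<wp> (2 * \<alpha>) = - 4"
proof -
  have sum: "\<alpha> - - \<alpha> \<notin> L" using two_alpha by simp
  have "zsum \<alpha> (- \<alpha>) = 0" by (simp add: zsum_def zeta_odd zeta_two_alpha)
  then have "\<wp> (2 * \<alpha>) + 2 * N = 0"
    using Frobenius_Stickelberger[OF alpha(1) _ sum] alpha by (simp add: wp_even add.commute)
  then show "\<wp> (2 * \<alpha>) = - 2 * N" by (simp add: add_eq_0_iff)
  have "zsum \<alpha> (2 * \<alpha>) = 0" by (simp add: zsum_def zeta_odd zeta_two_alpha)
  then have "deriv \<wp> \<alpha> + deriv \<wp> (2 * \<alpha>) = 0"
    using zsum_mult_wp_diff[OF alpha(1) two_alpha] alpha by simp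
  then show "deriv \<wp> (2 * \<alpha>) = - 4" using alpha by (simp add: add_eq_0_iff)
qed

text \<open>If \<open>\<beta>\<close> were congruent to \<open>-2 \<alpha>\<close>, then \<open>\<wp>'(\<beta>) = 4 m / a\<^sup>2\<close> would equal \<open>\<wp>'(-2 \<alpha>) = 4\<close>.\<close>
lemma beta_plus_two_alpha:
  assumes "m \<noteq> a^2"
  shows "\<beta> + 2 * \<alpha> \<notin> L"
proof
  assume *: "\<beta> + 2 * \<alpha> \<in> L"
  have "deriv \<wp> (- (2 * \<alpha>) + (\<beta> + 2 * \<alpha>)) = deriv \<wp> (- (2 * \<alpha>))"
    using * two_alpha by (intro deriv_wp_periodic) auto
  then have "\<mu> = A^2"
    using deriv_wp_odd[OF two_alpha] wp_two_alpha beta by (simp add: field_simps)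
  then have "m = a^2" by (simp flip: of_real_power)
  with assms show False by simp
qed

definition S :: "complex set" where "S = - Lambda_tilde \<omega>1 \<omega>2 N \<beta>"

text \<open>The zeros of \<open>\<wp> - M\<close> being known, the domain of the matrix solution omits three translates of the lattice.\<close>
lemma S_iff: "x \<in> S \<longleftrightarrow> x + \<beta> \<notin> L \<and> x + \<beta> - \<alpha> \<notin> L \<and> x + \<beta> + \<alpha> \<notin> L"
  using wp_eq_N_cases[of "x + \<beta>"] wp_eq_N_of_shift[of "x + \<beta>"] by (auto simp: S_def Lambda_tilde_def)

lemma S_D: "x \<in> S \<Longrightarrow> x + \<beta> \<notin> L" "x \<in> S \<Longrightarrow> \<wp> (x + \<beta>) \<noteq> N"
  by (auto simp: S_def Lambda_tilde_def)

lemma zero_in_S: "0 \<in> S"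
  using beta beta_shift by (simp add: S_iff)

lemma compl_S_sparse: "- S sparse_in UNIV"
proof -
  have "- S = {x. x + \<beta> \<in> L} \<union> {x. x + (\<beta> - \<alpha>) \<in> L} \<union> {x. x + (\<beta> + \<alpha>) \<in> L}"
    by (auto simp: S_iff add_diff_eq add.assoc)
  then show ?thesis by (auto intro!: sparse_in_union' lattice_translate_sparse)
qed

lemma open_S: "open S"
  using sparse_in_UNIV_imp_closed[OF compl_S_sparse] by (simp add: closed_def)

lemma connected_S: "connected S"
  using sparse_imp_connected[OF _ connected_UNIV open_UNIV compl_S_sparse] by (simp add: Diff_eq)

text \<open>The larger domain on which \<open>e_minus\<close> and \<open>e_plus\<close> are holomorphic; only the zeros of \<open>\<sigma>(x + \<beta>)\<close>
  are omitted.\<close>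
definition W :: "complex set" where "W = {x. x + \<beta> \<notin> L}"

lemma open_W: "open W"
proof -
  have "W = - {x. x + \<beta> \<in> L}" by (auto simp: W_def)
  then show ?thesis using sparse_in_UNIV_imp_closed[OF lattice_translate_sparse] by auto
qed

lemma S_subset_W: "S \<subseteq> W" by (auto simp: W_def S_iff)

text \<open>The Baker--Akhiezer function of the one-gap Lame operator with spectral point \<open>v\<close>, normalised to \<open>1\<close> at \<open>0\<close>.\<close>
definition baker :: "complex \<Rightarrow> complex \<Rightarrow> complex" where
  "baker v x = \<sigma> \<beta> * \<sigma> (x + \<beta> - v) / (\<sigma> (x + \<beta>) * \<sigma> (\<beta> - v)) * exp (\<zeta> v * x)"

lemma e_minus_baker: "e_minus \<omega>1 \<omega>2 \<alpha> \<beta> = baker \<alpha>"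
  by (simp add: fun_eq_iff e_minus_def baker_def)

lemma e_plus_baker: "e_plus \<omega>1 \<omega>2 \<alpha> \<beta> = baker (- (2 * \<alpha>))"
  by (simp add: fun_eq_iff e_plus_def baker_def zeta_odd zeta_two_alpha)

lemma baker_zero: "\<beta> - v \<notin> L \<Longrightarrow> baker v 0 = 1"
  using sigma_nonzero beta by (simp add: baker_def)

lemma baker_holomorphic: "baker v holomorphic_on W"
proof -
  have shift: "(\<lambda>x. \<sigma> (x + c)) holomorphic_on W" for c
  proof -
    have "(\<lambda>x. x + c) holomorphic_on W" by (intro holomorphic_intros)
    from holomorphic_on_compose[OF this sigma_holomorphic] show ?thesis by (simp add: o_def)
  qed
  have "(\<lambda>x. \<sigma> \<beta> / \<sigma> (\<beta> - v) * (\<sigma> (x + (\<beta> - v)) / \<sigma> (x + \<beta>)) * exp (\<zeta> v * x)) holomorphic_on W"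
    using sigma_nonzero by (intro holomorphic_intros shift) (auto simp: W_def divide_inverse)
  then show ?thesis by (simp add: baker_def[abs_def] add_diff_eq mult_ac)
qed

lemma baker_deriv: "x \<in> W \<Longrightarrow> (baker v has_field_derivative deriv (baker v) x) (at x)"
  using holomorphic_derivI[OF baker_holomorphic open_W] .

lemma baker_log_deriv:
  assumes "x \<in> W" "x + \<beta> - v \<notin> L"
  shows "deriv (baker v) x = zsum (x + \<beta>) v * baker v x"
proof -
  have x: "x + \<beta> \<notin> L" using assms by (simp add: W_def)
  have 1: "((\<lambda>x. \<sigma> (x + \<beta>)) has_field_derivative \<zeta> (x + \<beta>) * \<sigma> (x + \<beta>)) (at x)"
    by (rule has_field_derivative_shift[OF sigma_deriv[OF x]])
  have 2: "((\<lambda>x. \<sigma> (x + \<beta> - v)) has_field_derivative \<zeta> (x + \<beta> - v) * \<sigma> (x + \<beta> - v)) (at x)"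
    using has_field_derivative_shift[of \<sigma> _ x "\<beta> - v"] sigma_deriv[OF assms(2)] by (simp add: add_diff_eq)
  show ?thesis unfolding baker_def[abs_def] zsum_def
    by (rule DERIV_imp_deriv, rule quotient_log_deriv[OF 2 1 sigma_nonzero[OF x]])
qed

lemma baker_eventually:
  assumes "x \<in> W"
  shows "\<forall>\<^sub>F y in at x. y \<in> W \<and> y + \<beta> - v \<notin> L"
proof -
  have "\<forall>\<^sub>F y in at x. y \<in> W" using assms open_W by (rule eventually_at_in_open'[rotated])
  moreover have "\<forall>\<^sub>F y in at x. y \<notin> {x. x + (\<beta> - v) \<in> L}"
    using lattice_translate_sparse[of "\<beta> - v"] by (simp add: sparse_in_eventually_iff)
  ultimately show ?thesis by eventually_elim (simp add: add_diff_eq)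
qed

lemma wp_shift_cont: "x \<in> W \<Longrightarrow> isCont (\<lambda>x. \<wp> (x + \<beta>)) x" "x \<in> W \<Longrightarrow> isCont (\<lambda>x. deriv \<wp> (x + \<beta>)) x"
  using has_field_derivative_shift[OF wp_has_deriv] has_field_derivative_shift[OF wp_second_deriv] DERIV_isCont
  by (fastforce simp: W_def)+

lemma baker_cont: "x \<in> W \<Longrightarrow> isCont (baker v) x" "x \<in> W \<Longrightarrow> isCont (deriv (baker v)) x"
  "x \<in> W \<Longrightarrow> isCont (deriv (deriv (baker v))) x"
  using holomorphic_on_imp_continuous_on[OF baker_holomorphic[of v]]
    holomorphic_on_imp_continuous_on[OF holomorphic_deriv[OF baker_holomorphic[of v] open_W]]
    holomorphic_on_imp_continuous_on[OF holomorphic_deriv[OF holomorphic_deriv[OF baker_holomorphic[of v] open_W] open_W]]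
  by (auto simp: continuous_on_eq_continuous_at[OF open_W])

text \<open>Where \<open>\<sigma>(x + \<beta> - v)\<close> does not vanish this is \<open>zsum_mult_wp_diff\<close> for the logarithmic derivative. For
  \<open>e_plus\<close> the excluded points may lie in the domain of the matrix solution, so they are recovered by continuity.\<close>
lemma baker_mult:
  assumes v: "v \<notin> L" and x: "x \<in> W"
  shows "2 * (\<wp> (x + \<beta>) - \<wp> v) * deriv (baker v) x = (deriv \<wp> (x + \<beta>) + deriv \<wp> v) * baker v x"
proof (rule isCont_eq_of_eventually_eq[where x = x])
  show "\<forall>\<^sub>F x in at x. 2 * (\<wp> (x + \<beta>) - \<wp> v) * deriv (baker v) x = (deriv \<wp> (x + \<beta>) + deriv \<wp> v) * baker v x"
    using baker_eventually[OF x, of v]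
  proof eventually_elim
    case (elim y)
    then have "2 * zsum (y + \<beta>) v * (\<wp> (y + \<beta>) - \<wp> v) = deriv \<wp> (y + \<beta>) + deriv \<wp> v"
      using v by (intro zsum_mult_wp_diff) (auto simp: W_def)
    moreover have log: "deriv (baker v) y = zsum (y + \<beta>) v * baker v y"
      using elim by (intro baker_log_deriv) auto
    have "2 * (\<wp> (y + \<beta>) - \<wp> v) * deriv (baker v) y =
        (2 * zsum (y + \<beta>) v * (\<wp> (y + \<beta>) - \<wp> v)) * baker v y"
      unfolding log by (simp only: mult_ac)
    ultimately show ?case by (simp only:)
  qed
qed (intro continuous_intros wp_shift_cont baker_cont x)+

text \<open>The logarithmic derivative satisfies the Riccati equation of \<open>zsum_riccati\<close>, whose linearisation is the
  Lame equation.\<close>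
lemma baker_lame:
  assumes v: "v \<notin> L" and x: "x \<in> W"
  shows "(deriv (baker v) has_field_derivative (2 * \<wp> (x + \<beta>) + \<wp> v) * baker v x) (at x)"
proof -
  have d: "(deriv (baker v) has_field_derivative deriv (deriv (baker v)) y) (at y)" if "y \<in> W" for y
    using holomorphic_derivI[OF holomorphic_deriv[OF baker_holomorphic open_W] open_W that] .
  have "deriv (deriv (baker v)) x = (2 * \<wp> (x + \<beta>) + \<wp> v) * baker v x"
  proof (rule isCont_eq_of_eventually_eq[where x = x])
    show "\<forall>\<^sub>F x in at x. deriv (deriv (baker v)) x = (2 * \<wp> (x + \<beta>) + \<wp> v) * baker v x"
      using baker_eventually[OF x, of v]
    proof eventually_elim
      case (elim y)
      then have yW: "y \<in> W" and y: "y + \<beta> \<notin> L" "y + \<beta> - v \<notin> L" by (auto simp: W_def)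
      have "((\<lambda>x. zsum (x + \<beta>) v) has_field_derivative 2 * \<wp> (y + \<beta>) + \<wp> v - (zsum (y + \<beta>) v)^2) (at y)"
        using has_field_derivative_shift[OF zsum_riccati[OF y(1) v y(2)]] .
      from DERIV_mult[OF this baker_deriv[OF yW, of v]] baker_log_deriv[OF yW y(2)]
      have 1: "((\<lambda>x. zsum (x + \<beta>) v * baker v x) has_field_derivative
          (2 * \<wp> (y + \<beta>) + \<wp> v) * baker v y) (at y)"
        by (simp add: algebra_simps power2_eq_square)
      have "W \<inter> - {x. x + (\<beta> - v) \<in> L} = {x. x \<in> W \<and> x + \<beta> - v \<notin> L}"
        by (auto simp: add_diff_eq)
      moreover have "open (W \<inter> - {x. x + (\<beta> - v) \<in> L})"
        using open_W sparse_in_UNIV_imp_closed[OF lattice_translate_sparse] by auto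
      ultimately have "open {x. x \<in> W \<and> x + \<beta> - v \<notin> L}" by simp
      then have "(deriv (baker v) has_field_derivative (2 * \<wp> (y + \<beta>) + \<wp> v) * baker v y) (at y)"
        by (rule has_field_derivative_transform_within_open[OF 1]) (use elim baker_log_deriv in auto)
      then show ?case by (rule DERIV_imp_deriv)
    qed
  qed (intro continuous_intros wp_shift_cont baker_cont x)+
  with d[OF x] show ?thesis by simp
qed

text \<open>The initial slope comes from the first-order relation at \<open>0\<close>, where \<open>\<wp>(\<beta>) - M = 2 / a\<^sup>2\<close>.\<close>
lemma e_minus_facts:
  defines "e \<equiv> e_minus \<omega>1 \<omega>2 \<alpha> \<beta>"
  shows "x \<in> W \<Longrightarrow> (e has_field_derivative deriv e x) (at x)"
    and "x \<in> W \<Longrightarrow> (deriv e has_field_derivative (2 * \<wp> (x + \<beta>) + N) * e x) (at x)"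
    and "x \<in> W \<Longrightarrow> 2 * (\<wp> (x + \<beta>) - N) * deriv e x = (deriv \<wp> (x + \<beta>) + 4) * e x"
    and "e 0 = 1" and "deriv e 0 = \<mu> + A^2"
    and "x \<in> S \<Longrightarrow> e x \<noteq> 0"
proof -
  have 0: "0 \<in> W" using zero_in_S S_subset_W by blast
  show "x \<in> W \<Longrightarrow> (e has_field_derivative deriv e x) (at x)"
    "x \<in> W \<Longrightarrow> (deriv e has_field_derivative (2 * \<wp> (x + \<beta>) + N) * e x) (at x)"
    and *: "x \<in> W \<Longrightarrow> 2 * (\<wp> (x + \<beta>) - N) * deriv e x = (deriv \<wp> (x + \<beta>) + 4) * e x" for x
    using baker_deriv baker_lame baker_mult alpha unfolding e_def e_minus_baker by metis+
  show e0: "e 0 = 1" using beta_shift by (simp add: e_def e_minus_baker baker_zero)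
  have "4 / A^2 * deriv e 0 = 4 * \<mu> / A^2 + 4"
    using *[OF 0] by (simp add: e0 beta)
  then have "4 * deriv e 0 = 4 * (\<mu> + A^2)" by (simp add: field_simps)
  then show "deriv e 0 = \<mu> + A^2" by (simp only: mult_cancel_left) simp
  show "x \<in> S \<Longrightarrow> e x \<noteq> 0"
    using sigma_nonzero beta beta_shift by (simp add: e_def e_minus_def S_iff)
qed

lemma e_plus_facts:
  assumes m: "m \<noteq> a^2"
  defines "e \<equiv> e_plus \<omega>1 \<omega>2 \<alpha> \<beta>"
  shows "x \<in> W \<Longrightarrow> (e has_field_derivative deriv e x) (at x)"
    and "x \<in> W \<Longrightarrow> (deriv e has_field_derivative (2 * \<wp> (x + \<beta>) - 2 * N) * e x) (at x)"
    and "x \<in> W \<Longrightarrow> 2 * (\<wp> (x + \<beta>) + 2 * N) * deriv e x = (deriv \<wp> (x + \<beta>) + 4) * e x"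
    and "e 0 = 1" and "deriv e 0 = 2 / (A^2 * (\<mu> - A^2))"
proof -
  have v: "- (2 * \<alpha>) \<notin> L" "\<wp> (- (2 * \<alpha>)) = - 2 * N" "deriv \<wp> (- (2 * \<alpha>)) = 4"
    using two_alpha wp_two_alpha deriv_wp_odd[OF two_alpha] by (simp_all add: wp_even)
  have 0: "0 \<in> W" using zero_in_S S_subset_W by blast
  show d: "x \<in> W \<Longrightarrow> (e has_field_derivative deriv e x) (at x)" for x
    using baker_deriv unfolding e_def e_plus_baker .
  show d2: "x \<in> W \<Longrightarrow> (deriv e has_field_derivative (2 * \<wp> (x + \<beta>) - 2 * N) * e x) (at x)" for x
    using baker_lame[OF v(1)] unfolding e_def e_plus_baker v by simp
  show *: "x \<in> W \<Longrightarrow> 2 * (\<wp> (x + \<beta>) + 2 * N) * deriv e x = (deriv \<wp> (x + \<beta>) + 4) * e x" for x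
    using baker_mult[OF v(1)] unfolding e_def e_plus_baker v by simp
  show e0: "e 0 = 1" using beta_plus_two_alpha[OF m] by (simp add: e_def e_plus_baker baker_zero)
  have muA: "\<mu> - A^2 \<noteq> 0" using m by (simp flip: of_real_power of_real_diff)
  have p: "((\<lambda>x. \<wp> (x + \<beta>)) has_field_derivative deriv \<wp> \<beta>) (at 0)"
    "((\<lambda>x. deriv \<wp> (x + \<beta>)) has_field_derivative 6 * (\<wp> \<beta>)^2 - 6 * N^2) (at 0)"
    using has_field_derivative_shift[of \<wp> _ 0 \<beta>] wp_has_deriv[OF beta(1)]
      has_field_derivative_shift[of "deriv \<wp>" _ 0 \<beta>] wp_second_deriv[OF beta(1)] by auto
  (* The relation just proved says nothing about the derivative at 0 when wp(beta) = -2 M, which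
     happens for m = - a^2. Differentiating it once more and inserting the Lame equation does. *)
  have "((\<lambda>x. 2 * (\<wp> (x + \<beta>) + 2 * N) * deriv e x) has_field_derivative
      2 * deriv \<wp> \<beta> * deriv e 0 + (2 * \<wp> \<beta> - 2 * N) * (2 * (\<wp> \<beta> + 2 * N))) (at 0)"
    using DERIV_mult[OF DERIV_cmult[OF DERIV_add[OF p(1) DERIV_const[of "2 * N"]], of 2] d2[OF 0]] by (simp add: e0)
  moreover have "((\<lambda>x. 2 * (\<wp> (x + \<beta>) + 2 * N) * deriv e x) has_field_derivative
      (6 * (\<wp> \<beta>)^2 - 6 * N^2) + deriv e 0 * (deriv \<wp> \<beta> + 4)) (at 0)"
  proof (rule has_field_derivative_transform_within_open[OF _ open_W 0])
    show "((\<lambda>x. (deriv \<wp> (x + \<beta>) + 4) * e x) has_field_derivative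
      (6 * (\<wp> \<beta>)^2 - 6 * N^2) + deriv e 0 * (deriv \<wp> \<beta> + 4)) (at 0)"
      using DERIV_mult[OF DERIV_add[OF p(2) DERIV_const[of 4]] d[OF 0]] by (simp add: e0)
  qed (rule *[symmetric])
  ultimately have "2 * deriv \<wp> \<beta> * deriv e 0 + (2 * \<wp> \<beta> - 2 * N) * (2 * (\<wp> \<beta> + 2 * N)) =
      (6 * (\<wp> \<beta>)^2 - 6 * N^2) + deriv e 0 * (deriv \<wp> \<beta> + 4)"
    by (rule DERIV_unique)
  then have "deriv e 0 * (deriv \<wp> \<beta> - 4) = 2 * (\<wp> \<beta> - N)^2"
    by (simp add: power2_eq_square algebra_simps)
  then have eq0: "deriv e 0 * (4 * \<mu> / A^2 - 4) = 2 * (2 / A^2)^2" by (simp add: beta)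
  have cancel: "4 * (d * (B * (\<mu> - B))) = 4 * 2"
    if "B \<noteq> 0" and eq: "d * (4 * \<mu> / B - 4) = 2 * (2 / B)^2" for d B
  proof -
    have "4 * (d * (B * (\<mu> - B))) = d * (4 * \<mu> / B - 4) * (B * B)"
      using that(1) by (simp add: field_simps)
    also have "\<dots> = 4 * 2" using that(1) by (simp add: eq power2_eq_square)
    finally show ?thesis .
  qed
  have "4 * (deriv e 0 * (A^2 * (\<mu> - A^2))) = 4 * 2"
    by (rule cancel[OF _ eq0]) simp
  then have "deriv e 0 * (A^2 * (\<mu> - A^2)) = 2"
    by (simp only: mult_cancel_left) simp
  then show "deriv e 0 = 2 / (A^2 * (\<mu> - A^2))"
    using muA by (subst nonzero_eq_divide_eq) simp_all
qed

end

section \<open>Linear systems and matrix exponentials\<close>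

text \<open>The combinations of the \<open>G j\<close> with holomorphic coefficients form a class of functions that is closed under
  differentiation and whose members vanish at \<open>z0\<close>. Hence all derivatives of each \<open>G i\<close> vanish at \<open>z0\<close>,
  and \<open>G i\<close> vanishes on the connected set \<open>S\<close>.\<close>
lemma linear_system_zero:
  fixes G :: "'i::finite \<Rightarrow> complex \<Rightarrow> complex" and c :: "'i \<Rightarrow> 'i \<Rightarrow> complex \<Rightarrow> complex"
  assumes S: "open S" "connected S" "z0 \<in> S"
    and c: "\<And>i j. c i j holomorphic_on S"
    and G: "\<And>i x. x \<in> S \<Longrightarrow> (G i has_field_derivative (\<Sum>j\<in>UNIV. c i j x * G j x)) (at x)"
    and init: "\<And>i. G i z0 = 0"
    and x: "x \<in> S"
  shows "G i x = 0"
proof -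
  define comb where "comb = (\<lambda>f. \<exists>b :: 'i \<Rightarrow> complex \<Rightarrow> complex. (\<forall>j. b j holomorphic_on S) \<and>
      (\<forall>x\<in>S. f x = (\<Sum>j\<in>UNIV. b j x * G j x)))"
  have step: "comb (deriv f)" if "comb f" for f
  proof -
    from that obtain b :: "'i \<Rightarrow> complex \<Rightarrow> complex" where b: "\<And>j. b j holomorphic_on S"
      "\<And>x. x \<in> S \<Longrightarrow> f x = (\<Sum>j\<in>UNIV. b j x * G j x)"
      unfolding comb_def by blast
    define b' where "b' = (\<lambda>k x. deriv (b k) x + (\<Sum>j\<in>UNIV. b j x * c j k x))"
    have "deriv f x = (\<Sum>k\<in>UNIV. b' k x * G k x)" if x: "x \<in> S" for x
    proof -
      have "((\<lambda>x. \<Sum>j\<in>UNIV. b j x * G j x) has_field_derivative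
          (\<Sum>j\<in>UNIV. deriv (b j) x * G j x + (\<Sum>k\<in>UNIV. c j k x * G k x) * b j x)) (at x)"
        by (intro DERIV_sum DERIV_mult G x holomorphic_derivI[OF b(1) S(1) x])
      then have "(f has_field_derivative
          (\<Sum>j\<in>UNIV. deriv (b j) x * G j x + (\<Sum>k\<in>UNIV. c j k x * G k x) * b j x)) (at x)"
        by (rule has_field_derivative_transform_within_open[OF _ S(1) x]) (simp add: b(2))
      then have "deriv f x = (\<Sum>j\<in>UNIV. deriv (b j) x * G j x) +
          (\<Sum>j\<in>UNIV. \<Sum>k\<in>UNIV. b j x * c j k x * G k x)"
        by (subst DERIV_imp_deriv) (auto simp: sum.distrib sum_distrib_left sum_distrib_right mult_ac)
      also have "(\<Sum>j\<in>UNIV. \<Sum>k\<in>UNIV. b j x * c j k x * G k x) =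
          (\<Sum>k\<in>UNIV. \<Sum>j\<in>UNIV. b j x * c j k x * G k x)" by (rule sum.swap)
      finally show ?thesis
        by (simp add: b'_def distrib_right sum.distrib sum_distrib_right)
    qed
    moreover have "b' k holomorphic_on S" for k
      unfolding b'_def by (intro holomorphic_intros b c S)
    ultimately show ?thesis unfolding comb_def by blast
  qed
  have "comb (G i)"
    unfolding comb_def
  proof (rule exI[of _ "\<lambda>j x. if j = i then 1 else 0"], intro conjI allI ballI)
    show "(\<lambda>x. if j = i then 1 else 0) holomorphic_on S" for j by simp
    have "(\<Sum>j\<in>UNIV. (if j = i then 1 else 0) * G j x) = (\<Sum>j\<in>UNIV. if j = i then G j x else 0)" for x
      by (rule sum.cong) auto
    then show "G i x = (\<Sum>j\<in>UNIV. (if j = i then 1 else 0) * G j x)" for x by simp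
  qed
  then have "comb ((deriv ^^ n) (G i))" for n
    by (induction n) (auto simp: step)
  then have "(deriv ^^ n) (G i) z0 = 0" for n
    using S(3) unfolding comb_def by (metis (no_types, lifting) init mult_zero_right sum.neutral)
  moreover have "G i holomorphic_on S"
    using G by (simp only: holomorphic_on_open[OF S(1)]) blast
  ultimately show ?thesis
    using holomorphic_fun_eq_0_on_connected[of "G i" S z0 x] S x by blast
qed

text \<open>The bilinear pairing, without complex conjugation.\<close>
definition rdot :: "complex^3 \<Rightarrow> complex^3 \<Rightarrow> complex" where
  "rdot v w = (\<Sum>i\<in>UNIV. v $ i * w $ i)"

lemma rdot_vector_matrix: "rdot (v v* A) w = rdot v (A *v w)"
  by (simp add: rdot_def vector_matrix_mult_def matrix_vector_mult_def sum_3 algebra_simps)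

lemma matrix_vector_rdot: "(A *v w) $ i = rdot (A $ i) w"
  by (simp add: matrix_vector_mult_def rdot_def)

lemma matrix_power_entry_bound:
  fixes A :: "complex^3^3"
  assumes "\<And>i j. norm (A $ i $ j) \<le> c"
  shows "norm (((**) A ^^ n) (mat 1) $ i $ j) \<le> (3 * c) ^ n"
proof (induction n arbitrary: i)
  case 0
  then show ?case by (simp add: mat_def)
next
  case (Suc n)
  have c: "c \<ge> 0" using assms[of 1 1] norm_ge_zero order_trans by blast
  have "norm (((**) A ^^ Suc n) (mat 1) $ i $ j) =
      norm (\<Sum>k\<in>UNIV. A $ i $ k * ((**) A ^^ n) (mat 1) $ k $ j)"
    by (simp add: matrix_matrix_mult_def)
  also have "\<dots> \<le> (\<Sum>k\<in>(UNIV::3 set). c * (3 * c) ^ n)"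
    using assms Suc c by (intro sum_norm_le) (simp add: norm_mult mult_mono)
  also have "\<dots> = (3 * c) ^ Suc n" by simp
  finally show ?case .
qed

lemma norm_vec_le_sum: "norm x \<le> (\<Sum>i\<in>UNIV. norm (x $ i))" for x :: "'a::real_normed_vector ^ 'n"
  by (simp add: norm_vec_def L2_set_le_sum)

lemma mat_exp_summable:
  fixes A :: "complex^3^3"
  shows "summable (\<lambda>n. (1 / fact n) *\<^sub>R (((**) A ^^ n) (mat 1)))"
proof -
  define c where "c = (\<Sum>i\<in>UNIV. \<Sum>j\<in>UNIV. norm (A $ i $ j))"
  have c: "norm (A $ i $ j) \<le> c" for i j
  proof -
    have "norm (A $ i $ j) \<le> (\<Sum>j\<in>UNIV. norm (A $ i $ j))" by (rule member_le_sum) auto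
    also have "\<dots> \<le> c" unfolding c_def by (rule member_le_sum) (auto intro: sum_nonneg)
    finally show ?thesis .
  qed
  show ?thesis
  proof (rule summable_comparison_test')
    show "summable (\<lambda>n. 9 * ((3 * c) ^ n / fact n))"
      using summable_exp[of "3 * c"] by (intro summable_mult) (simp add: field_simps)
    fix n :: nat
    let ?B = "((**) A ^^ n) (mat 1) :: complex^3^3"
    have "norm ?B \<le> (\<Sum>i\<in>UNIV. norm (?B $ i))" by (rule norm_vec_le_sum)
    also have "\<dots> \<le> (\<Sum>i\<in>UNIV. \<Sum>j\<in>UNIV. norm (?B $ i $ j))"
      by (intro sum_mono norm_vec_le_sum)
    also have "\<dots> \<le> (\<Sum>i\<in>(UNIV::3 set). \<Sum>j\<in>(UNIV::3 set). (3 * c) ^ n)"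
      by (intro sum_mono matrix_power_entry_bound c)
    also have "\<dots> = 9 * (3 * c) ^ n" by simp
    finally show "norm ((1 / fact n) *\<^sub>R ?B) \<le> 9 * ((3 * c) ^ n / fact n)"
      by (simp add: divide_right_mono)
  qed
qed

text \<open>Multiplication by a fixed row vector is a bounded linear map, so it may be exchanged with the exponential series.\<close>
lemma vector_mat_exp:
  fixes A :: "complex^3^3"
  shows "(\<lambda>n. (1 / fact n) *\<^sub>R (((\<lambda>v. v v* A) ^^ n) v)) sums (v v* mat_exp A)"
proof -
  have "bounded_linear (\<lambda>B :: complex^3^3. v v* B)"
    by (rule linear_conv_bounded_linear[THEN iffD1], rule linearI)
       (simp_all add: vector_matrix_mult_def vec_eq_iff sum_3 algebra_simps)
  from bounded_linear.sums[OF this summable_sums[OF mat_exp_summable[of A]]]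
  have "(\<lambda>n. v v* ((1 / fact n) *\<^sub>R (((**) A ^^ n) (mat 1)))) sums (v v* mat_exp A)"
    by (simp add: mat_exp_def)
  moreover have "v v* (((**) A ^^ n) (mat 1)) = ((\<lambda>v. v v* A) ^^ n) v" for n
  proof (induction n arbitrary: v)
    case (Suc n)
    have "v v* (((**) A ^^ Suc n) (mat 1)) = (v v* A) v* (((**) A ^^ n) (mat 1))"
      by (simp add: vector_matrix_mul_assoc[symmetric])
    then show ?case by (simp only: Suc.IH funpow_Suc_right o_apply)
  qed simp
  moreover have "v v* (r *\<^sub>R B) = r *\<^sub>R (v v* B)" for r and B :: "complex^3^3"
    by (simp add: vector_matrix_mult_def vec_eq_iff sum_3 algebra_simps)
  ultimately show ?thesis by simp
qed

lemma eigen_mat_exp: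
  fixes A :: "complex^3^3"
  assumes "v v* A = s *s v"
  shows "v v* mat_exp A = exp s *s v"
proof -
  have "((\<lambda>v. v v* A) ^^ n) v = s ^ n *s v" for n
  proof (induction n)
    case (Suc n)
    have "(s ^ n *s v) v* A = s ^ n *s (v v* A)"
      by (simp add: vector_matrix_mult_def vec_eq_iff sum_3 algebra_simps)
    also have "\<dots> = s ^ Suc n *s v" by (simp add: assms)
    finally show ?case by (simp only: funpow.simps o_apply Suc.IH)
  qed simp
  then have 1: "(\<lambda>n. (1 / fact n) *\<^sub>R (s ^ n *s v)) sums (v v* mat_exp A)"
    using vector_mat_exp[of A v] by simp
  have "(\<lambda>n. (1 / fact n) *\<^sub>R (s ^ n *s v)) sums (exp s *s v)"
  proof -
    have "bounded_linear (\<lambda>c. c *s v)"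
      by (rule linear_conv_bounded_linear[THEN iffD1], rule linearI)
         (simp_all add: vec_eq_iff algebra_simps)
    from bounded_linear.sums[OF this exp_converges[of s]]
    have "(\<lambda>n. (s ^ n /\<^sub>R fact n) *s v) sums (exp s *s v)" .
    moreover have "(s ^ n /\<^sub>R fact n) *s v = (1 / fact n) *\<^sub>R (s ^ n *s v)" for n
      by (simp add: vec_eq_iff divide_inverse)
    ultimately show ?thesis by simp
  qed
  with 1 show ?thesis by (rule sums_unique2)
qed

lemma nilpotent_mat_exp:
  fixes A :: "complex^3^3"
  assumes "((v v* A) v* A) v* A = 0"
  shows "v v* mat_exp A = v + v v* A + (1/2) *\<^sub>R ((v v* A) v* A)"
proof -
  have z: "((\<lambda>v. v v* A) ^^ (n + 3)) v = 0" for n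
  proof (induction n)
    case 0
    show ?case using assms by (simp add: numeral_3_eq_3)
  next
    case (Suc n)
    have "((\<lambda>v. v v* A) ^^ (Suc n + 3)) v = ((\<lambda>v. v v* A) ^^ (n + 3)) v v* A"
      by (simp only: add_Suc funpow.simps o_apply)
    also have "\<dots> = 0" by (simp only: Suc.IH) (simp add: vector_matrix_mult_def vec_eq_iff)
    finally show ?case .
  qed
  have "(\<lambda>n. (1 / fact n) *\<^sub>R (((\<lambda>v. v v* A) ^^ n) v)) sums
      (\<Sum>n<3. (1 / fact n) *\<^sub>R (((\<lambda>v. v v* A) ^^ n) v))"
  proof (rule sums_finite)
    fix n :: nat assume "n \<notin> {..<3}"
    then have "n = (n - 3) + 3" by simp
    with z[of "n - 3"] show "(1 / fact n) *\<^sub>R (((\<lambda>v. v v* A) ^^ n) v) = 0" by simp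
  qed simp
  with vector_mat_exp[of A v] have "v v* mat_exp A = (\<Sum>n<3. (1 / fact n) *\<^sub>R (((\<lambda>v. v v* A) ^^ n) v))"
    by (rule sums_unique2)
  also have "\<dots> = v + v v* A + (1/2) *\<^sub>R ((v v* A) v* A)"
    by (simp add: numeral_3_eq_3)
  finally show ?thesis .
qed

section \<open>Rows of the matrix solution\<close>

context delaunay_data
begin

text \<open>The logarithmic derivative of \<open>\<wp>(x + \<beta>) - M\<close>, the nonconstant entry of the system.\<close>
definition h :: "complex \<Rightarrow> complex" where
  "h x = deriv \<wp> (x + \<beta>) / (\<wp> (x + \<beta>) - N)"

lemma h_deriv:
  assumes x: "x \<in> S"
  shows "(h has_field_derivative 6 * (\<wp> (x + \<beta>) + N) - (h x)^2) (at x)"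
proof -
  note x' = S_D[OF x]
  have "(h has_field_derivative
      ((6 * (\<wp> (x + \<beta>))^2 - 6 * N^2) * (\<wp> (x + \<beta>) - N) - deriv \<wp> (x + \<beta>) * deriv \<wp> (x + \<beta>)) /
      ((\<wp> (x + \<beta>) - N) * (\<wp> (x + \<beta>) - N))) (at x)"
    unfolding h_def[abs_def]
    by (rule DERIV_divide)
       (use x' has_field_derivative_shift[OF wp_second_deriv[OF x'(1)]]
          DERIV_diff[OF has_field_derivative_shift[OF wp_has_deriv[OF x'(1)]] DERIV_const[of N]] in auto)
  moreover have "((6 * p^2 - 6 * N^2) * (p - N) - d * d) / ((p - N) * (p - N)) = 6 * (p + N) - (d / (p - N))^2"
    if "p \<noteq> N" for p d
    using that by (simp add: divide_simps power2_eq_square) (simp add: algebra_simps)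
  ultimately show ?thesis using x'(2) by (simp add: h_def)
qed

lemma h_zero: "h 0 = 2 * \<mu>"
  by (simp add: h_def beta field_simps)

lemma row_system:
  fixes v :: "complex^3"
  assumes Psi: "Phi_inv_solution \<omega>1 \<omega>2 A N \<beta> \<Psi>"
  defines "F \<equiv> \<lambda>j x. (v v* \<Psi> x) $ j"
  shows "x \<in> S \<Longrightarrow> (F 1 has_field_derivative - h x * F 1 x - 2 / A * F 2 x) (at x)"
    and "x \<in> S \<Longrightarrow> (F 2 has_field_derivative - 2 / A * F 3 x) (at x)"
    and "x \<in> S \<Longrightarrow> (F 3 has_field_derivative - 2 * A^2 * F 1 x + h x * F 3 x) (at x)"
    and "F j 0 = v $ j"
proof -
  show "F j 0 = v $ j"
    using Psi by (simp add: F_def Phi_inv_solution_def)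
  assume x: "x \<in> S"
  have Psi_deriv: "((\<lambda>s. \<Psi> s $ i $ j) has_field_derivative (\<Psi> x ** ode_matrix \<omega>1 \<omega>2 A N \<beta> x) $ i $ j) (at x)" for i j
    using Psi x unfolding Phi_inv_solution_def S_def by auto
  have F: "(F j has_field_derivative ((v v* \<Psi> x) v* ode_matrix \<omega>1 \<omega>2 A N \<beta> x) $ j) (at x)" for j
  proof -
    have "((\<lambda>x. \<Sum>i\<in>UNIV. v $ i * \<Psi> x $ i $ j) has_field_derivative
        (\<Sum>i\<in>UNIV. v $ i * (\<Psi> x ** ode_matrix \<omega>1 \<omega>2 A N \<beta> x) $ i $ j)) (at x)"
      by (intro DERIV_sum DERIV_cmult Psi_deriv)
    then show ?thesis
      unfolding vector_matrix_mul_assoc by (simp add: F_def vector_matrix_mult_def)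
  qed
  have comps: "(w v* ode_matrix \<omega>1 \<omega>2 A N \<beta> x) $ 1 = - h x * w $ 1 - 2 / A * w $ 2"
    "(w v* ode_matrix \<omega>1 \<omega>2 A N \<beta> x) $ 2 = - 2 / A * w $ 3"
    "(w v* ode_matrix \<omega>1 \<omega>2 A N \<beta> x) $ 3 = - 2 * A^2 * w $ 1 + h x * w $ 3" for w :: "complex^3"
    by (simp_all add: vector_matrix_mult_def sum_3 ode_matrix_def Let_def h_def mult_ac)
  show "(F 1 has_field_derivative - h x * F 1 x - 2 / A * F 2 x) (at x)"
    "(F 2 has_field_derivative - 2 / A * F 3 x) (at x)"
    "(F 3 has_field_derivative - 2 * A^2 * F 1 x + h x * F 3 x) (at x)"
    using F[of 1] F[of 2] F[of 3] unfolding comps by (simp_all only: F_def)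
qed

text \<open>Eliminating the first and third entries of \<open>v \<Psi>\<close> from the system gives an equation with coefficient
  \<open>h' + h\<^sup>2\<close> in front of \<open>u'\<close>; this is \<open>\<wp>'' / (\<wp> - M) = 6 (\<wp> + M)\<close>.\<close>
lemma row_third_order:
  fixes v :: "complex^3"
  assumes Psi: "Phi_inv_solution \<omega>1 \<omega>2 A N \<beta> \<Psi>"
  defines "u \<equiv> \<lambda>x. (v v* \<Psi> x) $ 2"
  obtains u1 u2 where
    "\<And>x. x \<in> S \<Longrightarrow> (u has_field_derivative u1 x) (at x)"
    "\<And>x. x \<in> S \<Longrightarrow> (u1 has_field_derivative u2 x) (at x)"
    "\<And>x. x \<in> S \<Longrightarrow> (u2 has_field_derivative 6 * (\<wp> (x + \<beta>) + N) * u1 x - 8 * u x) (at x)"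
    "u 0 = v $ 2" "u1 0 = - 2 / A * v $ 3" "u2 0 = 4 * A * v $ 1 - 4 * \<mu> / A * v $ 3"
proof -
  note F = row_system[OF Psi, where v = v]
  define u1 where "u1 = (\<lambda>x. - 2 / A * (v v* \<Psi> x) $ 3)"
  define u2 where "u2 = (\<lambda>x. 4 * A * (v v* \<Psi> x) $ 1 + h x * u1 x)"
  have d1: "(u1 has_field_derivative u2 x) (at x)" if "x \<in> S" for x
    unfolding u1_def[abs_def] u2_def
    by (rule DERIV_cong[OF DERIV_cmult[OF F(3)[OF that]]]) (simp add: field_simps power2_eq_square u1_def)
  have "(u2 has_field_derivative 6 * (\<wp> (x + \<beta>) + N) * u1 x - 8 * u x) (at x)" if x: "x \<in> S" for x
  proof -
    have "(u2 has_field_derivative 4 * A * (- h x * (v v* \<Psi> x) $ 1 - 2 / A * (v v* \<Psi> x) $ 2) +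
        ((6 * (\<wp> (x + \<beta>) + N) - (h x)^2) * u1 x + u2 x * h x)) (at x)"
      unfolding u2_def[abs_def]
      using DERIV_add[OF DERIV_cmult[OF F(1)[OF x], of "4 * A"] DERIV_mult[OF h_deriv[OF x] d1[OF x]]]
      by (simp add: u2_def)
    then show ?thesis
      by (rule DERIV_cong) (simp add: u_def u2_def algebra_simps power2_eq_square)
  qed
  moreover have "(u has_field_derivative u1 x) (at x)" if "x \<in> S" for x
    unfolding u_def u1_def using F(2)[OF that] by simp
  moreover have "u2 0 = 4 * A * v $ 1 - 4 * \<mu> / A * v $ 3"
    using F(4) by (simp add: u2_def u1_def h_zero)
  ultimately show thesis
    using F(4) by (intro that[of u1 u2] d1) (simp_all add: u_def u1_def)
qed

text \<open>A solution of the scalar equation with the initial values prescribed by \<open>v\<close> is the second entry of \<open>v \<Psi>\<close>, by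
  uniqueness on the connected domain \<open>S\<close>.\<close>
lemma row_solution:
  fixes v :: "complex^3"
  assumes Psi: "Phi_inv_solution \<omega>1 \<omega>2 A N \<beta> \<Psi>"
    and y: "\<And>x. x \<in> S \<Longrightarrow> (y has_field_derivative y1 x) (at x)"
      "\<And>x. x \<in> S \<Longrightarrow> (y1 has_field_derivative y2 x) (at x)"
      "\<And>x. x \<in> S \<Longrightarrow> (y2 has_field_derivative 6 * (\<wp> (x + \<beta>) + N) * y1 x - 8 * y x) (at x)"
    and init: "v $ 2 = y 0" "- 2 / A * v $ 3 = y1 0" "4 * A * v $ 1 - 4 * \<mu> / A * v $ 3 = y2 0"
    and x: "x \<in> S"
  shows "(v v* \<Psi> x) $ 2 = y x"
proof -
  define u where "u = (\<lambda>x. (v v* \<Psi> x) $ 2)"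
  obtain u1 u2 where u:
    "\<And>x. x \<in> S \<Longrightarrow> (u has_field_derivative u1 x) (at x)"
    "\<And>x. x \<in> S \<Longrightarrow> (u1 has_field_derivative u2 x) (at x)"
    "\<And>x. x \<in> S \<Longrightarrow> (u2 has_field_derivative 6 * (\<wp> (x + \<beta>) + N) * u1 x - 8 * u x) (at x)"
    "u 0 = v $ 2" "u1 0 = - 2 / A * v $ 3" "u2 0 = 4 * A * v $ 1 - 4 * \<mu> / A * v $ 3"
    using row_third_order[OF Psi, of v] unfolding u_def by blast
  define G :: "3 \<Rightarrow> complex \<Rightarrow> complex" where
    "G = (\<lambda>j x. if j = 1 then u x - y x else if j = 2 then u1 x - y1 x else u2 x - y2 x)"
  define c :: "3 \<Rightarrow> 3 \<Rightarrow> complex \<Rightarrow> complex" where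
    "c = (\<lambda>i j x. if i = 1 then (if j = 2 then 1 else 0) else if i = 2 then (if j = 3 then 1 else 0)
        else if j = 1 then - 8 else if j = 2 then 6 * (\<wp> (x + \<beta>) + N) else 0)"
  have "(\<lambda>x. \<wp> (x + \<beta>)) holomorphic_on S"
    using has_field_derivative_shift[OF wp_has_deriv[OF S_D(1)]]
    by (simp only: holomorphic_on_open[OF open_S]) blast
  then have c: "c i j holomorphic_on S" for i j
    unfolding c_def
    by (cases "i = 1"; cases "i = 2"; cases "j = 1"; cases "j = 2"; cases "j = 3"; simp;
        intro holomorphic_intros; assumption)
  have G: "(G i has_field_derivative (\<Sum>j\<in>UNIV. c i j x * G j x)) (at x)" if x: "x \<in> S" for i x
  proof -
    have "(G 1 has_field_derivative (\<Sum>j\<in>UNIV. c 1 j x * G j x)) (at x)"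
      using DERIV_diff[OF u(1)[OF x] y(1)[OF x]] by (simp add: G_def c_def sum_3)
    moreover have "(G 2 has_field_derivative (\<Sum>j\<in>UNIV. c 2 j x * G j x)) (at x)"
      using DERIV_diff[OF u(2)[OF x] y(2)[OF x]] by (simp add: G_def c_def sum_3)
    moreover have "(G 3 has_field_derivative (\<Sum>j\<in>UNIV. c 3 j x * G j x)) (at x)"
      using DERIV_diff[OF u(3)[OF x] y(3)[OF x]] by (simp add: G_def c_def sum_3 algebra_simps)
    ultimately show ?thesis using exhaust_3[of i] by auto
  qed
  have G0: "G j 0 = 0" for j
    using u(4-6) init by (simp add: G_def)
  have "G 1 x = 0"
    by (rule linear_system_zero[OF open_S connected_S zero_in_S c G G0 x])
  then show ?thesis by (simp add: G_def u_def)
qed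

end

section \<open>Contour integrals through removable points\<close>

text \<open>The path may run through points of \<open>P\<close>, where nothing is known about \<open>F\<close>. Around such a point
  \<open>f\<close> has a primitive on a disc, and on the punctured disc \<open>F\<close> differs from it by a constant. So \<open>F\<close> extends to
  a primitive of \<open>f\<close> on all of \<open>D\<close>.\<close>
lemma contour_integral_primitive_off_sparse:
  fixes f F :: "complex \<Rightarrow> complex"
  assumes D: "open D" "f holomorphic_on D" and P: "P sparse_in UNIV"
    and F: "\<And>z. z \<in> D - P \<Longrightarrow> (F has_field_derivative f z) (at z)"
    and g: "valid_path g" "path_image g \<subseteq> D"
    and ends: "pathstart g \<in> D - P" "pathfinish g \<in> D - P"
  shows "contour_integral g f = F (pathfinish g) - F (pathstart g)"
proof -
  define F' where "F' = (\<lambda>z. Lim (at z) F)"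
  have F'_eq: "F' z = F z" if "z \<in> D - P" for z
    using DERIV_isCont[OF F[OF that]] unfolding F'_def isCont_def by (intro tendsto_Lim) auto
  have F': "(F' has_field_derivative f p) (at p)" if p: "p \<in> D" for p
  proof -
    obtain B where B: "open B" "p \<in> B" "\<forall>y\<in>B. y \<noteq> p \<longrightarrow> y \<notin> P"
      using sparse_in_not_in[OF P, of p] by auto
    then have "open (B \<inter> D)" "p \<in> B \<inter> D" using D p by auto
    then obtain e where e: "e > 0" "ball p e \<subseteq> B \<inter> D" using open_contains_ball by blast
    have "f holomorphic_on ball p e" using D(2) e(2) by (auto intro: holomorphic_on_subset)
    then obtain G where G: "\<And>z. z \<in> ball p e \<Longrightarrow> (G has_field_derivative f z) (at z within ball p e)"
      using holomorphic_convex_primitive'[OF convex_ball open_ball] by blast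
    have G': "(G has_field_derivative f z) (at z)" if "z \<in> ball p e" for z
      using G[OF that] at_within_open[OF that] by simp
    have "(\<lambda>z. F z - G z) constant_on (ball p e - {p})"
    proof (rule has_field_derivative_0_imp_constant_on)
      fix z assume z: "z \<in> ball p e - {p}"
      then have "z \<in> D - P" using B e by auto
      with DERIV_diff[OF F G', of z] z show "((\<lambda>z. F z - G z) has_field_derivative 0) (at z)" by simp
    qed (auto simp: connected_punctured_ball open_delete)
    then obtain c where c: "\<And>z. z \<in> ball p e - {p} \<Longrightarrow> F z - G z = c"
      unfolding constant_on_def by blast
    have eq: "F' z = G z + c" if z: "z \<in> ball p e" for z
    proof -
      have "((\<lambda>z. G z + c) \<longlongrightarrow> G z + c) (at z)"
        using DERIV_isCont[OF G'[OF z]] unfolding isCont_def by (intro tendsto_intros)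
      moreover have "\<forall>\<^sub>F w in at z. G w + c = F w"
      proof -
        have "\<forall>\<^sub>F w in at z. w \<in> ball p e" using z by (intro eventually_at_in_open') auto
        moreover have "\<forall>\<^sub>F w in at z. w \<noteq> p" by (rule eventually_neq_at_within)
        ultimately show ?thesis by eventually_elim (use c in \<open>force simp: algebra_simps\<close>)
      qed
      ultimately have "(F \<longlongrightarrow> G z + c) (at z)" by (rule Lim_transform_eventually)
      then show ?thesis unfolding F'_def by (intro tendsto_Lim) auto
    qed
    have pb: "p \<in> ball p e" using e by simp
    have "((\<lambda>z. G z + c) has_field_derivative f p) (at p)"
      using DERIV_add[OF G'[OF pb] DERIV_const[of c]] by simp
    then show ?thesis
      by (rule has_field_derivative_transform_within_open[OF _ open_ball pb]) (simp add: eq)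
  qed
  have "(f has_contour_integral (F' (pathfinish g) - F' (pathstart g))) g"
    by (rule contour_integral_primitive[OF _ g]) (use F' in \<open>auto intro: has_field_derivative_at_within\<close>)
  then show ?thesis
    using ends by (simp add: contour_integral_unique F'_eq)
qed

section \<open>The matrix \<open>T\<close> and the shape of the transformed surfaces\<close>

lemma vec3_simps [simp]:
  "(vector [a, b, c] :: 'a::zero ^ 3) $ 1 = a" "(vector [a, b, c] :: 'a::zero ^ 3) $ 2 = b"
  "(vector [a, b, c] :: 'a::zero ^ 3) $ 3 = c"
  by simp_all

text \<open>The conjugate transpose: \<open>T\<close> is unitary.\<close>
definition T_inverse :: "complex^3^3" where
  "T_inverse = (let \<omega> = exp (2 * of_real pi * \<i> / 3) in
     of_real (1 / sqrt 3) *\<^sub>M vector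
       [vector [1, \<omega>^2, \<omega>],
        vector [1, 1, 1],
        vector [1, \<omega>, \<omega>^2]])"

abbreviation omega3 :: complex where "omega3 \<equiv> exp (2 * of_real pi * \<i> / 3)"

lemma cube_root:
  "omega3 = Complex (- 1 / 2) (sqrt 3 / 2)" "omega3 ^ 2 = Complex (- 1 / 2) (- sqrt 3 / 2)"
proof -
  have "omega3 = cis (2 * pi / 3)"
    by (simp add: cis_conv_exp mult_ac)
  then show *: "omega3 = Complex (- 1 / 2) (sqrt 3 / 2)"
    by (simp add: complex_eq_iff cos_120 sin_120)
  show "omega3 ^ 2 = Complex (- 1 / 2) (- sqrt 3 / 2)"
    unfolding * by (simp add: complex_eq_iff power2_eq_square)
qed

lemma T_inverse: "T_mat ** T_inverse = mat 1" "T_inverse ** T_mat = mat 1"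
proof -
  show "T_mat ** T_inverse = mat 1" "T_inverse ** T_mat = mat 1"
    unfolding T_mat_def T_inverse_def Let_def
    unfolding cube_root(2) unfolding cube_root(1)
    by (auto simp: vec_eq_iff forall_3 matrix_matrix_mult_def sum_3 cscale_def mat_def complex_eq_iff
      field_simps)
qed

lemma matrix_inv_unique:
  fixes A B :: "'a::comm_ring_1 ^ 'n ^ 'n"
  assumes "A ** B = mat 1" "B ** A = mat 1"
  shows "matrix_inv A = B"
proof -
  have "A ** matrix_inv A = mat 1 \<and> matrix_inv A ** A = mat 1"
    unfolding matrix_inv_def by (rule someI[of _ B]) (use assms in auto)
  then have "matrix_inv A = (B ** A) ** matrix_inv A" using assms by simp
  also have "\<dots> = B ** (A ** matrix_inv A)" by (simp only: matrix_mul_assoc)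
  finally show ?thesis using \<open>A ** matrix_inv A = mat 1 \<and> _\<close> by simp
qed

lemma T_matrix_inv: "matrix_inv T_mat = T_inverse"
  by (rule matrix_inv_unique) (rule T_inverse)+

lemma det_cscale: "det (c *\<^sub>M Y) = c ^ 3 * det Y"
  by (simp add: det_3 cscale_def power3_eq_cube algebra_simps)

lemma det_T_inverse: "det T_inverse = - \<i>"
proof -
  have "omega3 * omega3 ^ 2 = 1"
    unfolding cube_root(2) unfolding cube_root(1) by (simp add: complex_eq_iff)
  then have cube: "omega3 ^ 3 = 1" by (simp add: power3_eq_cube power2_eq_square mult.assoc)
  have "det (vector [vector [1, w^2, w], vector [1, 1, 1], vector [1, w, w^2]] :: complex^3^3) =
      3 * w^2 - 2 * w - w * w^3" for w
    by (simp add: det_3 algebra_simps power2_eq_square power3_eq_cube)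
  then have "det T_inverse = of_real (1 / sqrt 3) ^ 3 * (3 * (omega3 ^ 2 - omega3))"
    unfolding T_inverse_def Let_def by (simp only: det_cscale cube) simp
  also have "\<dots> = - \<i>"
    unfolding cube_root(2) unfolding cube_root(1)
    by (simp add: complex_eq_iff power3_eq_cube)
  finally show ?thesis .
qed

text \<open>The matrix \<open>T\<close> cancels, and what is left of each coordinate is a row of \<open>K\<close> carried by \<open>exp((x + i y) X)\<close> and then by
  \<open>\<Psi>\<close>, of which the surface takes the second entry.\<close>
lemma gamma_surface:
  fixes D K :: "complex^3^3"
  shows "((c *\<^sub>M (D ** K ** matrix_inv T_mat)) *v surface A \<mu> \<Psi> x y) =
    c *s (D *v (\<chi> j. ((K $ j v* mat_exp (Complex x y *\<^sub>M potential_X A \<mu>)) v* \<Psi> (of_real x)) $ 2))"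
proof -
  let ?E = "mat_exp (Complex x y *\<^sub>M potential_X A \<mu>)"
  define e :: "complex^3" where "e = vector [0, 1, 0]"
  have "(D ** K ** T_inverse) ** (T_mat ** ?E ** \<Psi> (of_real x)) =
      D ** K ** (T_inverse ** T_mat) ** ?E ** \<Psi> (of_real x)"
    by (simp only: matrix_mul_assoc)
  also have "\<dots> = D ** K ** ?E ** \<Psi> (of_real x)" by (simp add: T_inverse)
  finally have "(D ** K ** matrix_inv T_mat) *v surface A \<mu> \<Psi> x y =
      D *v (K *v (?E *v (\<Psi> (of_real x) *v e)))"
    by (simp only: surface_def T_matrix_inv matrix_vector_mul_assoc e_def)
       (simp only: matrix_mul_assoc)
  moreover have "K *v (?E *v (\<Psi> (of_real x) *v e)) = (\<chi> j. ((K $ j v* ?E) v* \<Psi> (of_real x)) $ 2)"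
  proof -
    have "rdot w e = w $ 2" for w by (simp add: rdot_def e_def sum_3)
    then show ?thesis
      by (simp add: vec_eq_iff matrix_vector_rdot rdot_vector_matrix[symmetric])
  qed
  moreover have "(c *\<^sub>M Y) *v w = c *s (Y *v w)" for Y w
    by (simp add: vec_eq_iff cscale_def matrix_vector_mult_def sum_3 algebra_simps)
  ultimately show ?thesis by simp
qed

lemma scaled_row: "((c *s v) v* B) $ j = c * (v v* B) $ j" for B :: "complex^3^3"
  by (simp add: vector_matrix_mult_def sum_3 algebra_simps)

section \<open>Real unimodular transformations\<close>

text \<open>Conjugation exchanges the first and third rows of the inverse of \<open>T\<close> and fixes the second one.\<close>
lemma real_row_T_inverse:
  fixes w :: "complex^3"
  assumes "w $ 2 \<in> \<real>" "w $ 3 = cnj (w $ 1)"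
  shows "(w v* T_inverse) $ j \<in> \<real>"
proof -
  have *: "cnj omega3 = omega3 ^ 2" "cnj (omega3 ^ 2) = omega3"
    unfolding cube_root(2) unfolding cube_root(1) by (simp_all add: complex_eq_iff)
  have c: "cnj (w $ 2) = w $ 2" using assms(1) by (simp add: Reals_cnj_iff)
  have "cnj ((w v* T_inverse) $ j) = (w v* T_inverse) $ j"
    using exhaust_3[of j] assms(2) c *
    by (auto simp: vector_matrix_mult_def sum_3 T_inverse_def Let_def cscale_def
        simp del: complex_cnj_power)
  then show ?thesis by (simp add: Reals_cnj_iff)
qed

lemma SL3R_intro:
  fixes D K :: "complex^3^3"
  assumes "\<And>i. c * (D ** K) $ i $ 2 \<in> \<real>" "\<And>i. c * (D ** K) $ i $ 3 = cnj (c * (D ** K) $ i $ 1)"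
    and "c ^ 3 * (det D * det K) = \<i>"
  shows "c *\<^sub>M (D ** K ** matrix_inv T_mat) \<in> SL3R"
proof -
  have "(c *\<^sub>M (D ** K ** T_inverse)) $ i $ j = ((c *s (D ** K) $ i) v* T_inverse) $ j" for i j
    by (simp add: cscale_def matrix_matrix_mult_def[of "D ** K"] vector_matrix_mult_def sum_3 algebra_simps)
  then have "(c *\<^sub>M (D ** K ** T_inverse)) $ i $ j \<in> \<real>" for i j
    using real_row_T_inverse[of "c *s (D ** K) $ i" j] assms(1,2) by simp
  moreover have "det (c *\<^sub>M (D ** K ** T_inverse)) = 1"
    using assms(3) by (simp add: det_cscale det_mul det_T_inverse mult.assoc[symmetric])
  ultimately show ?thesis by (simp add: SL3R_def T_matrix_inv)
qed

context delaunay_data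
begin

section \<open>Explicit solutions of the third-order equation\<close>

lemma wp_shift_deriv: "x \<in> S \<Longrightarrow> ((\<lambda>x. \<wp> (x + \<beta>)) has_field_derivative deriv \<wp> (x + \<beta>)) (at x)"
  by (intro has_field_derivative_shift wp_has_deriv S_D)

abbreviation e where "e \<equiv> e_minus \<omega>1 \<omega>2 \<alpha> \<beta>"

lemma e_derivs:
  assumes "x \<in> S"
  shows "(e has_field_derivative deriv e x) (at x)"
    and "(deriv e has_field_derivative (2 * \<wp> (x + \<beta>) + N) * e x) (at x)"
    and "((\<lambda>x. (2 * \<wp> (x + \<beta>) + N) * e x) has_field_derivative
           2 * deriv \<wp> (x + \<beta>) * e x + (2 * \<wp> (x + \<beta>) + N) * deriv e x) (at x)"
    and "2 * (\<wp> (x + \<beta>) - N) * deriv e x = (deriv \<wp> (x + \<beta>) + 4) * e x"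
proof -
  have W: "x \<in> W" using assms S_subset_W by blast
  show *: "(e has_field_derivative deriv e x) (at x)"
    "(deriv e has_field_derivative (2 * \<wp> (x + \<beta>) + N) * e x) (at x)"
    "2 * (\<wp> (x + \<beta>) - N) * deriv e x = (deriv \<wp> (x + \<beta>) + 4) * e x"
    using e_minus_facts(1-3)[OF W] by auto
  show "((\<lambda>x. (2 * \<wp> (x + \<beta>) + N) * e x) has_field_derivative
           2 * deriv \<wp> (x + \<beta>) * e x + (2 * \<wp> (x + \<beta>) + N) * deriv e x) (at x)"
    using wp_shift_deriv[OF assms] *(1) by (auto intro!: derivative_eq_intros)
qed

text \<open>Writing a solution as \<open>e g\<close>, the Lame equation and the first-order relation for \<open>e\<close> turn the third-order
  equation into \<open>(g'' - 3 M g)' = -3 (e' / e) (g'' - 3 M g)\<close>, which the exponentials with exponents \<open>\<plusminus>k\<close>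
  satisfy since \<open>k\<^sup>2 = 3 M\<close>. For \<open>M = 0\<close> the choice \<open>\<kappa> = 0\<close> gives the first vector of the Jordan chain.\<close>
lemma row_e_minus:
  assumes Psi: "Phi_inv_solution \<omega>1 \<omega>2 A N \<beta> \<Psi>" and \<kappa>: "\<kappa>^2 = 3 * N" and x: "x \<in> S"
    and v: "v = vector [A * (\<kappa> - \<mu> - A^2) / 2, 1, - (A * (\<kappa> + \<mu> + A^2) / 2)]"
  shows "(v v* \<Psi> x) $ 2 = e x * exp (\<kappa> * x)"
proof -
  define g where "g = (\<lambda>x. exp (\<kappa> * x))"
  have g: "(g has_field_derivative \<kappa> * g x) (at x)" for x
    unfolding g_def by (auto intro!: derivative_eq_intros)
  let ?y1 = "\<lambda>x. (deriv e x + \<kappa> * e x) * g x"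
  let ?y2 = "\<lambda>x. ((2 * \<wp> (x + \<beta>) + N) * e x + 2 * \<kappa> * deriv e x + \<kappa>^2 * e x) * g x"
  have "(v v* \<Psi> x) $ 2 = e x * g x"
  proof (rule row_solution[OF Psi, of "\<lambda>x. e x * g x" ?y1 ?y2, OF _ _ _ _ _ _ x])
    fix x assume "x \<in> S"
    note d = e_derivs[OF this]
    show "((\<lambda>x. e x * g x) has_field_derivative ?y1 x) (at x)"
      by (rule DERIV_cong[OF DERIV_mult[OF d(1) g]]) (simp add: algebra_simps)
    show "(?y1 has_field_derivative ?y2 x) (at x)"
      by (rule DERIV_cong[OF DERIV_mult[OF DERIV_add[OF d(2) DERIV_cmult[OF d(1), of \<kappa>]] g]])
         (simp add: algebra_simps power2_eq_square)
    have "(?y2 has_field_derivative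
        (2 * deriv \<wp> (x + \<beta>) * e x + (2 * \<wp> (x + \<beta>) + N) * deriv e x +
         2 * \<kappa> * ((2 * \<wp> (x + \<beta>) + N) * e x) + \<kappa>^2 * deriv e x) * g x +
        \<kappa> * g x * ((2 * \<wp> (x + \<beta>) + N) * e x + 2 * \<kappa> * deriv e x + \<kappa>^2 * e x)) (at x)"
      by (rule DERIV_mult[OF DERIV_add[OF DERIV_add[OF d(3) DERIV_cmult[OF d(2), of "2 * \<kappa>"]]
            DERIV_cmult[OF d(1), of "\<kappa>^2"]] g])
    moreover have "(2 * dp * y + (2 * p + N) * y1 + 2 * \<kappa> * ((2 * p + N) * y) + \<kappa>^2 * y1) * z +
        \<kappa> * z * ((2 * p + N) * y + 2 * \<kappa> * y1 + \<kappa>^2 * y) =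
        6 * (p + N) * ((y1 + \<kappa> * y) * z) - 8 * (y * z)"
      if "2 * (p - N) * y1 = (dp + 4) * y" for p dp y y1 z
      using that \<kappa> by algebra
    ultimately show "(?y2 has_field_derivative 6 * (\<wp> (x + \<beta>) + N) * ?y1 x - 8 * (e x * g x)) (at x)"
      using d(4) by simp
  next
    note 0 = e_minus_facts(4,5)
    have g0: "g 0 = 1" by (simp add: g_def)
    show "v $ 2 = e 0 * g 0" "- 2 / A * v $ 3 = ?y1 0"
      by (simp_all add: v 0 g0 field_simps)
    have "4 * A * (A * (\<kappa> - \<mu> - A^2) / 2) + 4 * \<mu> / A * (A * (\<kappa> + \<mu> + A^2) / 2) =
        2 * A^2 * (\<kappa> - \<mu> - A^2) + 2 * \<mu> * (\<kappa> + \<mu> + A^2)"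
      by (simp add: power2_eq_square)
    also have "\<dots> = 4 / A^2 + 2 * N + N + 2 * \<kappa> * (\<mu> + A^2) + \<kappa>^2"
    proof -
      have "4 / A^2 = 2 * (2 / A^2)" by simp
      also have "2 / A^2 = \<mu>^2 - A^4 - 3 * N" using N_eq by (simp add: algebra_simps)
      finally show ?thesis
        unfolding \<kappa> by (simp only:) (simp add: algebra_simps power2_eq_square power4_eq_xxxx)
    qed
    finally show "4 * A * v $ 1 - 4 * \<mu> / A * v $ 3 = ?y2 0"
      by (simp add: v 0 g0 beta algebra_simps)
  qed
  then show ?thesis by (simp add: g_def)
qed

lemma row_e_plus:
  assumes Psi: "Phi_inv_solution \<omega>1 \<omega>2 A N \<beta> \<Psi>" and m: "m \<noteq> a^2" and x: "x \<in> S"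
    and v: "v = vector [- (1 / (A * (\<mu> - A^2))), 1, - (1 / (A * (\<mu> - A^2)))]"
  shows "(v v* \<Psi> x) $ 2 = e_plus \<omega>1 \<omega>2 \<alpha> \<beta> x"
proof -
  define y where "y = e_plus \<omega>1 \<omega>2 \<alpha> \<beta>"
  note y = e_plus_facts[OF m, folded y_def]
  have muA: "\<mu> - A^2 \<noteq> 0" using m by (simp flip: of_real_power of_real_diff)
  let ?y2 = "\<lambda>x. (2 * \<wp> (x + \<beta>) - 2 * N) * y x"
  have "(v v* \<Psi> x) $ 2 = y x"
  proof (rule row_solution[OF Psi, of y "deriv y" ?y2, OF _ _ _ _ _ _ x])
    fix x assume x: "x \<in> S"
    then have W: "x \<in> W" using S_subset_W by blast
    show "(y has_field_derivative deriv y x) (at x)" "(deriv y has_field_derivative ?y2 x) (at x)"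
      using y(1,2)[OF W] .
    have "(?y2 has_field_derivative 2 * deriv \<wp> (x + \<beta>) * y x +
        deriv y x * (2 * \<wp> (x + \<beta>) - 2 * N)) (at x)"
      using DERIV_mult[OF DERIV_diff[OF DERIV_cmult[OF wp_shift_deriv[OF x], of 2] DERIV_const[of "2 * N"]] y(1)[OF W]]
      by simp
    moreover have "2 * dp * w + w1 * (2 * p - 2 * N) = 6 * (p + N) * w1 - 8 * w"
      if "2 * (p + 2 * N) * w1 = (dp + 4) * w" for p dp w w1
      using that by algebra
    ultimately show "(?y2 has_field_derivative 6 * (\<wp> (x + \<beta>) + N) * deriv y x - 8 * y x) (at x)"
      using y(3)[OF W] by simp
  next
    show "v $ 2 = y 0" "- 2 / A * v $ 3 = deriv y 0"
      using muA by (simp_all add: v y(4,5) field_simps power2_eq_square)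
    have "4 * A * (- (1 / (A * d))) - 4 * \<mu> / A * (- (1 / (A * d))) = 4 / A^2"
      if "d = \<mu> - A^2" "d \<noteq> 0" for d
    proof -
      have mu: "\<mu> = d + A^2" using that by simp
      show ?thesis unfolding mu using that(2) by (simp add: field_simps power2_eq_square)
    qed
    from this[OF refl muA] show "4 * A * v $ 1 - 4 * \<mu> / A * v $ 3 = ?y2 0"
      by (simp add: v y(4) beta)
  qed
  then show ?thesis by (simp add: y_def)
qed

text \<open>For \<open>M = 0\<close> the two exponentials of \<open>row_e_minus\<close> coalesce, and \<open>g(x) = x\<close> takes the place of the second one.\<close>
lemma row_linear_multiple:
  assumes Psi: "Phi_inv_solution \<omega>1 \<omega>2 A N \<beta> \<Psi>" and N: "N = 0" and x: "x \<in> S"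
    and v: "v = vector [A / 2, 0, - (A / 2)]"
  shows "(v v* \<Psi> x) $ 2 = x * e x"
proof (rule row_solution[OF Psi, of "\<lambda>x. x * e x" "\<lambda>x. e x + x * deriv e x"
      "\<lambda>x. 2 * deriv e x + x * ((2 * \<wp> (x + \<beta>) + N) * e x)", OF _ _ _ _ _ _ x])
  fix x assume "x \<in> S"
  note d = e_derivs[OF this]
  show "((\<lambda>x. x * e x) has_field_derivative e x + x * deriv e x) (at x)"
    by (rule DERIV_cong[OF DERIV_mult[OF DERIV_ident d(1)]]) (simp add: algebra_simps)
  show "((\<lambda>x. e x + x * deriv e x) has_field_derivative
      2 * deriv e x + x * ((2 * \<wp> (x + \<beta>) + N) * e x)) (at x)"
    by (rule DERIV_cong[OF DERIV_add[OF d(1) DERIV_mult[OF DERIV_ident d(2)]]]) (simp add: algebra_simps)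
  have "((\<lambda>x. 2 * deriv e x + x * ((2 * \<wp> (x + \<beta>) + N) * e x)) has_field_derivative
      2 * ((2 * \<wp> (x + \<beta>) + N) * e x) + (1 * ((2 * \<wp> (x + \<beta>) + N) * e x) +
      (2 * deriv \<wp> (x + \<beta>) * e x + (2 * \<wp> (x + \<beta>) + N) * deriv e x) * x)) (at x)"
    by (rule DERIV_add[OF DERIV_cmult[OF d(2), of 2] DERIV_mult[OF DERIV_ident d(3)]])
  moreover have "2 * ((2 * p + N) * y) + (1 * ((2 * p + N) * y) + (2 * dp * y + (2 * p + N) * y1) * x) =
      6 * (p + N) * (y + x * y1) - 8 * (x * y)"
    if "2 * (p - N) * y1 = (dp + 4) * y" for p dp y y1
    using that N by algebra
  ultimately show "((\<lambda>x. 2 * deriv e x + x * ((2 * \<wp> (x + \<beta>) + N) * e x)) has_field_derivative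
      6 * (\<wp> (x + \<beta>) + N) * (e x + x * deriv e x) - 8 * (x * e x)) (at x)"
    using d(4) by simp
next
  show "v $ 2 = 0 * e 0" "- 2 / A * v $ 3 = e 0 + 0 * deriv e 0"
    "4 * A * v $ 1 - 4 * \<mu> / A * v $ 3 = 2 * deriv e 0 + 0 * ((2 * \<wp> (0 + \<beta>) + N) * e 0)"
    by (simp_all add: v e_minus_facts(4,5) power2_eq_square algebra_simps)
qed

text \<open>For \<open>M = 0\<close> the factor \<open>g = r\<close> of the remaining solution satisfies \<open>g''' = -3 (e' / e) g''\<close>, so that \<open>e\<^sup>3 r''\<close> is
  constant; its value is read off at \<open>0\<close>.\<close>
lemma row_quadrature:
  assumes Psi: "Phi_inv_solution \<omega>1 \<omega>2 A N \<beta> \<Psi>" and N: "N = 0"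
    and v: "v = vector [A / 2, 0, A / 2]"
  obtains r r1 where "\<And>x. x \<in> S \<Longrightarrow> (v v* \<Psi> x) $ 2 = e x * r x"
    "\<And>x. x \<in> S \<Longrightarrow> (r has_field_derivative r1 x) (at x)"
    "\<And>x. x \<in> S \<Longrightarrow> (r1 has_field_derivative 4 * A^2 / (e x)^3) (at x)"
    "r 0 = 0" "r1 0 = - 1"
proof -
  define u where "u = (\<lambda>x. (v v* \<Psi> x) $ 2)"
  obtain u1 u2 where u:
    "\<And>x. x \<in> S \<Longrightarrow> (u has_field_derivative u1 x) (at x)"
    "\<And>x. x \<in> S \<Longrightarrow> (u1 has_field_derivative u2 x) (at x)"
    "\<And>x. x \<in> S \<Longrightarrow> (u2 has_field_derivative 6 * (\<wp> (x + \<beta>) + N) * u1 x - 8 * u x) (at x)"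
    "u 0 = v $ 2" "u1 0 = - 2 / A * v $ 3" "u2 0 = 4 * A * v $ 1 - 4 * \<mu> / A * v $ 3"
    using row_third_order[OF Psi, of v] unfolding u_def by blast
  define e2 where "e2 = (\<lambda>x. (2 * \<wp> (x + \<beta>) + N) * e x)"
  (* J is e^3 times the second derivative of u / e, written without denominators. *)
  define J where "J = (\<lambda>x. (u2 x * e x - u x * e2 x) * e x - 2 * (u1 x * e x - u x * deriv e x) * deriv e x)"
  have d: "(e has_field_derivative deriv e x) (at x)" "(deriv e has_field_derivative e2 x) (at x)"
    "(e2 has_field_derivative 2 * deriv \<wp> (x + \<beta>) * e x + (2 * \<wp> (x + \<beta>) + N) * deriv e x) (at x)"
    "2 * (\<wp> (x + \<beta>) - N) * deriv e x = (deriv \<wp> (x + \<beta>) + 4) * e x" if "x \<in> S" for x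
    using e_derivs[OF that] unfolding e2_def by simp_all
  have "J constant_on S"
  proof (rule has_field_derivative_0_imp_constant_on[OF _ connected_S open_S])
    fix x assume x: "x \<in> S"
    note d = d[OF x]
    have "(J has_field_derivative
        ((6 * (\<wp> (x + \<beta>) + N) * u1 x - 8 * u x) * e x + deriv e x * u2 x -
          (u1 x * e2 x + (2 * deriv \<wp> (x + \<beta>) * e x + (2 * \<wp> (x + \<beta>) + N) * deriv e x) * u x)) * e x +
        deriv e x * (u2 x * e x - u x * e2 x) -
        (2 * (u2 x * e x + deriv e x * u1 x - (u1 x * deriv e x + e2 x * u x)) * deriv e x +
          e2 x * (2 * (u1 x * e x - u x * deriv e x)))) (at x)"
      unfolding J_def
      by (rule DERIV_diff DERIV_mult DERIV_cmult u(1-3)[OF x] d(1-3))+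
    moreover have "((6 * (p + N) * w1 - 8 * w) * y + y1 * w2 -
          (w1 * y2 + (2 * dp * y + (2 * p + N) * y1) * w)) * y +
        y1 * (w2 * y - w * y2) -
        (2 * (w2 * y + y1 * w1 - (w1 * y1 + y2 * w)) * y1 + y2 * (2 * (w1 * y - w * y1))) = 0"
      if "2 * (p - N) * y1 = (dp + 4) * y" "y2 = (2 * p + N) * y" for p dp w w1 w2 y y1 y2
      using that N by algebra
    ultimately show "(J has_field_derivative 0) (at x)"
      using d(4) by (simp add: e2_def)
  qed
  moreover have "J 0 = 4 * A^2"
    using u(4-6) by (simp add: J_def v e2_def e_minus_facts(4,5) power2_eq_square algebra_simps)
  ultimately have J: "J x = 4 * A^2" if "x \<in> S" for x
    using that zero_in_S unfolding constant_on_def by metis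
  define r where "r = (\<lambda>x. u x / e x)"
  define r1 where "r1 = (\<lambda>x. (u1 x * e x - u x * deriv e x) / (e x * e x))"
  show thesis
  proof (rule that[of r r1])
    fix x assume x: "x \<in> S"
    note d = d[OF x]
    have ex: "e x \<noteq> 0" by (rule e_minus_facts(6)[OF x])
    show "(v v* \<Psi> x) $ 2 = e x * r x" using ex by (simp add: r_def u_def)
    show "(r has_field_derivative r1 x) (at x)"
      unfolding r_def r1_def by (rule DERIV_divide[OF u(1)[OF x] d(1) ex])
    have "(r1 has_field_derivative
        ((u2 x * e x + deriv e x * u1 x - (u1 x * deriv e x + e2 x * u x)) * (e x * e x) -
         (u1 x * e x - u x * deriv e x) * (deriv e x * e x + deriv e x * e x)) / (e x * e x * (e x * e x))) (at x)"
      unfolding r1_def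
      by (rule DERIV_divide DERIV_diff DERIV_mult u(1-3)[OF x] d(1-2))+ (use ex in simp)
    moreover have "((u2 x * e x + deriv e x * u1 x - (u1 x * deriv e x + e2 x * u x)) * (e x * e x) -
         (u1 x * e x - u x * deriv e x) * (deriv e x * e x + deriv e x * e x)) / (e x * e x * (e x * e x)) =
         J x / (e x)^3"
      using ex by (simp add: J_def divide_simps power3_eq_cube) (simp add: algebra_simps)
    ultimately show "(r1 has_field_derivative 4 * A^2 / (e x)^3) (at x)"
      by (simp add: J[OF x])
  next
    show "r 0 = 0" "r1 0 = - 1"
      using u(4,5) by (simp_all add: r_def r1_def v e_minus_facts(4,5))
  qed
qed

lemma e_inverse:
  "inverse (e x) = \<sigma> (x + \<beta>) * \<sigma> (\<beta> - \<alpha>) / (\<sigma> \<beta> * \<sigma> (x + \<beta> - \<alpha>)) * exp (- \<zeta> \<alpha> * x)"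
  by (simp add: e_minus_def exp_minus divide_inverse mult_ac)

text \<open>The integrand \<open>(x - s) r''(s)\<close> has the primitive \<open>(x - s) r'(s) + r(s)\<close>. It is known on the domain of \<open>\<Psi>\<close>
  only, while the path is merely required to avoid the poles of the integrand.\<close>
lemma quadrature_q_int:
  assumes r: "\<And>x. x \<in> S \<Longrightarrow> (r has_field_derivative r1 x) (at x)"
    "\<And>x. x \<in> S \<Longrightarrow> (r1 has_field_derivative 4 * A^2 / (e x)^3) (at x)"
    "r 0 = 0" "r1 0 = - 1"
    and x: "x \<in> S" and g: "q_path \<omega>1 \<omega>2 \<alpha> \<beta> x g"
  shows "r x = - x + 4 * A^2 * q_int \<omega>1 \<omega>2 \<alpha> \<beta> g x * (\<sigma> (\<beta> - \<alpha>) / \<sigma> \<beta>)^3"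
proof -
  define c where "c = \<sigma> (\<beta> - \<alpha>) / \<sigma> \<beta>"
  define f where "f = (\<lambda>s. (x - s) * (\<sigma> (s + \<beta>) / \<sigma> (s + \<beta> - \<alpha>))^3 * exp (- 3 * \<zeta> \<alpha> * s))"
  define D where "D = {s. s + (\<beta> - \<alpha>) \<notin> L}"
  have cA: "4 * A^2 * c^3 \<noteq> 0"
    using sigma_nonzero beta beta_shift by (simp add: c_def)
  have openD: "open D"
  proof -
    have "D = - {s. s + (\<beta> - \<alpha>) \<in> L}" by (auto simp: D_def)
    then show ?thesis using sparse_in_UNIV_imp_closed[OF lattice_translate_sparse] by auto
  qed
  have shift: "(\<lambda>x. \<sigma> (x + d)) holomorphic_on D" for d
  proof -
    have "(\<lambda>x. x + d) holomorphic_on D" by (intro holomorphic_intros)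
    from holomorphic_on_compose[OF this sigma_holomorphic] show ?thesis by (simp add: o_def)
  qed
  have "(\<lambda>s. (x - s) * (\<sigma> (s + \<beta>) / \<sigma> (s + (\<beta> - \<alpha>)))^3 * exp (- 3 * \<zeta> \<alpha> * s)) holomorphic_on D"
    using sigma_nonzero by (intro holomorphic_intros shift) (auto simp: D_def)
  then have holf: "f holomorphic_on D" by (simp add: f_def add_diff_eq)
  have inv3: "1 / (e s)^3 = c^3 * (\<sigma> (s + \<beta>) / \<sigma> (s + \<beta> - \<alpha>))^3 * exp (- 3 * \<zeta> \<alpha> * s)" for s
  proof -
    have "exp (- 3 * \<zeta> \<alpha> * s) = exp (- \<zeta> \<alpha> * s) ^ 3"
      by (simp add: exp_of_nat_mult[symmetric] mult_ac)
    moreover have "1 / (e s)^3 = (inverse (e s))^3" by (simp add: power_inverse divide_inverse)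
    moreover have "inverse (e s) = c * (\<sigma> (s + \<beta>) / \<sigma> (s + \<beta> - \<alpha>)) * exp (- \<zeta> \<alpha> * s)"
      unfolding e_inverse c_def by simp
    ultimately show ?thesis by (simp only: power_mult_distrib)
  qed
  have SD: "D - - S = S" using S_iff by (auto simp: D_def add_diff_eq)
  define F where "F = (\<lambda>s. ((x - s) * r1 s + r s) / (4 * A^2 * c^3))"
  have F: "(F has_field_derivative f s) (at s)" if s: "s \<in> D - - S" for s
  proof -
    have s: "s \<in> S" using s by simp
    have "((\<lambda>s. (x - s) * r1 s + r s) has_field_derivative (0 - 1) * r1 s + 4 * A^2 / (e s)^3 * (x - s) + r1 s) (at s)"
      by (rule DERIV_add DERIV_mult DERIV_diff DERIV_const DERIV_ident r(1,2)[OF s])+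
    then have "(F has_field_derivative ((0 - 1) * r1 s + 4 * A^2 / (e s)^3 * (x - s) + r1 s) / (4 * A^2 * c^3)) (at s)"
      unfolding F_def by (rule DERIV_cdivide)
    moreover have "((0 - 1) * r1 s + 4 * A^2 / (e s)^3 * (x - s) + r1 s) / (4 * A^2 * c^3) = f s"
    proof -
      have "(0 - 1) * r1 s + 4 * A^2 / (e s)^3 * (x - s) + r1 s = 4 * A^2 * (1 / (e s)^3) * (x - s)" by simp
      also have "\<dots> = 4 * A^2 * c^3 * f s" unfolding inv3 f_def by (simp only: mult_ac)
      finally show ?thesis using cA by simp
    qed
    ultimately show ?thesis by simp
  qed
  have "contour_integral g f = F x - F 0"
    using contour_integral_primitive_off_sparse[OF openD holf compl_S_sparse F, of g] g x zero_in_S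
    unfolding SD by (auto simp: q_path_def D_def add_diff_eq)
  then have "q_int \<omega>1 \<omega>2 \<alpha> \<beta> g x = (r x + x) / (4 * A^2 * c^3)"
    unfolding q_int_def f_def[symmetric] by (simp add: F_def r(3,4) diff_divide_distrib add_divide_distrib)
  then have "4 * A^2 * c^3 * q_int \<omega>1 \<omega>2 \<alpha> \<beta> g x = r x + x" using cA by simp
  then show ?thesis unfolding c_def[symmetric] by (simp add: algebra_simps)
qed

end

context delaunay_data
begin

section \<open>The transformed surfaces\<close>

text \<open>The third row is the first one with \<open>k\<close> replaced by \<open>-k\<close>.\<close>
lemma K1_outer_rows:
  "K1 A \<mu> k $ 1 = vector [A * (k - \<mu> - A^2) / 2, 1, - (A * (k + \<mu> + A^2) / 2)]"
  "K1 A \<mu> k $ 3 = vector [A * (- k - \<mu> - A^2) / 2, 1, - (A * (- k + \<mu> + A^2) / 2)]"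
  by (simp_all add: K1_def vec_eq_iff forall_3 field_simps)

lemma vector_matrix_cscale: "v v* (z *\<^sub>M B) = z *s (v v* B)" for v and B :: "complex^3^3"
  by (simp add: vec_eq_iff vector_matrix_mult_def cscale_def sum_3 algebra_simps)

text \<open>The characteristic polynomial of the potential matrix is \<open>s\<^sup>3 - 3 M s\<close>, by the relation between \<open>M\<close>, \<open>m\<close> and
  \<open>a\<close>.\<close>
lemma potential_eigenrow:
  assumes \<kappa>: "\<kappa>^2 = 3 * N"
  shows "(vector [A * (\<kappa> - \<mu> - A^2) / 2, 1, - (A * (\<kappa> + \<mu> + A^2) / 2)] :: complex^3) v* potential_X A \<mu>
      = (- \<kappa>) *s vector [A * (\<kappa> - \<mu> - A^2) / 2, 1, - (A * (\<kappa> + \<mu> + A^2) / 2)]"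
proof -
  define i where "i = 1 / A"
  have i: "A * i = 1" by (simp add: i_def)
  have "\<kappa>^2 = \<mu>^2 - 2 * i^2 - A^4"
    using \<kappa> N_eq by (simp add: i_def power_divide)
  then have "A * (\<kappa>^2 - \<mu>^2 + A^4) = - 2 * i * (A * i)" by (simp add: power2_eq_square)
  then have rel: "A * (\<kappa>^2 - \<mu>^2 + A^4) = - 2 * i" unfolding i by simp
  define b where "b = A / 2"
  have half: "A * w / 2 = b * w" for w by (simp add: b_def)
  have "2 * (b * (\<kappa> * \<kappa> - \<mu> * \<mu> + A * A * A * A)) = 2 * (- i)"
    using rel by (simp add: b_def power2_eq_square power4_eq_xxxx)
  then have rel': "b * (\<kappa> * \<kappa> - \<mu> * \<mu> + A * A * A * A) = - i"
    by (simp only: mult_cancel_left) simp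
  have c1: "b * (\<kappa> - \<mu> - A * A) * \<mu> + i + b * (\<kappa> + \<mu> + A * A) * (A * A) =
      - (\<kappa> * (b * (\<kappa> - \<mu> - A * A)))"
    using rel' by (simp add: algebra_simps)
  have c2: "- (b * (\<kappa> - \<mu> - A * A) * i) - b * (\<kappa> + \<mu> + A * A) * i = - \<kappa>"
    using i by (simp add: b_def field_simps)
  have c3: "b * (\<kappa> - \<mu> - A * A) * (A * A) - i + b * (\<kappa> + \<mu> + A * A) * \<mu> =
      \<kappa> * (b * (\<kappa> + \<mu> + A * A))"
    using rel' by (simp add: algebra_simps)
  show ?thesis
    unfolding vec_eq_iff forall_3 potential_X_def vector_matrix_mult_def i_def[symmetric] power2_eq_square half
    using c1 c2 c3 by (simp add: sum_3)
qed

lemma K1_rows: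
  assumes k: "k^2 = 3 * N" and m: "\<mu> - A^2 \<noteq> 0"
  shows "K1 A \<mu> k $ 1 v* (z *\<^sub>M potential_X A \<mu>) = (- k * z) *s K1 A \<mu> k $ 1"
    and "K1 A \<mu> k $ 2 v* (z *\<^sub>M potential_X A \<mu>) = 0 *s K1 A \<mu> k $ 2"
    and "K1 A \<mu> k $ 3 v* (z *\<^sub>M potential_X A \<mu>) = (k * z) *s K1 A \<mu> k $ 3"
proof -
  have km: "(- k)^2 = 3 * N" using k by simp
  show "K1 A \<mu> k $ 1 v* (z *\<^sub>M potential_X A \<mu>) = (- k * z) *s K1 A \<mu> k $ 1"
    unfolding vector_matrix_cscale K1_outer_rows potential_eigenrow[OF k] by (simp add: vec_eq_iff)
  show "K1 A \<mu> k $ 3 v* (z *\<^sub>M potential_X A \<mu>) = (k * z) *s K1 A \<mu> k $ 3"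
    unfolding vector_matrix_cscale K1_outer_rows potential_eigenrow[OF km] by (simp add: vec_eq_iff)
  define i where "i = 1 / A"
  define j where "j = 1 / (A * (\<mu> - A * A))"
  have j: "(\<mu> - A * A) * j = i" using m by (simp add: j_def i_def power2_eq_square)
  have "K1 A \<mu> k $ 2 = vector [- j, 1, - j]" by (simp add: K1_def j_def power2_eq_square)
  moreover have "vector [- j, 1, - j] v* potential_X A \<mu> = 0"
    unfolding vec_eq_iff forall_3 potential_X_def vector_matrix_mult_def i_def[symmetric] power2_eq_square
    using j by (simp add: sum_3 algebra_simps)
  ultimately show "K1 A \<mu> k $ 2 v* (z *\<^sub>M potential_X A \<mu>) = 0 *s K1 A \<mu> k $ 2"
    unfolding vector_matrix_cscale by simp
qed

lemma det_K1:
  assumes k: "k^2 = 3 * N" and m: "\<mu> - A^2 \<noteq> 0"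
  shows "(\<mu> - A^2) * det (K1 A \<mu> k) = - (A^2 * k^3)"
proof -
  define i where "i = 1 / A"
  have i: "i * A = 1" by (simp add: i_def)
  have rel: "k^2 = \<mu>^2 - 2 * i^2 - A^4"
    using k N_eq by (simp add: i_def power_divide)
  define j where "j = 1 / (A * (\<mu> - A^2))"
  have j: "j * (A * (\<mu> - A^2)) = 1" using m by (simp add: j_def)
  have "det (K1 A \<mu> k) = 2 * A * k * (j - A * (\<mu> + A^2) / 2)"
    unfolding K1_def j_def[symmetric] by (simp add: det_3 field_simps power2_eq_square)
  then have "2 * det (K1 A \<mu> k) = 2 * A * k * (2 * j - A * (\<mu> + A^2))" by (simp add: field_simps)
  then show ?thesis using i j rel by algebra
qed

text \<open>The factor \<open>exp(-k (x + i y))\<close> of the first coordinate cancels against \<open>exp(k (x + i y))\<close> of the third one, and likewise the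
  factors \<open>exp(\<plusminus>k x)\<close> of the two solutions. In the second coordinate no exponential occurs.\<close>
lemma K1_surface_components:
  fixes x y :: real
  assumes Psi: "Phi_inv_solution \<omega>1 \<omega>2 A N \<beta> \<Psi>" and k: "k^2 = 3 * N" and m: "m \<noteq> a^2"
    and x: "complex_of_real x \<in> S"
  defines "u \<equiv> \<lambda>j. ((K1 A \<mu> k $ j v* mat_exp (Complex x y *\<^sub>M potential_X A \<mu>)) v* \<Psi> (of_real x)) $ 2"
  shows "u 1 * u 3 = (e (of_real x))^2" and "u 2 = e_plus \<omega>1 \<omega>2 \<alpha> \<beta> (of_real x)"
proof -
  have muA: "\<mu> - A^2 \<noteq> 0" using m by (simp flip: of_real_power of_real_diff)
  let ?x = "complex_of_real x" and ?z = "Complex x y"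
  have rows: "(K1 A \<mu> k $ 1 v* \<Psi> ?x) $ 2 = e ?x * exp (k * ?x)"
    "(K1 A \<mu> k $ 3 v* \<Psi> ?x) $ 2 = e ?x * exp (- k * ?x)"
  proof -
    show "(K1 A \<mu> k $ 1 v* \<Psi> ?x) $ 2 = e ?x * exp (k * ?x)"
      by (rule row_e_minus[OF Psi k x K1_outer_rows(1)])
    show "(K1 A \<mu> k $ 3 v* \<Psi> ?x) $ 2 = e ?x * exp (- k * ?x)"
      by (rule row_e_minus[OF Psi _ x K1_outer_rows(2)]) (simp add: k)
  qed
  have "u 1 = exp (- k * ?z) * (e ?x * exp (k * ?x))" "u 3 = exp (k * ?z) * (e ?x * exp (- k * ?x))"
    unfolding u_def eigen_mat_exp[OF K1_rows(1)[OF k muA]] eigen_mat_exp[OF K1_rows(3)[OF k muA]]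
      scaled_row rows by simp_all
  then have "u 1 * u 3 = (exp (- k * ?z) * exp (k * ?z)) * (exp (k * ?x) * exp (- k * ?x)) * (e ?x)^2"
    by (simp only: power2_eq_square mult_ac)
  then show "u 1 * u 3 = (e ?x)^2" by (simp flip: exp_add)
  have "(K1 A \<mu> k $ 2 v* \<Psi> ?x) $ 2 = e_plus \<omega>1 \<omega>2 \<alpha> \<beta> ?x"
    by (rule row_e_plus[OF Psi m x]) (simp add: K1_def)
  then show "u 2 = e_plus \<omega>1 \<omega>2 \<alpha> \<beta> ?x"
    unfolding u_def eigen_mat_exp[OF K1_rows(2)[OF k muA]] scaled_row by simp
qed

text \<open>For imaginary \<open>k\<close> the first and third entries of each row of \<open>K\<^sub>1\<close> are complex conjugate.\<close>
lemma gamma1_SL3R: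
  assumes k: "k^2 = 3 * N" and imag: "k = \<i> * of_real \<kappa>" "\<kappa> \<noteq> 0" and m: "\<mu> - A^2 \<noteq> 0"
  shows "gamma1 A \<mu> k \<in> SL3R"
  unfolding gamma1_def
proof (rule SL3R_intro)
  let ?D = "vector [vector [1 / A, 0, 0], vector [0, \<mu> - A\<^sup>2, 0], vector [0, 0, 1 / A]] :: complex^3^3"
  have ik: "\<i> / k = of_real (1 / \<kappa>)" using imag by simp
  fix i :: 3
  show "\<i> / k * (?D ** K1 A \<mu> k) $ i $ 2 \<in> \<real>"
    using exhaust_3[of i] unfolding ik
    by (auto simp: matrix_matrix_mult_def sum_3 K1_def)
  show "\<i> / k * (?D ** K1 A \<mu> k) $ i $ 3 = cnj (\<i> / k * (?D ** K1 A \<mu> k) $ i $ 1)"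
    using exhaust_3[of i] unfolding ik
    by (auto simp: matrix_matrix_mult_def sum_3 K1_def imag(1) diff_divide_distrib algebra_simps)
next
  let ?D = "vector [vector [1 / A, 0, 0], vector [0, \<mu> - A\<^sup>2, 0], vector [0, 0, 1 / A]] :: complex^3^3"
  have k0: "k \<noteq> 0" using imag by simp
  have "det ?D = (\<mu> - A^2) / A^2" by (simp add: det_3 power2_eq_square)
  then have "(\<i> / k) ^ 3 * (det ?D * det (K1 A \<mu> k)) =
      (\<i> / k) ^ 3 * (((\<mu> - A^2) * det (K1 A \<mu> k)) / A^2)" by simp
  also have "\<dots> = \<i>"
    unfolding det_K1[OF k m] using k0 by (simp add: power3_eq_cube)
  finally show "(\<i> / k) ^ 3 * (det ?D * det (K1 A \<mu> k)) = \<i>" .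
qed

text \<open>For real \<open>k\<close> the outer rows of \<open>K\<^sub>1\<close> are the same up to exchanging the first and third entries. Their sum is then symmetric
  in these entries and their difference is antisymmetric, so that the factor \<open>i\<close> makes the entries of the
  latter complex conjugate.\<close>
lemma gamma2_SL3R:
  assumes k: "k^2 = 3 * N" and real: "k = of_real \<kappa>" "\<kappa> \<noteq> 0" and m: "\<mu> - A^2 \<noteq> 0"
  shows "gamma2 A \<mu> k \<in> SL3R"
  unfolding gamma2_def
proof (rule SL3R_intro)
  let ?D = "vector [vector [2 / A, 0, 2 / A], vector [0, \<mu> - A\<^sup>2, 0],
      vector [2 * \<i> / A, 0, - (2 * \<i> / A)]] :: complex^3^3"
  fix i :: 3
  show "1 / (2 * k) * (?D ** K1 A \<mu> k) $ i $ 2 \<in> \<real>"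
    using exhaust_3[of i]
    by (auto simp: matrix_matrix_mult_def sum_3 K1_def real(1) complex_is_Real_iff)
  show "1 / (2 * k) * (?D ** K1 A \<mu> k) $ i $ 3 = cnj (1 / (2 * k) * (?D ** K1 A \<mu> k) $ i $ 1)"
    using exhaust_3[of i]
    by (auto simp: matrix_matrix_mult_def sum_3 K1_def real(1) field_simps)
next
  let ?D = "vector [vector [2 / A, 0, 2 / A], vector [0, \<mu> - A\<^sup>2, 0],
      vector [2 * \<i> / A, 0, - (2 * \<i> / A)]] :: complex^3^3"
  have k0: "k \<noteq> 0" using real by simp
  have "det ?D = - 8 * \<i> * (\<mu> - A^2) / A^2" by (simp add: det_3 power2_eq_square field_simps)
  then have "(1 / (2 * k)) ^ 3 * (det ?D * det (K1 A \<mu> k)) =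
      (1 / (2 * k)) ^ 3 * (- 8 * \<i> * ((\<mu> - A^2) * det (K1 A \<mu> k)) / A^2)" by simp
  also have "\<dots> = \<i>"
    unfolding det_K1[OF k m] using k0 by (simp add: power3_eq_cube)
  finally show "(1 / (2 * k)) ^ 3 * (det ?D * det (K1 A \<mu> k)) = \<i>" .
qed

text \<open>The rows form a Jordan chain: the potential matrix maps \<open>\<rho>3\<close> to \<open>(m - a\<^sup>2) \<rho>2\<close>, \<open>\<rho>2\<close> to \<open>-\<rho>1\<close> and \<open>\<rho>1\<close> to \<open>0\<close>.\<close>
lemma parabolic_rows:
  fixes z :: complex
  assumes N: "N = 0"
  defines "\<rho>1 \<equiv> vector [- (A / 2 * (\<mu> + A^2)), 1, - (A / 2 * (\<mu> + A^2))] :: complex^3"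
    and "\<rho>2 \<equiv> vector [A / 2, 0, - (A / 2)] :: complex^3"
    and "\<rho>3 \<equiv> vector [A / 2, 0, A / 2] :: complex^3"
    and "Y \<equiv> z *\<^sub>M potential_X A \<mu>"
  shows "\<rho>1 v* mat_exp Y = \<rho>1"
    and "\<rho>2 v* mat_exp Y = \<rho>2 - z *s \<rho>1"
    and "\<rho>3 v* mat_exp Y = \<rho>3 + (z * (\<mu> - A^2)) *s \<rho>2 - (z^2 / 2 * (\<mu> - A^2)) *s \<rho>1"
proof -
  have "\<rho>1 = vector [A * (0 - \<mu> - A^2) / 2, 1, - (A * (0 + \<mu> + A^2) / 2)]"
    by (simp add: \<rho>1_def vec_eq_iff forall_3 field_simps)
  with potential_eigenrow[of 0] N have "\<rho>1 v* potential_X A \<mu> = 0" by simp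
  then have 1: "\<rho>1 v* Y = 0" by (simp add: Y_def vector_matrix_cscale)
  have "\<rho>2 v* potential_X A \<mu> = - \<rho>1"
    unfolding vec_eq_iff forall_3 \<rho>1_def \<rho>2_def potential_X_def vector_matrix_mult_def
    by (simp add: sum_3 algebra_simps)
  then have 2: "\<rho>2 v* Y = (- z) *s \<rho>1" by (simp add: Y_def vector_matrix_cscale vec_eq_iff)
  have "\<rho>3 v* potential_X A \<mu> = (\<mu> - A^2) *s \<rho>2"
    unfolding vec_eq_iff forall_3 \<rho>3_def \<rho>2_def potential_X_def vector_matrix_mult_def
    by (simp add: sum_3 algebra_simps)
  then have 3: "\<rho>3 v* Y = (z * (\<mu> - A^2)) *s \<rho>2"
    by (simp only: Y_def vector_matrix_cscale vector_smult_assoc)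
  have s: "(c *s w) v* Y = c *s (w v* Y)" for c w
    by (simp add: vec_eq_iff scaled_row)
  have neg: "(- w) v* Y = - (w v* Y)" for w
    by (simp add: vec_eq_iff vector_matrix_mult_def sum_3)
  have half: "(1 / 2) *\<^sub>R w = (1 / 2) *s w" for w :: "complex^3"
    unfolding vec_eq_iff vector_scaleR_component vector_smult_component by (simp add: scaleR_conv_of_real)
  show "\<rho>1 v* mat_exp Y = \<rho>1"
    using nilpotent_mat_exp[of \<rho>1 Y] by (simp add: 1)
  show "\<rho>2 v* mat_exp Y = \<rho>2 - z *s \<rho>1"
    using nilpotent_mat_exp[of \<rho>2 Y] by (simp add: 1 2 s neg vec_eq_iff)
  show "\<rho>3 v* mat_exp Y = \<rho>3 + (z * (\<mu> - A^2)) *s \<rho>2 - (z^2 / 2 * (\<mu> - A^2)) *s \<rho>1"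
    using nilpotent_mat_exp[of \<rho>3 Y] unfolding half
    by (simp add: 1 2 3 s neg vec_eq_iff power2_eq_square algebra_simps)
qed

text \<open>The quotients of \<open>\<sigma>\<close> values in \<open>P\<close>, \<open>K\<^sub>2\<close> and the prefactor cancel, and the rows of \<open>\<gamma>\<^sub>3 T\<close> are multiples of the
  Jordan chain.\<close>
lemma gamma3_rows:
  fixes \<rho>1 \<rho>2 \<rho>3 :: "complex^3"
  assumes "\<rho>1 = vector [- (A / 2 * (\<mu> + A^2)), 1, - (A / 2 * (\<mu> + A^2))]"
    "\<rho>2 = vector [A / 2, 0, - (A / 2)]" "\<rho>3 = vector [A / 2, 0, A / 2]"
  shows "gamma3 \<omega>1 \<omega>2 \<alpha> \<beta> A \<mu> = 1 *\<^sub>M (mat 1 **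
      vector [(- \<i>) *s \<rho>2, (- 2 / A^2) *s \<rho>1, \<rho>3] ** matrix_inv T_mat)"
proof -
  define s where "s = \<sigma> (\<beta> - \<alpha>) / \<sigma> \<beta>"
  have s: "s \<noteq> 0" using sigma_nonzero beta beta_shift by (simp add: s_def)
  let ?D = "vector [vector [0, 1, 0], vector [2 / A\<^sup>2, 0, 0], vector [0, 0, 1]] :: complex^3^3"
  have "(- (1 / s)) *\<^sub>M (?D ** P_mat \<omega>1 \<omega>2 \<alpha> \<beta> A ** K2 \<omega>1 \<omega>2 \<alpha> \<beta> A \<mu>) =
      vector [(- \<i>) *s \<rho>2, (- 2 / A^2) *s \<rho>1, \<rho>3]"
  proof -
    have inv: "\<sigma> \<beta> / \<sigma> (\<beta> - \<alpha>) = 1 / s" by (simp add: s_def)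
    show ?thesis
      unfolding vec_eq_iff forall_3 P_mat_def K2_def s_def[symmetric] inv assms
      using s by (simp add: cscale_def matrix_matrix_mult_def sum_3 power3_eq_cube power2_eq_square field_simps)
  qed
  moreover have "c *\<^sub>M (Y ** Z) = (c *\<^sub>M Y) ** Z" for c and Y Z :: "complex^3^3"
    by (simp add: vec_eq_iff cscale_def matrix_matrix_mult_def sum_3 algebra_simps)
  moreover have "1 *\<^sub>M Y = Y" for Y :: "complex^3^3" by (simp add: cscale_def vec_eq_iff)
  moreover have "\<sigma> \<beta> / \<sigma> (\<beta> - \<alpha>) = 1 / s" by (simp add: s_def)
  ultimately show ?thesis unfolding gamma3_def by (simp only: matrix_mul_lid)
qed

lemma gamma3_SL3R: "gamma3 \<omega>1 \<omega>2 \<alpha> \<beta> A \<mu> \<in> SL3R"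
  unfolding gamma3_rows[OF refl refl refl]
proof (rule SL3R_intro)
  fix i :: 3
  let ?K = "vector [(- \<i>) *s vector [A / 2, 0, - (A / 2)],
      (- 2 / A^2) *s vector [- (A / 2 * (\<mu> + A^2)), 1, - (A / 2 * (\<mu> + A^2))],
      vector [A / 2, 0, A / 2]] :: complex^3^3"
  show "1 * (mat 1 ** ?K) $ i $ 2 \<in> \<real>" "1 * (mat 1 ** ?K) $ i $ 3 = cnj (1 * (mat 1 ** ?K) $ i $ 1)"
    using exhaust_3[of i] by (auto simp: complex_is_Real_iff)
next
  let ?K = "vector [(- \<i>) *s vector [A / 2, 0, - (A / 2)],
      (- 2 / A^2) *s vector [- (A / 2 * (\<mu> + A^2)), 1, - (A / 2 * (\<mu> + A^2))],
      vector [A / 2, 0, A / 2]] :: complex^3^3"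
  show "1 ^ 3 * (det (mat 1 :: complex^3^3) * det ?K) = \<i>"
    unfolding det_I by (simp add: det_3 power2_eq_square field_simps)
qed

text \<open>With \<open>z = x + i y\<close> the coordinates are \<open>X\<^sub>1 = -i (x - z) e\<close> and
  \<open>X\<^sub>3 = e r + (m - a\<^sup>2) (z x - z\<^sup>2 / 2) e\<close>. Completing the square in \<open>z\<close> gives the parabola.\<close>
lemma gamma3_surface:
  fixes x y :: real and X :: "complex^3"
  assumes Psi: "Phi_inv_solution \<omega>1 \<omega>2 A N \<beta> \<Psi>" and N: "N = 0"
    and x: "complex_of_real x \<in> S"
    and X: "X = gamma3 \<omega>1 \<omega>2 \<alpha> \<beta> A \<mu> *v surface A \<mu> \<Psi> x y"
  shows "X $ 2 = - 2 / A^2 * e (of_real x)"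
    and "q_path \<omega>1 \<omega>2 \<alpha> \<beta> (of_real x) g \<Longrightarrow>
      X $ 3 = Q_coeff \<omega>1 \<omega>2 \<alpha> \<beta> A \<mu> (of_real x) * (X $ 1)^2 + R_coeff \<omega>1 \<omega>2 \<alpha> \<beta> A \<mu> g (of_real x)"
proof -
  define \<rho>1 :: "complex^3" where "\<rho>1 = vector [- (A / 2 * (\<mu> + A^2)), 1, - (A / 2 * (\<mu> + A^2))]"
  define \<rho>2 :: "complex^3" where "\<rho>2 = vector [A / 2, 0, - (A / 2)]"
  define \<rho>3 :: "complex^3" where "\<rho>3 = vector [A / 2, 0, A / 2]"
  let ?x = "complex_of_real x" and ?z = "Complex x y"
  let ?E = "mat_exp (?z *\<^sub>M potential_X A \<mu>)"
  define E where "E = e ?x"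
  have E: "E \<noteq> 0" unfolding E_def by (rule e_minus_facts(6)[OF x])
  note exps = parabolic_rows[OF N, folded \<rho>1_def \<rho>2_def \<rho>3_def]
  obtain r r1 where r: "\<And>x. x \<in> S \<Longrightarrow> (\<rho>3 v* \<Psi> x) $ 2 = e x * r x"
    "\<And>x. x \<in> S \<Longrightarrow> (r has_field_derivative r1 x) (at x)"
    "\<And>x. x \<in> S \<Longrightarrow> (r1 has_field_derivative 4 * A^2 / (e x)^3) (at x)"
    "r 0 = 0" "r1 0 = - 1"
    using row_quadrature[OF Psi N \<rho>3_def] by blast
  have "\<rho>1 = vector [A * (0 - \<mu> - A^2) / 2, 1, - (A * (0 + \<mu> + A^2) / 2)]"
    by (simp add: \<rho>1_def vec_eq_iff forall_3 field_simps)
  note u1 = row_e_minus[OF Psi _ x this]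
  have u: "(\<rho>1 v* \<Psi> ?x) $ 2 = E" "(\<rho>2 v* \<Psi> ?x) $ 2 = ?x * E" "(\<rho>3 v* \<Psi> ?x) $ 2 = E * r ?x"
    using u1 row_linear_multiple[OF Psi N x \<rho>2_def] r(1)[OF x] N by (simp_all add: E_def)
  have X': "X = (\<chi> j. ((vector [(- \<i>) *s \<rho>2, (- 2 / A^2) *s \<rho>1, \<rho>3] $ j v* ?E) v* \<Psi> ?x) $ 2)"
    unfolding X gamma3_rows[OF \<rho>1_def \<rho>2_def \<rho>3_def] gamma_surface by (simp add: vec_eq_iff)
  have sc: "(c *s w) v* B = c *s (w v* B)" for c w and B :: "complex^3^3"
    by (simp add: vec_eq_iff scaled_row)
  have "X $ 1 = ((((- \<i>) *s \<rho>2) v* ?E) v* \<Psi> ?x) $ 2" unfolding X' by simp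
  then have X1: "X $ 1 = - \<i> * (?x * E - ?z * E)"
    by (simp only: sc exps vector_matrix_mult_diff_distrib vector_smult_component vector_minus_component u)
  show X2: "X $ 2 = - 2 / A^2 * e (of_real x)"
  proof -
    have "X $ 2 = ((((- 2 / A^2) *s \<rho>1) v* ?E) v* \<Psi> ?x) $ 2" unfolding X' by simp
    then show ?thesis by (simp only: sc exps vector_smult_component u E_def)
  qed
  have X3: "X $ 3 = E * r ?x + ?z * (\<mu> - A^2) * (?x * E) - ?z^2 / 2 * (\<mu> - A^2) * E"
    unfolding X' by (simp add: sc exps vector_matrix_mult_diff_distrib vector_matrix_left_distrib u)
  assume g: "q_path \<omega>1 \<omega>2 \<alpha> \<beta> (of_real x) g"
  have Q: "Q_coeff \<omega>1 \<omega>2 \<alpha> \<beta> A \<mu> ?x = (\<mu> - A^2) / 2 * inverse E"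
    unfolding E_def e_inverse by (simp add: Q_coeff_def mult_ac)
  have R: "R_coeff \<omega>1 \<omega>2 \<alpha> \<beta> A \<mu> g ?x = E * ((\<mu> - A^2) / 2 * ?x^2 + r ?x)"
  proof -
    have "R_coeff \<omega>1 \<omega>2 \<alpha> \<beta> A \<mu> g ?x = E * ((\<mu> - A^2) / 2 * ?x^2 +
        (- ?x + 4 * A^2 * q_int \<omega>1 \<omega>2 \<alpha> \<beta> g ?x * (\<sigma> (\<beta> - \<alpha>) / \<sigma> \<beta>)^3))"
      unfolding R_coeff_def E_def by simp
    moreover have "r ?x = - ?x + 4 * A^2 * q_int \<omega>1 \<omega>2 \<alpha> \<beta> g ?x * (\<sigma> (\<beta> - \<alpha>) / \<sigma> \<beta>)^3"
      using quadrature_q_int[OF r(2-5) x g] .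
    ultimately show ?thesis by (simp only:)
  qed
  have "inverse E * (- \<i> * (?x * E - ?z * E))^2 = - ((?x - ?z)^2 * E)"
    using E by (simp add: power2_eq_square field_simps)
  then have QX: "Q_coeff \<omega>1 \<omega>2 \<alpha> \<beta> A \<mu> ?x * (X $ 1)^2 = (\<mu> - A^2) / 2 * (- ((?x - ?z)^2 * E))"
    unfolding Q X1 by (simp only: mult.assoc)
  show "X $ 3 = Q_coeff \<omega>1 \<omega>2 \<alpha> \<beta> A \<mu> ?x * (X $ 1)^2 + R_coeff \<omega>1 \<omega>2 \<alpha> \<beta> A \<mu> g ?x"
    unfolding X3 R QX by (simp add: power2_eq_square field_simps)
qed

end

theorem theorem4p10:
  fixes a m M :: real and k \<omega>1 \<omega>2 \<alpha> \<beta> A \<mu> :: complex and \<Psi> :: "complex \<Rightarrow> complex^3^3"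
  assumes "a > 0"
    and "3 * M = m^2 - 2 / a^2 - a^4"
    and "k = csqrt (complex_of_real (3 * M))"
    and "elliptic_data a m M \<omega>1 \<omega>2 \<alpha> \<beta>"
    and "Phi_inv_solution \<omega>1 \<omega>2 (complex_of_real a) (complex_of_real M) \<beta> \<Psi>"
    and "A = complex_of_real a" and "\<mu> = complex_of_real m"
  shows
    "(3 * M < 0 \<and> m \<noteq> a^2 \<longrightarrow>
        gamma1 A \<mu> k \<in> SL3R \<and>
        (\<forall>(x::real) (y::real) (X::complex^3).
           complex_of_real x \<notin> Lambda_tilde \<omega>1 \<omega>2 (complex_of_real M) \<beta> \<longrightarrow>
           X = gamma1 A \<mu> k *v surface A \<mu> \<Psi> x y \<longrightarrow>
           X $ 1 * X $ 3 = - 1 / (A^2 * k^2) * (e_minus \<omega>1 \<omega>2 \<alpha> \<beta> (complex_of_real x))^2 \<and>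
           X $ 2 = \<i> * (\<mu> - A^2) / k * e_plus \<omega>1 \<omega>2 \<alpha> \<beta> (complex_of_real x)))
     \<and> (3 * M > 0 \<longrightarrow>
        gamma2 A \<mu> k \<in> SL3R \<and>
        (\<forall>(x::real) (y::real) (X::complex^3).
           complex_of_real x \<notin> Lambda_tilde \<omega>1 \<omega>2 (complex_of_real M) \<beta> \<longrightarrow>
           X = gamma2 A \<mu> k *v surface A \<mu> \<Psi> x y \<longrightarrow>
           (X $ 1)^2 + (X $ 3)^2 = 4 / (A^2 * k^2) * (e_minus \<omega>1 \<omega>2 \<alpha> \<beta> (complex_of_real x))^2 \<and>
           X $ 2 = (\<mu> - A^2) / (2 * k) * e_plus \<omega>1 \<omega>2 \<alpha> \<beta> (complex_of_real x)))
     \<and> (3 * M = 0 \<longrightarrow>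
        gamma3 \<omega>1 \<omega>2 \<alpha> \<beta> A \<mu> \<in> SL3R \<and>
        (\<forall>(x::real) (y::real) (X::complex^3).
           complex_of_real x \<notin> Lambda_tilde \<omega>1 \<omega>2 (complex_of_real M) \<beta> \<longrightarrow>
           X = gamma3 \<omega>1 \<omega>2 \<alpha> \<beta> A \<mu> *v surface A \<mu> \<Psi> x y \<longrightarrow>
           (\<forall>g. q_path \<omega>1 \<omega>2 \<alpha> \<beta> (complex_of_real x) g \<longrightarrow>
              X $ 3 = Q_coeff \<omega>1 \<omega>2 \<alpha> \<beta> A \<mu> (complex_of_real x) * (X $ 1)^2
                      + R_coeff \<omega>1 \<omega>2 \<alpha> \<beta> A \<mu> g (complex_of_real x)) \<and>
           X $ 2 = - 2 / A^2 * e_minus \<omega>1 \<omega>2 \<alpha> \<beta> (complex_of_real x)))"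
proof -
  interpret delaunay_data a m M \<omega>1 \<omega>2 \<alpha> \<beta>
    using assms(1,2,4) by unfold_locales
  note A = \<open>A = complex_of_real a\<close> \<open>\<mu> = complex_of_real m\<close>
  note Psi = assms(5)
  have k2: "k^2 = 3 * complex_of_real M" using assms(3) by simp
  have S: "complex_of_real x \<in> S" if "complex_of_real x \<notin> Lambda_tilde \<omega>1 \<omega>2 (complex_of_real M) \<beta>" for x
    using that by (simp add: S_def)
  have muA: "complex_of_real m - complex_of_real a ^ 2 \<noteq> 0" if "m \<noteq> a^2"
    using that by (simp flip: of_real_power of_real_diff)
  show ?thesis
    unfolding A
  proof (intro conjI impI allI; (elim conjE)?)
    assume neg: "3 * M < 0" and m: "m \<noteq> a^2"
    have k: "k = \<i> * of_real (sqrt (- (3 * M)))" "sqrt (- (3 * M)) \<noteq> 0"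
      using neg assms(3) by (auto simp: csqrt_of_real_nonpos)
    show "gamma1 (of_real a) (of_real m) k \<in> SL3R"
      by (rule gamma1_SL3R[OF k2 k muA[OF m]])
    fix x y :: real and X :: "complex^3"
    assume x: "complex_of_real x \<notin> Lambda_tilde \<omega>1 \<omega>2 (complex_of_real M) \<beta>"
      and X: "X = gamma1 (of_real a) (of_real m) k *v surface (of_real a) (of_real m) \<Psi> x y"
    note comps = K1_surface_components[OF Psi k2 m S[OF x], of y]
    have prod: "(\<i> / k * (1 / c * u)) * (\<i> / k * (1 / c * w)) = - 1 / (c^2 * k^2) * (u * w)" for c u w
      by (simp add: power2_eq_square mult_ac)
    show "X $ 1 * X $ 3 = - 1 / ((of_real a)^2 * k^2) * (e_minus \<omega>1 \<omega>2 \<alpha> \<beta> (of_real x))^2"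
      unfolding X gamma1_def gamma_surface comps(1)[symmetric] prod[symmetric]
      by (simp add: matrix_vector_mult_def sum_3)
    show "X $ 2 = \<i> * (of_real m - (of_real a)^2) / k * e_plus \<omega>1 \<omega>2 \<alpha> \<beta> (of_real x)"
      unfolding X gamma1_def gamma_surface comps(2)[symmetric]
      by (simp add: matrix_vector_mult_def sum_3)
  next
    assume pos: "3 * M > 0"
    have m: "m \<noteq> a^2"
    proof
      assume "m = a^2"
      then have "3 * M = - (2 / a^2)" using assms(2) by (simp add: power_mult[symmetric])
      moreover have "2 / a^2 > 0" using assms(1) by simp
      ultimately show False using pos by linarith
    qed
    have k: "k = of_real (sqrt (3 * M))" "sqrt (3 * M) \<noteq> 0"
      using pos assms(3) by (auto simp: csqrt_of_real_nonneg)
    show "gamma2 (of_real a) (of_real m) k \<in> SL3R"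
      by (rule gamma2_SL3R[OF k2 k muA[OF m]])
    fix x y :: real and X :: "complex^3"
    assume x: "complex_of_real x \<notin> Lambda_tilde \<omega>1 \<omega>2 (complex_of_real M) \<beta>"
      and X: "X = gamma2 (of_real a) (of_real m) k *v surface (of_real a) (of_real m) \<Psi> x y"
    note comps = K1_surface_components[OF Psi k2 m S[OF x], of y]
    have k0: "k \<noteq> 0" using k by simp
    have sum: "(1 / (2 * k) * (2 / c * u + 2 / c * w))^2 + (1 / (2 * k) * (2 * \<i> / c * u - 2 * \<i> / c * w))^2 =
        4 / (c^2 * k^2) * (u * w)" for c u w
      by (simp add: power2_eq_square add_divide_distrib[symmetric] diff_divide_distrib[symmetric] algebra_simps)
    show "(X $ 1)^2 + (X $ 3)^2 = 4 / ((of_real a)^2 * k^2) * (e_minus \<omega>1 \<omega>2 \<alpha> \<beta> (of_real x))^2"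
      unfolding X gamma2_def gamma_surface comps(1)[symmetric] sum[symmetric]
      by (simp add: matrix_vector_mult_def sum_3)
    show "X $ 2 = (of_real m - (of_real a)^2) / (2 * k) * e_plus \<omega>1 \<omega>2 \<alpha> \<beta> (of_real x)"
      unfolding X gamma2_def gamma_surface comps(2)[symmetric]
      by (simp add: matrix_vector_mult_def sum_3)
  next
    assume "3 * M = 0"
    then have N: "complex_of_real M = 0" by simp
    show "gamma3 \<omega>1 \<omega>2 \<alpha> \<beta> (of_real a) (of_real m) \<in> SL3R" by (rule gamma3_SL3R)
    fix x y :: real and X :: "complex^3"
    assume x: "complex_of_real x \<notin> Lambda_tilde \<omega>1 \<omega>2 (complex_of_real M) \<beta>"
      and X: "X = gamma3 \<omega>1 \<omega>2 \<alpha> \<beta> (of_real a) (of_real m) *v surface (of_real a) (of_real m) \<Psi> x y"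
    note surf = gamma3_surface[OF Psi N S[OF x] X]
    show "X $ 2 = - 2 / (of_real a)^2 * e_minus \<omega>1 \<omega>2 \<alpha> \<beta> (of_real x)" by (rule surf(1))
    fix g assume g: "q_path \<omega>1 \<omega>2 \<alpha> \<beta> (of_real x) g"
    show "X $ 3 = Q_coeff \<omega>1 \<omega>2 \<alpha> \<beta> (of_real a) (of_real m) (of_real x) * (X $ 1)^2
        + R_coeff \<omega>1 \<omega>2 \<alpha> \<beta> (of_real a) (of_real m) g (of_real x)"
      by (rule surf(2)[OF g])
  qed
qed

end
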